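(* For any $\gamma>0$ and $k\in\mathbb{N}$ there exist a constant $d_{\gamma,k}$ and (for each $N$) a set $\Omega_{\gamma,k}\subseteq\Omega$, depending only on $\gamma$ and $k$, such that the following hold for all sufficiently large $N$. For any $k$-lukewarm start $\nu_N$ on $\mathbb{Z}_N\times\mathbb{Z}$ we have $$\nu_N(\Omega_{\gamma,k})\geq 1-N^{-\gamma}.$$ Moreover, for any $A_0,A_0'\in\Omega_{\gamma,k}$ with $|A_0|=|A_0'|$, writing $t_{\gamma,k}=d_{\gamma,k}N^2\log N$, we have $$\|P(t_{\gamma,k})-P'(t_{\gamma,k})\|_{TV}\leq N^{-\gamma},$$ where $(A(t))_{t\ge0}$ and $(A'(t))_{t\ge0}$ are IDLA processes starting from $A_0$ and $A_0'$ respectively, and $P(t)$ and $P'(t)$ denote the laws of $A(t)$ and $A'(t)$ respectively.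
   Context: Here $\mathbb{N}=\{0,1,2,\dots\}$. For an integer $N\ge 3$, $\mathbb{Z}_N\times\mathbb{Z}$ is the cylinder graph whose base graph is the cycle on $N$ vertices; level $k$ is $\mathbb{Z}_N\times\{k\}$ and $R_k=\{(x,y)\in\mathbb{Z}_N\times\mathbb{Z}: y\leq k\}$. Internal DLA (IDLA): the state space is $\Omega=\{A\subseteq\mathbb{Z}_N\times\mathbb{Z}: A=R_0\cup F\text{ for some finite }F\}$ (which depends on $N$). Given $A(0)\in\Omega$, for integers $t\ge1$ set $A(t)=A(t-1)\cup\{Z_t\}$, where $Z_t$ is the exit location from $A(t-1)$ (the first site visited outside $A(t-1)$) of a simple random walk on the cylinder graph started from a uniformly random site of level $0$, independent of the past. For non-integer $t\ge 0$ read $A(t)=A(\lfloor t\rfloor)$. Shifted IDLA: for $A\in\Omega$ let $k_A=\max\{k\ge0: R_k\subseteq A\}$ and let $\mathcal{S}(A)=\{(x,y-k_A):(x,y)\in A\}$. The shifted process is $A^*(t)=\mathcal{S}(A(t))$; it is a positive recurrent Markov chain and $\mu_N$ denotes its stationary distribution. A probability measure $\nu_N$ on $\Omega$ is a $k$-lukewarm start if $\nu_N(A)\leq N^k\mu_N(A)$ for all $A\in\Omega$. For $A\in\Omega$, $|A|=\#\{(x,y)\in A:y>0\}$ is the number of sites of $A$ strictly above level $0$. $\|P-Q\|_{TV}=\sup_{S}|P(S)-Q(S)|$ is total variation distance. *)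

theory Defs
  imports "HOL-Probability.Probability"
begin

text \<open>
  A vertex of the cylinder graph over the cycle on \<open>N\<close> vertices is a pair \<open>(x, y)\<close> of integers
  with \<open>0 \<le> x < N\<close>; the first coordinate is the canonical representative of a residue
  class modulo \<open>N\<close>. All constants take \<open>N\<close> as an argument and are meant for \<open>N \<ge> 3\<close>.
\<close>

type_synonym site = "int \<times> int"

definition cylinder :: "nat \<Rightarrow> site set" where
  "cylinder N = {0..<int N} \<times> UNIV"

definition cyl_adj :: "nat \<Rightarrow> site \<Rightarrow> site \<Rightarrow> bool" where
  "cyl_adj N v w \<longleftrightarrow> v \<in> cylinder N \<and> w \<in> cylinder N \<and>
     (snd v = snd w \<and> (fst w = (fst v + 1) mod int N \<or> fst v = (fst w + 1) mod int N)
      \<or> fst v = fst w \<and> \<bar>snd v - snd w\<bar> = 1)"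

definition level :: "nat \<Rightarrow> int \<Rightarrow> site set" where
  "level N k = {(x, y) \<in> cylinder N. y = k}"

definition filled :: "nat \<Rightarrow> int \<Rightarrow> site set" where
  "filled N k = {(x, y) \<in> cylinder N. y \<le> k}"

definition configs :: "nat \<Rightarrow> site set set" where
  "configs N = {filled N 0 \<union> F | F. finite F \<and> F \<subseteq> cylinder N}"

definition config_size :: "site set \<Rightarrow> nat" where
  "config_size A = card {(x, y) \<in> A. y > 0}"


text \<open>
  A sample point of the simple random walk is a starting site together with an infinite
  sequence of increments, the increments being independent and uniform on the four unit vectors.
  The starting site lives on the measurable space \<open>level N 0\<close>, so that every trajectory, not only
  almost every one, stays on the cylinder and \<open>idla\<close> below never leaves \<open>configs N\<close>.
\<close>

definition unit_steps :: "(int \<times> int) set" where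
  "unit_steps = {(1, 0), (-1, 0), (0, 1), (0, -1)}"

fun move :: "nat \<Rightarrow> site \<Rightarrow> int \<times> int \<Rightarrow> site" where
  "move N (x, y) (dx, dy) = ((x + dx) mod int N, y + dy)"

type_synonym walk_sample = "site \<times> (nat \<Rightarrow> int \<times> int)"

definition walk_space :: "nat \<Rightarrow> walk_sample measure" where
  "walk_space N = uniform_count_measure (level N 0) \<Otimes>\<^sub>M
     (\<Pi>\<^sub>M _ \<in> (UNIV :: nat set). measure_pmf (pmf_of_set unit_steps))"

primrec walk :: "nat \<Rightarrow> walk_sample \<Rightarrow> nat \<Rightarrow> site" where
  "walk N w 0 = fst w"
| "walk N w (Suc n) = move N (walk N w n) (snd w n)"

text \<open>
  For a configuration \<open>A\<close> the walk leaves \<open>A\<close> almost surely, so the value of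
  \<open>exit_site N A w\<close> on samples that never leave \<open>A\<close> is immaterial.
\<close>

definition exit_site :: "nat \<Rightarrow> site set \<Rightarrow> walk_sample \<Rightarrow> site" where
  "exit_site N A w = walk N w (LEAST n. walk N w n \<notin> A)"


text \<open>The \<open>t\<close>-th component of a sample point drives the particle released at time \<open>t + 1\<close>.\<close>

definition idla_space :: "nat \<Rightarrow> (nat \<Rightarrow> walk_sample) measure" where
  "idla_space N = (\<Pi>\<^sub>M _ \<in> (UNIV :: nat set). walk_space N)"

primrec idla :: "nat \<Rightarrow> site set \<Rightarrow> (nat \<Rightarrow> walk_sample) \<Rightarrow> nat \<Rightarrow> site set" where
  "idla N A \<omega> 0 = A"
| "idla N A \<omega> (Suc t) = idla N A \<omega> t \<union> {exit_site N (idla N A \<omega> t) (\<omega> t)}"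

definition idla_law :: "nat \<Rightarrow> site set \<Rightarrow> real \<Rightarrow> site set measure" where
  "idla_law N A t = distr (idla_space N) (count_space (configs N)) (\<lambda>\<omega>. idla N A \<omega> (nat \<lfloor>t\<rfloor>))"

definition tv_dist :: "'a measure \<Rightarrow> 'a measure \<Rightarrow> real" where
  "tv_dist P Q = (SUP S \<in> sets P. \<bar>measure P S - measure Q S\<bar>)"


definition full_height :: "nat \<Rightarrow> site set \<Rightarrow> nat" where
  "full_height N A = Max {k. filled N (int k) \<subseteq> A}"

definition shift_down :: "nat \<Rightarrow> site set \<Rightarrow> site set" where
  "shift_down N A = (\<lambda>(x, y). (x, y - int (full_height N A))) ` A"

definition config_distribution :: "nat \<Rightarrow> site set measure \<Rightarrow> bool" where
  "config_distribution N \<nu> \<longleftrightarrow> prob_space \<nu> \<and> sets \<nu> = Pow (configs N)"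

text \<open>
  Stationarity for the shifted chain: if \<open>A(0)\<close> has law \<open>\<mu>\<close> and is independent of the walks,
  then the shift of \<open>A(1)\<close> has law \<open>\<mu>\<close> again. Since every shifted configuration is fixed by
  \<open>shift_down\<close>, such a \<open>\<mu>\<close> is automatically carried by shifted configurations, on which
  \<open>A \<mapsto> shift_down (A(1))\<close> is one step of the shifted chain. The chain is positive recurrent, so
  for \<open>N \<ge> 3\<close> exactly one \<open>\<mu>\<close> has this property.
\<close>

definition stationary_shifted_idla :: "nat \<Rightarrow> site set measure \<Rightarrow> bool" where
  "stationary_shifted_idla N \<mu> \<longleftrightarrow> config_distribution N \<mu> \<and>
     distr (\<mu> \<Otimes>\<^sub>M idla_space N) (count_space (configs N))
       (\<lambda>(A, \<omega>). shift_down N (idla N A \<omega> 1)) = \<mu>"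

definition lukewarm_start :: "nat \<Rightarrow> nat \<Rightarrow> site set measure \<Rightarrow> site set measure \<Rightarrow> bool" where
  "lukewarm_start N k \<mu> \<nu> \<longleftrightarrow> config_distribution N \<nu> \<and>
     (\<forall>A \<in> configs N. measure \<nu> {A} \<le> real N ^ k * measure \<mu> {A})"


text \<open>
  Consistency of the encoding: the walk moves to a uniformly random neighbour, and the laws
  above are push-forwards along measurable maps.
\<close>

lemma map_pmf_move_eq_uniform_neighbour:
  assumes "N \<ge> 3" "v \<in> cylinder N"
  shows "map_pmf (move N v) (pmf_of_set unit_steps) = pmf_of_set {w. cyl_adj N v w}"
proof -
  obtain x y where v: "v = (x, y)" and x: "0 \<le> x" "x < int N"
    using assms(2) by (auto simp: cylinder_def)
  have p1: "(x + 1) mod int N = (if x = int N - 1 then 0 else x + 1)"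
    using x assms(1) by (auto intro: mod_pos_pos_trivial)
  have m1: "(x - 1) mod int N = (if x = 0 then int N - 1 else x - 1)"
    using x assms(1) by (auto simp: zmod_minus1 intro: mod_pos_pos_trivial)
  have m2: "(-1) mod int N = int N - 1"
    using assms(1) by (simp add: zmod_minus1)
  have q1: "(z + 1) mod int N = (if z = int N - 1 then 0 else z + 1)" if "0 \<le> z" "z < int N" for z
    using that assms(1) by (auto intro: mod_pos_pos_trivial)
  have "inj_on (move N v) unit_steps"
    using x assms(1) by (auto simp: inj_on_def unit_steps_def v p1 m1 split: if_splits)
  moreover have "move N v ` unit_steps = {w. cyl_adj N v w}"
  proof -
    have "move N v ` unit_steps =
        {((x + 1) mod int N, y), ((x - 1) mod int N, y), (x, y + 1), (x, y - 1)}"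
      using x by (auto simp: unit_steps_def v)
    also have "\<dots> = {w. cyl_adj N v w}"
    proof (intro set_eqI iffI)
      fix w assume "w \<in> {((x + 1) mod int N, y), ((x - 1) mod int N, y), (x, y + 1), (x, y - 1)}"
      then show "w \<in> {w. cyl_adj N v w}"
        using x assms(1) by (auto simp: cyl_adj_def cylinder_def v p1 m1 m2 q1 split: if_splits)
    next
      fix w assume w: "w \<in> {w. cyl_adj N v w}"
      obtain a b where ab: "w = (a, b)" by fastforce
      have a: "0 \<le> a" "a < int N" using w by (auto simp: cyl_adj_def cylinder_def ab)
      have "a = (x - 1) mod int N" if "x = (a + 1) mod int N"
        unfolding that using a by (simp add: mod_diff_left_eq)
      moreover have "b = y + 1 \<or> b = y - 1" if "\<bar>y - b\<bar> = 1" using that by arith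
      moreover have "y = b \<and> (a = (x + 1) mod int N \<or> x = (a + 1) mod int N)
          \<or> x = a \<and> \<bar>y - b\<bar> = 1"
        using w unfolding cyl_adj_def v ab by simp
      ultimately show "w \<in> {((x + 1) mod int N, y), ((x - 1) mod int N, y), (x, y + 1), (x, y - 1)}"
        unfolding ab insert_iff prod.inject by metis
    qed
    finally show ?thesis .
  qed
  ultimately show ?thesis
    by (subst map_pmf_of_set_inj) (auto simp: unit_steps_def)
qed

lemma countable_configs: "countable (configs N)"
proof -
  have "configs N = (\<lambda>F. filled N 0 \<union> F) ` {F. finite F \<and> F \<subseteq> cylinder N}"
    by (auto simp: configs_def)
  moreover have "countable {F. finite F \<and> F \<subseteq> cylinder N}"
    by (rule countable_subset[OF _ countable_Collect_finite]) auto
  ultimately show ?thesis by simp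
qed

lemma move_in_cylinder: "N > 0 \<Longrightarrow> move N v d \<in> cylinder N"
  by (cases v; cases d) (auto simp: cylinder_def)

lemma insert_configs: "A \<in> configs N \<Longrightarrow> z \<in> cylinder N \<Longrightarrow> A \<union> {z} \<in> configs N"
proof -
  assume "A \<in> configs N" and z: "z \<in> cylinder N"
  then obtain F where F: "finite F" "F \<subseteq> cylinder N" "A = filled N 0 \<union> F"
    by (auto simp: configs_def)
  then have "A \<union> {z} = filled N 0 \<union> insert z F" "finite (insert z F)" "insert z F \<subseteq> cylinder N"
    using z by auto
  then show ?thesis unfolding configs_def by blast
qed


lemma finite_level: "finite (level N k)"
  by (rule finite_subset[of _ "{0..<int N} \<times> {k}"]) (auto simp: level_def cylinder_def)

lemma level_nonempty: "N > 0 \<Longrightarrow> level N k \<noteq> {}"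
proof -
  assume "N > 0"
  then have "(0, k) \<in> level N k" by (auto simp: level_def cylinder_def)
  then show ?thesis by blast
qed

lemma prob_space_walk_space: "N > 0 \<Longrightarrow> prob_space (walk_space N)"
  unfolding walk_space_def
  by (intro prob_space_pair prob_space_uniform_count_measure prob_space_PiM
        measure_pmf.prob_space_axioms finite_level level_nonempty)

lemma prob_space_idla_space: "N > 0 \<Longrightarrow> prob_space (idla_space N)"
  unfolding idla_space_def by (intro prob_space_PiM prob_space_walk_space)

lemma walk_in_cylinder: "N > 0 \<Longrightarrow> w \<in> space (walk_space N) \<Longrightarrow> walk N w n \<in> cylinder N"
  by (cases n)
     (auto simp: move_in_cylinder walk_space_def space_pair_measure space_uniform_count_measure level_def)

lemma exit_site_in_cylinder:
  "N > 0 \<Longrightarrow> w \<in> space (walk_space N) \<Longrightarrow> exit_site N A w \<in> cylinder N"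
  by (simp add: exit_site_def walk_in_cylinder)

lemma measurable_walk: "(\<lambda>w. walk N w n) \<in> walk_space N \<rightarrow>\<^sub>M count_space UNIV"
proof (induction n)
  case 0
  have "fst \<in> walk_space N \<rightarrow>\<^sub>M uniform_count_measure (level N 0)"
    unfolding walk_space_def by (rule measurable_fst)
  moreover have "(\<lambda>v. v) \<in> uniform_count_measure (level N 0) \<rightarrow>\<^sub>M count_space UNIV"
    by (auto simp: measurable_def space_uniform_count_measure sets_uniform_count_measure)
  ultimately have "(\<lambda>w. fst w) \<in> walk_space N \<rightarrow>\<^sub>M count_space UNIV"
    by (rule measurable_compose)
  then show ?case by simp
next
  case (Suc n)
  have 1: "(\<lambda>w. snd w n) \<in> walk_space N \<rightarrow>\<^sub>M count_space UNIV"
    unfolding walk_space_def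
    by (rule measurable_compose[OF measurable_snd])
       (rule measurable_compose[OF measurable_component_singleton], simp_all)
  show ?case
    unfolding walk.simps
    by (rule measurable_compose_countable[OF _ Suc], rule measurable_compose[OF 1]) simp
qed

lemma measurable_exit_site: "exit_site N A \<in> walk_space N \<rightarrow>\<^sub>M count_space UNIV"
proof -
  note measurable_walk[measurable]
  have "(\<lambda>w. LEAST n. walk N w n \<notin> A) \<in> walk_space N \<rightarrow>\<^sub>M count_space UNIV"
  proof (rule measurable_Least)
    fix n
    show "Measurable.pred (walk_space N) (\<lambda>w. walk N w n \<notin> A)"
      by (rule measurable_compose[OF measurable_walk]) simp
  qed
  then show ?thesis
    unfolding exit_site_def by (rule measurable_compose_countable[OF measurable_walk])
qed

lemma measurable_idla:
  assumes "N > 0" "A \<in> configs N"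
  shows "(\<lambda>\<omega>. idla N A \<omega> t) \<in> idla_space N \<rightarrow>\<^sub>M count_space (configs N)"
proof (induction t)
  case 0
  then show ?case using assms by simp
next
  case (Suc t)
  have 1: "(\<lambda>\<omega>. \<omega> t) \<in> idla_space N \<rightarrow>\<^sub>M walk_space N"
    unfolding idla_space_def by (rule measurable_component_singleton) simp
  show ?case
    unfolding idla.simps
  proof (rule measurable_compose_countable'[OF _ Suc countable_configs])
    fix B assume B: "B \<in> configs N"
    have "(\<lambda>w. exit_site N B w) \<in> walk_space N \<rightarrow>\<^sub>M count_space (cylinder N)"
      using measurable_exit_site[of N B] exit_site_in_cylinder[OF assms(1), of _ B]
      by (auto simp: measurable_def)
    moreover have "(\<lambda>z. B \<union> {z}) \<in> count_space (cylinder N) \<rightarrow>\<^sub>M count_space (configs N)"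
      using insert_configs[OF B] by auto
    ultimately have "(\<lambda>w. B \<union> {exit_site N B w}) \<in> walk_space N \<rightarrow>\<^sub>M count_space (configs N)"
      by (rule measurable_compose)
    then show "(\<lambda>\<omega>. B \<union> {exit_site N B (\<omega> t)}) \<in> idla_space N \<rightarrow>\<^sub>M count_space (configs N)"
      by (rule measurable_compose[OF 1])
  qed
qed

lemma prob_space_idla_law: "N > 0 \<Longrightarrow> A \<in> configs N \<Longrightarrow> prob_space (idla_law N A t)"
  unfolding idla_law_def
  by (intro prob_space.prob_space_distr prob_space_idla_space measurable_idla)

lemma full_height:
  assumes "N > 0" "A \<in> configs N"
  shows "filled N (int (full_height N A)) \<subseteq> A" "finite {k. filled N (int k) \<subseteq> A}"
proof -
  obtain F where F: "finite F" "A = filled N 0 \<union> F"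
    using assms by (auto simp: configs_def)
  have "{k. filled N (int k) \<subseteq> A} \<subseteq> insert 0 ((\<lambda>z. nat (snd z)) ` F)"
  proof
    fix k assume "k \<in> {k. filled N (int k) \<subseteq> A}"
    moreover have "(0, int k) \<in> filled N (int k)"
      using assms by (auto simp: filled_def cylinder_def)
    ultimately have "(0, int k) \<in> A" by blast
    then have "k = 0 \<or> (0, int k) \<in> F" using F by (auto simp: filled_def)
    then show "k \<in> insert 0 ((\<lambda>z. nat (snd z)) ` F)" by force
  qed
  then show fin: "finite {k. filled N (int k) \<subseteq> A}"
    using F(1) by (meson finite.insertI finite_imageI finite_subset)
  have "0 \<in> {k. filled N (int k) \<subseteq> A}" using F by simp
  then have "{k. filled N (int k) \<subseteq> A} \<noteq> {}" by blast
  then have "full_height N A \<in> {k. filled N (int k) \<subseteq> A}"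
    unfolding full_height_def by (rule Max_in[OF fin])
  then show "filled N (int (full_height N A)) \<subseteq> A" by simp
qed

lemma shift_down_in_configs:
  assumes "N > 0" "A \<in> configs N"
  shows "shift_down N A \<in> configs N"
proof -
  define h where "h = int (full_height N A)"
  define s where "s = (\<lambda>(x, y). (x, y - h) :: site)"
  obtain F where F: "finite F" "F \<subseteq> cylinder N" "A = filled N 0 \<union> F"
    using assms by (auto simp: configs_def)
  have h: "filled N h \<subseteq> A" "h \<ge> 0" using full_height(1)[OF assms] by (simp_all add: h_def)
  have "filled N 0 \<subseteq> s ` A"
  proof
    fix z assume "z \<in> filled N 0"
    then have "(fst z, snd z + h) \<in> filled N h" by (auto simp: filled_def cylinder_def)
    then have "(fst z, snd z + h) \<in> A" using h by blast
    then have "s (fst z, snd z + h) \<in> s ` A" by (rule imageI)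
    then show "z \<in> s ` A" by (simp add: s_def)
  qed
  moreover have "s ` filled N 0 \<subseteq> filled N 0"
    using h(2) by (auto simp: s_def filled_def cylinder_def)
  moreover have "s ` A = s ` filled N 0 \<union> s ` F" unfolding F(3) by (rule image_Un)
  ultimately have "shift_down N A = filled N 0 \<union> s ` F"
    unfolding shift_down_def s_def[symmetric] h_def[symmetric] by (metis (no_types) Un_absorb2 Un_assoc Un_commute sup.orderE)
  moreover have "finite (s ` F)" using F(1) by (rule finite_imageI)
  moreover have "s ` F \<subseteq> cylinder N"
  proof (rule image_subsetI)
    fix z assume "z \<in> F"
    then have "z \<in> cylinder N" using F(2) by (rule rev_subsetD)
    then show "s z \<in> cylinder N" by (cases z) (simp add: s_def cylinder_def)
  qed
  ultimately show ?thesis unfolding configs_def by (intro CollectI exI[of _ "s ` F"] conjI)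
qed

lemma measurable_shifted_idla:
  assumes "N > 0" "sets \<mu> = Pow (configs N)"
  shows "(\<lambda>(A, \<omega>). shift_down N (idla N A \<omega> t))
    \<in> \<mu> \<Otimes>\<^sub>M idla_space N \<rightarrow>\<^sub>M count_space (configs N)"
proof -
  have "sets (\<mu> \<Otimes>\<^sub>M idla_space N) = sets (count_space (configs N) \<Otimes>\<^sub>M idla_space N)"
    using assms by (intro sets_pair_measure_cong) auto
  moreover have "(\<lambda>p. shift_down N (idla N (fst p) (snd p) t))
    \<in> count_space (configs N) \<Otimes>\<^sub>M idla_space N \<rightarrow>\<^sub>M count_space (configs N)"
  proof (rule measurable_pair_measure_countable1[OF countable_configs])
    fix A assume A: "A \<in> configs N"
    have "shift_down N \<in> count_space (configs N) \<rightarrow>\<^sub>M count_space (configs N)"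
      using shift_down_in_configs[OF assms(1)] by auto
    from measurable_compose[OF measurable_idla[OF assms(1) A] this]
    show "(\<lambda>y. shift_down N (idla N (fst (A, y)) (snd (A, y)) t)) \<in> idla_space N \<rightarrow>\<^sub>M count_space (configs N)"
      by simp
  qed
  ultimately show ?thesis
    unfolding case_prod_unfold by (subst measurable_cong_sets[OF _ refl])
qed

end

theory Submission imports Defs begin

text \<open>
  By the Abelian property, the law of \<open>A(t)\<close> started from \<open>A\<^sub>0\<close> is that of a flat-started cluster
  \<open>W(t)\<close> into which one further particle is released from each site of \<open>A\<^sub>0\<close> above level \<open>0\<close>. If
  \<open>A\<^sub>0\<close> lies below a height of order \<open>N log N\<close> and \<open>W(t)\<close> fills a constant multiple of that height,
  these particles are equidistributed on their level up to a polynomially small error before they can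
  leave the filled part, so they may be replaced by particles started uniformly on level \<open>0\<close>: the law
  of \<open>A(t)\<close> depends on \<open>A\<^sub>0\<close> only through its size.

  It remains to see that stationary configurations are that low. The flat-started cluster fills
  \<open>R H\<close> by an exponential supermartingale built from the probability of hitting a vacant site, and
  the few particles exceeding the volume of \<open>R H\<close> do not climb far. Hence a configuration of height
  \<open>M\<close>, for any \<open>M\<close> above order \<open>N log N\<close>, has height at most \<open>M / 2\<close> after shifting at time
  \<open>4 N M\<close>, up to an error decaying exponentially in \<open>M / N\<close>. Stationarity turns this into
  \<open>\<mu> (height > M / 2) \<le> \<mu> (height > M) + error\<close>, which is summed over \<open>M, 2 M, 4 M, \<dots>\<close>.
\<close>

text \<open>Apart from the constant mode, every horizontal Fourier mode of a harmonic function
  decays by at least \<open>exp (- 1 / N)\<close> per level. So order N log N levels make a particle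
  uniform up to a power of N, and filling that many levels takes order N^2 log N particles, which is
  the time scale of the theorem. A lukewarm start costs a factor N^k, paid for by a larger multiple
  of N log N.

  The walk lives in an infinite half-cylinder. Almost sure exit, the strong Markov property,
  optional stopping and the Abelian property are all derived from one fact: a bounded Dirichlet
  problem there has a unique solution. Summing over levels reduces this to bounded convex sequences
  on a half-line.

  No moment of the stationary law is known beforehand. The comparison of heights M / 2 and M still
  closes, because every single configuration has finite height and the tail therefore tends to zero
  along doubling heights. Halving the height requires a sharp inner bound: the particles in excess
  of the filled volume must amount to a small fraction of M levels.\<close>

locale cyl =
  fixes N :: nat
  assumes N3: "N \<ge> 3"
begin

abbreviation sites :: "site set" where
  "sites \<equiv> cylinder N"

abbreviation steps :: "(int \<times> int) pmf" where
  "steps \<equiv> pmf_of_set unit_steps"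

section \<open>Neighbour averages, level sums and a maximum principle on the half-cylinder\<close>

definition avg :: "(site \<Rightarrow> real) \<Rightarrow> site \<Rightarrow> real" where
  "avg f v = measure_pmf.expectation steps (\<lambda>d. f (move N v d))"

definition row_sum :: "(site \<Rightarrow> real) \<Rightarrow> int \<Rightarrow> real" where
  "row_sum f y = (\<Sum>x\<in>{0..<int N}. f (x, y))"

lemma unit_steps_simps [simp]:
  "finite unit_steps" "unit_steps \<noteq> {}" "card unit_steps = 4"
  by (auto simp: unit_steps_def)

lemma avg_eq:
  "avg f (x, y) = (f ((x + 1) mod int N, y) + f ((x - 1) mod int N, y)
     + f (x mod int N, y + 1) + f (x mod int N, y - 1)) / 4"
proof -
  have "avg f (x, y) = (\<Sum>d\<in>unit_steps. f (move N (x, y) d)) / 4"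
    unfolding avg_def by (subst integral_pmf_of_set) auto
  then show ?thesis by (simp add: unit_steps_def)
qed

lemma row_sum_shift:
  "(\<Sum>x\<in>{0..<int N}. f ((x + c) mod int N)) = (\<Sum>x\<in>{0..<int N}. f x)" for f :: "int \<Rightarrow> real"
proof (rule sum.reindex_bij_witness[of _ "\<lambda>x. (x - c) mod int N" "\<lambda>x. (x + c) mod int N"])
  fix a assume "a \<in> {0..<int N}"
  then show "((a + c) mod int N - c) mod int N = a" "((a - c) mod int N + c) mod int N = a"
    by (simp_all add: mod_diff_left_eq mod_add_left_eq)
qed (use N3 in auto)

text \<open>By rotation invariance both horizontal neighbours contribute the level itself, so level
  sums of a harmonic function solve a one-dimensional equation. The uniqueness arguments on the
  cylinder pass through this projection.\<close>

lemma row_sum_avg: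
  "row_sum (avg f) y = (2 * row_sum f y + row_sum f (y + 1) + row_sum f (y - 1)) / 4"
proof -
  have "row_sum (avg f) y = ((\<Sum>x\<in>{0..<int N}. f ((x + 1) mod int N, y)) +
      (\<Sum>x\<in>{0..<int N}. f ((x + (-1)) mod int N, y)) +
      (\<Sum>x\<in>{0..<int N}. f (x mod int N, y + 1)) + (\<Sum>x\<in>{0..<int N}. f (x mod int N, y - 1))) / 4"
    unfolding row_sum_def avg_eq by (simp add: sum.distrib flip: sum_divide_distrib)
  also have "(\<Sum>x\<in>{0..<int N}. f (x mod int N, y + 1)) = row_sum f (y + 1)"
    unfolding row_sum_def by (intro sum.cong) auto
  also have "(\<Sum>x\<in>{0..<int N}. f (x mod int N, y - 1)) = row_sum f (y - 1)"
    unfolding row_sum_def by (intro sum.cong) auto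
  finally show ?thesis
    by (subst (asm) (1 2) row_sum_shift[of "\<lambda>x. f (x, y)"]) (simp add: row_sum_def)
qed

lemma mem_sites: "(x, y) \<in> sites \<longleftrightarrow> 0 \<le> x \<and> x < int N"
  by (auto simp: cylinder_def)

lemma move_sites [simp]: "move N v d \<in> sites"
  using N3 by (intro move_in_cylinder) auto

end

text \<open>If the sequence dropped by \<open>e\<close> from j to j + 1, convexity would propagate a
  slope of at least that size to all lower indices, and the values would grow linearly towards minus
  infinity.\<close>

lemma convex_bounded_mono:
  fixes \<phi> :: "int \<Rightarrow> real"
  assumes "\<And>j. j \<le> M \<Longrightarrow> 2 * \<phi> j \<le> \<phi> (j + 1) + \<phi> (j - 1)" "\<And>j. \<phi> j \<le> B" "j \<le> M"
  shows "\<phi> j \<le> \<phi> (j + 1)"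
proof (rule ccontr)
  assume neg: "\<not> ?thesis"
  define e where "e = \<phi> j - \<phi> (j + 1)"
  have e: "e > 0" using neg by (simp add: e_def)
  have *: "\<phi> (j - int n) - \<phi> (j - int n + 1) \<ge> e \<and> \<phi> (j - int n) \<ge> \<phi> j + real n * e" for n
  proof (induction n)
    case 0 then show ?case by (simp add: e_def)
  next
    case (Suc n)
    have "2 * \<phi> (j - int n) \<le> \<phi> (j - int n + 1) + \<phi> (j - int n - 1)"
      using assms(1)[of "j - int n"] assms(3) by auto
    then show ?case using Suc by (auto simp: algebra_simps)
  qed
  obtain n where "real n * e > B - \<phi> j" using e reals_Archimedean3 by blast
  with *[of n] assms(2)[of "j - int n"] show False by auto
qed

text \<open>Both the sequence and its negative are convex, so \<open>convex_bounded_mono\<close>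
  makes it monotone in both directions.\<close>

lemma harmonic_bounded_const:
  fixes \<phi> :: "int \<Rightarrow> real"
  assumes "\<And>j. j \<le> M \<Longrightarrow> 2 * \<phi> j = \<phi> (j + 1) + \<phi> (j - 1)" "\<And>j. \<bar>\<phi> j\<bar> \<le> B" "j \<le> M + 1"
  shows "\<phi> j = \<phi> (M + 1)"
proof -
  have up: "\<phi> i = \<phi> (i + 1)" if "i \<le> M" for i
  proof (rule antisym)
    show "\<phi> i \<le> \<phi> (i + 1)"
      by (rule convex_bounded_mono[of M _ B])
         (use assms(1,2) that in \<open>auto simp: abs_le_iff\<close>)
    have "- \<phi> i \<le> - \<phi> (i + 1)"
    proof (rule convex_bounded_mono[of M "\<lambda>i. - \<phi> i" B])
      fix k show "2 * - \<phi> k \<le> - \<phi> (k + 1) + - \<phi> (k - 1)" if "k \<le> M"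
        using assms(1)[OF that] by simp
      show "- \<phi> k \<le> B" using assms(2)[of k] by (simp add: abs_le_iff)
    qed fact
    then show "\<phi> (i + 1) \<le> \<phi> i" by simp
  qed
  have "\<phi> (M + 1 - int n) = \<phi> (M + 1)" for n
  proof (induction n)
    case (Suc n)
    then show ?case using up[of "M - int n"] by (simp add: algebra_simps)
  qed simp
  from this[of "nat (M + 1 - j)"] show ?thesis using assms(3) by simp
qed

context cyl
begin

text \<open>The level sums are bounded and convex up to level M, hence nondecreasing, and they
  vanish at M + 1. A nonnegative function whose level sums are at most 0 is zero. Applied to the
  difference of two bounded solutions this gives uniqueness for the Dirichlet problem.\<close>

lemma subharmonic_bounded_zero:
  fixes g :: "site \<Rightarrow> real"
  assumes pos: "\<And>v. v \<in> sites \<Longrightarrow> 0 \<le> g v" and bd: "\<And>v. v \<in> sites \<Longrightarrow> g v \<le> B"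
    and sub: "\<And>v. v \<in> sites \<Longrightarrow> snd v \<le> M \<Longrightarrow> g v \<le> avg g v"
    and zero: "\<And>v. v \<in> sites \<Longrightarrow> snd v > M \<Longrightarrow> g v = 0"
    and v: "v \<in> sites"
  shows "g v = 0"
proof -
  define \<phi> where "\<phi> = row_sum g"
  have \<phi>0: "\<phi> j \<ge> 0" for j
    unfolding \<phi>_def row_sum_def by (intro sum_nonneg pos) (auto simp: mem_sites)
  have "\<phi> j \<le> \<phi> (j + 1)" if "j \<le> M" for j
  proof (rule convex_bounded_mono[of M _ "real N * B"])
    fix k assume "k \<le> M"
    have "row_sum g k \<le> row_sum (avg g) k"
      unfolding row_sum_def using \<open>k \<le> M\<close> by (intro sum_mono sub) (auto simp: mem_sites)
    then show "2 * \<phi> k \<le> \<phi> (k + 1) + \<phi> (k - 1)"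
      unfolding row_sum_avg \<phi>_def by simp
  next
    fix k
    have "\<phi> k \<le> (\<Sum>x\<in>{0..<int N}. B)"
      unfolding \<phi>_def row_sum_def by (intro sum_mono bd) (auto simp: mem_sites)
    then show "\<phi> k \<le> real N * B" by simp
  qed fact
  moreover have "\<phi> (M + 1) = 0"
    unfolding \<phi>_def row_sum_def by (intro sum.neutral ballI zero) (auto simp: mem_sites)
  ultimately have *: "\<phi> (M + 1 - int n) \<le> 0" for n
  proof (induction n)
    case (Suc n)
    from Suc.prems(1)[of "M - int n"] Suc show ?case by (simp add: algebra_simps)
  qed simp
  show ?thesis
  proof (cases "snd v \<le> M")
    case True
    obtain x y where xy: "v = (x, y)" by fastforce
    have "\<phi> y \<le> 0" using *[of "nat (M + 1 - y)"] True xy by simp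
    with \<phi>0[of y] have "(\<Sum>x\<in>{0..<int N}. g (x, y)) = 0" by (simp add: \<phi>_def row_sum_def)
    then have "\<forall>x\<in>{0..<int N}. g (x, y) = 0"
      by (subst (asm) sum_nonneg_eq_0_iff) (auto intro: pos simp: mem_sites)
    then show ?thesis using v xy by (auto simp: mem_sites)
  qed (use zero v in auto)
qed

end

section \<open>The exit distribution\<close>

text \<open>The Markov property at the first step: an independent, identically distributed sequence
  splits into its first entry and a rest of the same law. It serves both for the increments of one
  walk and for the walks that drive IDLA.\<close>

lemma (in sequence_space) emeasure_case_nat:
  assumes "X \<in> sets S"
  shows "emeasure S X = (\<integral>\<^sup>+ s. emeasure S {\<omega> \<in> space S. case_nat s \<omega> \<in> X} \<partial>M)"
proof -
  have m: "(\<lambda>(s, \<omega>). case_nat s \<omega>) \<in> M \<Otimes>\<^sub>M S \<rightarrow>\<^sub>M S"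
    by measurable
  have "emeasure S X = emeasure (distr (M \<Otimes>\<^sub>M S) S (\<lambda>(s, \<omega>). case_nat s \<omega>)) X"
    by (simp add: PiM_iter)
  also have "\<dots> = emeasure (M \<Otimes>\<^sub>M S) ((\<lambda>(s, \<omega>). case_nat s \<omega>) -` X \<inter> space (M \<Otimes>\<^sub>M S))"
    by (rule emeasure_distr[OF m assms])
  also have "\<dots> = (\<integral>\<^sup>+ s. emeasure S (Pair s -` ((\<lambda>(s, \<omega>). case_nat s \<omega>) -` X \<inter> space (M \<Otimes>\<^sub>M S))) \<partial>M)"
    by (rule P.emeasure_pair_measure_alt) (use m assms in measurable)
  also have "\<dots> = (\<integral>\<^sup>+ s. emeasure S {\<omega> \<in> space S. case_nat s \<omega> \<in> X} \<partial>M)"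
    by (intro nn_integral_cong arg_cong2[of _ _ _ _ emeasure]) (auto simp: space_pair_measure)
  finally show ?thesis .
qed

lemma countable_prob_space_pmf:
  fixes M :: "'a :: countable measure"
  assumes "prob_space M" "sets M = UNIV"
  shows "measure_pmf (Abs_pmf M) = M"
proof (rule Abs_pmf_inverse)
  interpret prob_space M by fact
  have "(\<Union>x\<in>{x. measure M {x} = 0}. {x}) \<in> null_sets M"
    by (rule null_sets_UN') (auto simp: null_sets_def assms(2) emeasure_eq_measure)
  then have "AE x in M. measure M {x} \<noteq> 0"
    by (rule AE_I') auto
  then show "M \<in> {M. prob_space M \<and> sets M = UNIV \<and> (AE x in M. measure M {x} \<noteq> 0)}"
    using assms by simp
qed

context cyl
begin

definition path_space :: "(nat \<Rightarrow> int \<times> int) measure" where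
  "path_space = (\<Pi>\<^sub>M _ \<in> (UNIV :: nat set). measure_pmf steps)"

lemma space_path_space [simp]: "space path_space = UNIV"
  by (simp add: path_space_def space_PiM PiE_def extensional_def)

lemma path_sequence_space: "sequence_space (measure_pmf steps)"
  by unfold_locales

lemma prob_space_path_space: "prob_space path_space"
  unfolding path_space_def by (intro prob_space_PiM measure_pmf.prob_space_axioms)

lemma measurable_path_walk: "(\<lambda>s. walk N (v, s) n) \<in> path_space \<rightarrow>\<^sub>M count_space UNIV"
proof (induction n)
  case (Suc n)
  have 1: "(\<lambda>s. s n) \<in> path_space \<rightarrow>\<^sub>M count_space UNIV"
    unfolding path_space_def
    by (rule measurable_compose[OF measurable_component_singleton]) simp_all
  show ?case
    unfolding walk.simps snd_conv
    by (rule measurable_compose_countable[OF _ Suc], rule measurable_compose[OF 1]) simp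
qed simp

lemma measurable_path_exit: "(\<lambda>s. exit_site N A (v, s)) \<in> path_space \<rightarrow>\<^sub>M count_space UNIV"
proof -
  have "(\<lambda>s. LEAST n. walk N (v, s) n \<notin> A) \<in> path_space \<rightarrow>\<^sub>M count_space UNIV"
  proof (rule measurable_Least)
    fix n
    show "Measurable.pred path_space (\<lambda>s. walk N (v, s) n \<notin> A)"
      by (rule measurable_compose[OF measurable_path_walk]) simp
  qed
  then show ?thesis
    unfolding exit_site_def by (rule measurable_compose_countable[OF measurable_path_walk])
qed

lemma sets_path_exit: "{s. exit_site N A (v, s) \<in> X} \<in> sets path_space"
  using measurable_sets[OF measurable_path_exit[of A v], of X] by (simp add: vimage_def)

text \<open>As a discrete law it composes by \<open>bind_pmf\<close>, so that identities between
  random growth steps become equations in the pmf monad. Paths that never leave \<open>A\<close>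
  contribute an arbitrary value of \<open>exit_site\<close>, but they are null once \<open>A\<close>
  is bounded above.\<close>

definition exit_pmf :: "site set \<Rightarrow> site \<Rightarrow> site pmf" where
  "exit_pmf A v = Abs_pmf (distr path_space (count_space UNIV) (\<lambda>s. exit_site N A (v, s)))"

lemma measure_exit_pmf: "measure_pmf (exit_pmf A v) = distr path_space (count_space UNIV) (\<lambda>s. exit_site N A (v, s))"
  unfolding exit_pmf_def
  by (rule countable_prob_space_pmf)
     (auto intro!: prob_space.prob_space_distr prob_space_path_space measurable_path_exit)

lemma emeasure_exit_pmf: "emeasure (measure_pmf (exit_pmf A v)) X = emeasure path_space {s. exit_site N A (v, s) \<in> X}"
  unfolding measure_exit_pmf
  by (subst emeasure_distr[OF measurable_path_exit]) (auto simp: vimage_def)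

lemma emeasure_path_step:
  assumes "{s. P s} \<in> sets path_space"
  shows "emeasure path_space {s. P s} = (\<integral>\<^sup>+ d. emeasure path_space {s. P (case_nat d s)} \<partial>measure_pmf steps)"
  using sequence_space.emeasure_case_nat[OF path_sequence_space, of "{s. P s}"] assms
  by (simp add: path_space_def[symmetric])

lemma walk_case_nat: "walk N (v, case_nat d s) (Suc n) = walk N (move N v d, s) n"
  by (induction n) auto

lemma walk_sites: "v \<in> sites \<Longrightarrow> walk N (v, s) n \<in> sites"
  by (cases n) auto

lemma sets_stay: "{s. \<forall>n. walk N (v, s) n \<in> A} \<in> sets path_space"
proof -
  have "{s. walk N (v, s) n \<in> A} \<in> sets path_space" for n
    using measurable_sets[OF measurable_path_walk[of v n], of A] by (simp add: vimage_def)
  then have "(\<Inter>n. {s. walk N (v, s) n \<in> A}) \<in> sets path_space"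
    by (intro sets.countable_INT) auto
  then show ?thesis by (simp add: Collect_all_eq)
qed

text \<open>An upper bound on the height suffices for almost sure exit, because the height of the
  walk is a recurrent lazy walk. Working with such sets covers configurations, \<open>R H\<close>
  and \<open>R H - {z}\<close> alike.\<close>

definition bounded_above :: "site set \<Rightarrow> bool" where
  "bounded_above A \<longleftrightarrow> (\<exists>M. \<forall>v\<in>A. snd v \<le> M)"

text \<open>As a function of the starting site, the probability of staying in \<open>A\<close>
  forever is bounded, harmonic on \<open>A\<close> and zero off \<open>A\<close>, so
  \<open>subharmonic_bounded_zero\<close> applies.\<close>

lemma stay_null:
  assumes A: "bounded_above A" and v: "v \<in> sites"
  shows "emeasure path_space {s. \<forall>n. walk N (v, s) n \<in> A} = 0"
proof -
  interpret S: prob_space path_space by (rule prob_space_path_space)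
  obtain M where M: "\<And>v. v \<in> A \<Longrightarrow> snd v \<le> M" using A by (auto simp: bounded_above_def)
  define u where "u v = measure path_space {s. \<forall>n. walk N (v, s) n \<in> A}" for v
  have out: "u v = 0" if "v \<notin> A" for v
  proof -
    have "{s. \<forall>n. walk N (v, s) n \<in> A} = {}" using that by (auto intro: exI[of _ 0])
    then show ?thesis by (simp only: u_def measure_empty)
  qed
  have "u v = 0"
  proof (rule subharmonic_bounded_zero[of u 1 M])
    fix w :: site assume "w \<in> sites"
    show "0 \<le> u w" "u w \<le> 1" by (simp_all add: u_def)
    show "u w = 0" if "snd w > M" using out[of w] M[of w] that by linarith
    show "u w \<le> avg u w"
    proof (cases "w \<in> A")
      case False
      have "0 \<le> avg u w" unfolding avg_def by (intro integral_nonneg_AE) (simp add: u_def)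
      then show ?thesis using out[OF False] by simp
    next
      case True
      have "emeasure path_space {s. \<forall>n. walk N (w, s) n \<in> A} =
        (\<integral>\<^sup>+ d. emeasure path_space {s. \<forall>n. walk N (w, case_nat d s) n \<in> A} \<partial>measure_pmf steps)"
        by (rule emeasure_path_step[OF sets_stay])
      also have "\<dots> = (\<integral>\<^sup>+ d. emeasure path_space {s. \<forall>n. walk N (move N w d, s) n \<in> A} \<partial>measure_pmf steps)"
      proof (intro nn_integral_cong arg_cong2[of _ _ _ _ emeasure] refl Collect_cong)
        fix d s
        show "(\<forall>n. walk N (w, case_nat d s) n \<in> A) \<longleftrightarrow> (\<forall>n. walk N (move N w d, s) n \<in> A)"
          using True by (metis walk_case_nat walk.simps(1) fst_conv not0_implies_Suc)
      qed
      also have "\<dots> = (\<integral>\<^sup>+ d. ennreal (u (move N w d)) \<partial>measure_pmf steps)"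
        by (simp add: u_def S.emeasure_eq_measure)
      also have "\<dots> = ennreal (avg u w)"
        unfolding avg_def
        by (intro nn_integral_eq_integral measure_pmf.integrable_const_bound[where B = 1])
           (auto simp: u_def)
      finally show ?thesis
        unfolding u_def[of w] by (simp add: S.emeasure_eq_measure avg_def integral_nonneg_AE u_def)
    qed
  qed fact
  then show ?thesis by (simp add: u_def S.emeasure_eq_measure)
qed

lemma exit_site_outside: "\<exists>n. walk N (v, s) n \<notin> A \<Longrightarrow> exit_site N A (v, s) \<notin> A"
  unfolding exit_site_def by (rule LeastI_ex)

lemma exit_pmf_not_in:
  assumes "bounded_above A" "v \<in> sites" "a \<in> set_pmf (exit_pmf A v)"
  shows "a \<notin> A"
proof
  assume "a \<in> A"
  have "emeasure path_space {s. exit_site N A (v, s) \<in> {a}} \<le> emeasure path_space {s. \<forall>n. walk N (v, s) n \<in> A}"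
    using exit_site_outside[of v _ A] \<open>a \<in> A\<close> by (intro emeasure_mono sets_stay) blast
  also have "\<dots> = 0" by (rule stay_null[OF assms(1,2)])
  finally have "emeasure (measure_pmf (exit_pmf A v)) {a} = 0" by (simp add: emeasure_exit_pmf)
  then show False using assms(3) by (simp add: emeasure_pmf_single set_pmf_iff)
qed

lemma exit_pmf_sites:
  assumes "v \<in> sites" "a \<in> set_pmf (exit_pmf A v)"
  shows "a \<in> sites"
proof (rule ccontr)
  assume "a \<notin> sites"
  then have "{s. exit_site N A (v, s) \<in> {a}} = {}"
    using walk_sites[OF assms(1)] by (auto simp: exit_site_def)
  then have "emeasure (measure_pmf (exit_pmf A v)) {a} = 0" unfolding emeasure_exit_pmf by simp
  then show False using assms(2) by (simp add: emeasure_pmf_single set_pmf_iff)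
qed

lemma exit_pmf_outside:
  assumes "v \<notin> A"
  shows "exit_pmf A v = return_pmf v"
proof -
  have "exit_site N A (v, s) = v" for s
  proof -
    have "(LEAST n. walk N (v, s) n \<notin> A) = 0" using assms by (intro Least_equality) auto
    then show ?thesis by (simp add: exit_site_def)
  qed
  then have "emeasure (measure_pmf (exit_pmf A v)) {a} = 0" if "a \<noteq> v" for a
    using that by (simp add: emeasure_exit_pmf)
  then have "set_pmf (exit_pmf A v) \<subseteq> {v}"
    by (fastforce simp: emeasure_pmf_single set_pmf_iff)
  then show ?thesis by (simp add: set_pmf_subset_singleton)
qed

text \<open>Together with \<open>exit_pmf_outside\<close> this exhibits the exit law as the solution
  of a Dirichlet problem: harmonic on \<open>A\<close>, a point mass at the start off
  \<open>A\<close>.\<close>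

lemma exit_pmf_step:
  assumes A: "bounded_above A" and v: "v \<in> A" "v \<in> sites"
  shows "exit_pmf A v = bind_pmf steps (\<lambda>d. exit_pmf A (move N v d))"
proof (rule pmf_eqI)
  fix a
  have "emeasure path_space {s. exit_site N A (v, s) \<in> {a}} =
     (\<integral>\<^sup>+ d. emeasure path_space {s. exit_site N A (v, case_nat d s) \<in> {a}} \<partial>measure_pmf steps)"
    by (rule emeasure_path_step[OF sets_path_exit])
  also have "\<dots> = (\<integral>\<^sup>+ d. emeasure path_space {s. exit_site N A (move N v d, s) \<in> {a}} \<partial>measure_pmf steps)"
  proof (intro nn_integral_cong emeasure_eq_AE)
    fix d
    \<comment> \<open>Off this null set the \<open>LEAST\<close> in \<open>exit_site\<close> has a
      witness, so prefixing one step inside \<open>A\<close> shifts it by exactly one.\<close>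
    have "AE s in path_space. \<not> (\<forall>n. walk N (move N v d, s) n \<in> A)"
      by (rule AE_I'[of "{s. \<forall>n. walk N (move N v d, s) n \<in> A}"])
         (use stay_null[OF A] sets_stay in \<open>auto simp: null_sets_def\<close>)
    then show "AE s in path_space. (s \<in> {s. exit_site N A (v, case_nat d s) \<in> {a}}) =
        (s \<in> {s. exit_site N A (move N v d, s) \<in> {a}})"
    proof eventually_elim
      case (elim s)
      then obtain n where n: "walk N (move N v d, s) n \<notin> A" by blast
      have "(LEAST n. walk N (v, case_nat d s) n \<notin> A) = Suc (LEAST n. walk N (v, case_nat d s) (Suc n) \<notin> A)"
        by (rule Least_Suc[of _ "Suc n"]) (use n v in \<open>simp_all add: walk_case_nat del: walk.simps(2)\<close>)
      then have "exit_site N A (v, case_nat d s) = exit_site N A (move N v d, s)"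
        by (simp add: exit_site_def walk_case_nat del: walk.simps(2))
      then show ?case by simp
    qed
    show "{s. exit_site N A (move N v d, s) \<in> {a}} \<in> sets path_space" by (rule sets_path_exit)
    have "(\<lambda>s. case_nat d s) \<in> path_space \<rightarrow>\<^sub>M path_space"
      unfolding path_space_def by measurable
    from measurable_sets[OF this sets_path_exit[of A v "{a}"]]
    show "{s. exit_site N A (v, case_nat d s) \<in> {a}} \<in> sets path_space"
      by (simp add: vimage_def)
  qed
  also have "\<dots> = emeasure (measure_pmf (bind_pmf steps (\<lambda>d. exit_pmf A (move N v d)))) {a}"
    by (simp add: emeasure_exit_pmf)
  finally show "pmf (exit_pmf A v) a = pmf (bind_pmf steps (\<lambda>d. exit_pmf A (move N v d))) a"
    unfolding emeasure_exit_pmf[symmetric] by (simp add: emeasure_pmf_single)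
qed

end

section \<open>Optional stopping and the Abelian property\<close>

lemma expectation_bind_pmf:
  fixes f :: "'b \<Rightarrow> real"
  assumes "\<And>x. \<bar>f x\<bar> \<le> B"
  shows "measure_pmf.expectation (bind_pmf p k) f = measure_pmf.expectation p (\<lambda>x. measure_pmf.expectation (k x) f)"
  unfolding measure_pmf_bind
  by (rule integral_bind[where K = "count_space UNIV" and B' = 1 and B = B])
     (use assms in \<open>auto intro!: AE_I2 measure_pmf.finite_measure prob_space_imp_subprob_space
        simp: space_subprob_algebra measure_pmf.subprob_space_axioms measure_pmf.emeasure_space_1[simplified]\<close>)

lemma integrable_bounded_pmf:
  fixes f :: "'b \<Rightarrow> real"
  assumes "\<And>x. \<bar>f x\<bar> \<le> B"
  shows "integrable (measure_pmf p) f"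
  by (rule measure_pmf.integrable_const_bound[of _ B]) (use assms in auto)

lemma abs_expectation_le:
  fixes f :: "'b \<Rightarrow> real"
  assumes "\<And>x. x \<in> set_pmf p \<Longrightarrow> \<bar>f x\<bar> \<le> B"
  shows "\<bar>measure_pmf.expectation p f\<bar> \<le> B"
proof -
  have "integrable (measure_pmf p) f"
    by (rule measure_pmf.integrable_const_bound[of _ B]) (use assms in \<open>auto simp: AE_measure_pmf_iff\<close>)
  then have "\<bar>measure_pmf.expectation p f\<bar> \<le> measure_pmf.expectation p (\<lambda>x. \<bar>f x\<bar>)"
    by simp
  also have "\<dots> \<le> measure_pmf.expectation p (\<lambda>_. B)"
    using \<open>integrable _ f\<close> assms by (intro integral_mono_AE) (auto simp: AE_measure_pmf_iff)
  finally show ?thesis by simp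
qed

lemma measure_bind_pmf:
  "measure_pmf.prob (bind_pmf p k) S = measure_pmf.expectation p (\<lambda>x. measure_pmf.prob (k x) S)"
proof -
  have "measure_pmf.expectation (bind_pmf p k) (indicator S :: _ \<Rightarrow> real) =
      measure_pmf.expectation p (\<lambda>x. measure_pmf.expectation (k x) (indicator S))"
    by (rule expectation_bind_pmf[of _ 1]) (auto simp: indicator_def)
  then show ?thesis by simp
qed

lemma prob_bind_diff_le:
  assumes "\<And>x. x \<in> set_pmf p \<Longrightarrow> \<bar>measure_pmf.prob (k x) S - measure_pmf.prob (k' x) S\<bar> \<le> e"
  shows "\<bar>measure_pmf.prob (bind_pmf p k) S - measure_pmf.prob (bind_pmf p k') S\<bar> \<le> e"
proof -
  have "integrable (measure_pmf p) (\<lambda>x. measure_pmf.prob (k x) S)" for k :: "_ \<Rightarrow> _ pmf"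
    by (rule integrable_bounded_pmf[of _ 1]) simp
  then have "measure_pmf.prob (bind_pmf p k) S - measure_pmf.prob (bind_pmf p k') S =
     measure_pmf.expectation p (\<lambda>x. measure_pmf.prob (k x) S - measure_pmf.prob (k' x) S)"
    by (simp add: measure_bind_pmf)
  then show ?thesis using abs_expectation_le[OF assms] by simp
qed

context cyl
begin

text \<open>The expected exit value and \<open>f\<close> are both harmonic on \<open>A\<close> and
  agree off \<open>A\<close>. The absolute value of their difference is bounded and subharmonic,
  hence zero: uniqueness takes the place of a martingale argument.\<close>

lemma optional_stopping:
  assumes A: "bounded_above A" and bd: "\<And>v. \<bar>f v\<bar> \<le> B"
    and harm: "\<And>v. v \<in> A \<Longrightarrow> v \<in> sites \<Longrightarrow> f v = avg f v" and v: "v \<in> sites"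
  shows "measure_pmf.expectation (exit_pmf A v) f = f v"
proof -
  obtain M where M: "\<And>v. v \<in> A \<Longrightarrow> snd v \<le> M" using A by (auto simp: bounded_above_def)
  define e where "e v = measure_pmf.expectation (exit_pmf A v) f" for v
  define g where "g v = \<bar>e v - f v\<bar>" for v
  have eb: "\<bar>e v\<bar> \<le> B" for v unfolding e_def by (rule abs_expectation_le) (rule bd)
  have out: "g v = 0" if "v \<notin> A" for v
    using that by (simp add: g_def e_def exit_pmf_outside)
  have gb: "g v \<le> 2 * B" "0 \<le> g v" for v using eb[of v] bd[of v] by (auto simp: g_def)
  have "g v = 0"
  proof (rule subharmonic_bounded_zero[of g "2 * B" M])
    fix w :: site assume w: "w \<in> sites"
    show "g w = 0" if "snd w > M" using out[of w] M[of w] that by linarith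
    show "g w \<le> avg g w"
    proof (cases "w \<in> A")
      case False
      then show ?thesis using gb(2) by (simp add: out avg_def integral_nonneg_AE)
    next
      case True
      have "e w = avg e w"
        unfolding e_def avg_def exit_pmf_step[OF A True w] by (rule expectation_bind_pmf[OF bd])
      then have "g w = \<bar>avg e w - avg f w\<bar>" using harm[OF True w] by (simp add: g_def)
      also have "avg e w - avg f w = measure_pmf.expectation steps (\<lambda>d. e (move N w d) - f (move N w d))"
        unfolding avg_def
        by (intro Bochner_Integration.integral_diff[symmetric] integrable_bounded_pmf[of _ B] eb bd)
      also have "\<bar>\<dots>\<bar> \<le> avg g w"
        unfolding avg_def g_def by (rule integral_abs_bound)
      finally show ?thesis .
    qed
  qed (use gb v in auto)
  then show ?thesis by (simp add: g_def e_def)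
qed

text \<open>Optional stopping applied to each point probability of \<open>K\<close>. It yields every
  later identity of the form "run the walk until it leaves a smaller set, then continue".\<close>

lemma exit_pmf_kernel:
  assumes A: "bounded_above A"
    and harm: "\<And>v. v \<in> A \<Longrightarrow> v \<in> sites \<Longrightarrow> K v = bind_pmf steps (\<lambda>d. K (move N v d))" and v: "v \<in> sites"
  shows "bind_pmf (exit_pmf A v) K = K v"
proof (rule pmf_eqI)
  fix i
  show "pmf (bind_pmf (exit_pmf A v) K) i = pmf (K v) i"
    unfolding pmf_bind
  proof (rule optional_stopping[OF A _ _ v, of _ 1])
    fix w assume "w \<in> A" "w \<in> sites"
    show "pmf (K w) i = avg (\<lambda>w. pmf (K w) i) w"
      unfolding avg_def by (subst harm) (fact | simp add: pmf_bind)+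
  qed (simp add: pmf_le_1)
qed

text \<open>The strong Markov property at the exit from the smaller set.\<close>

lemma exit_pmf_absorb:
  assumes "bounded_above A" "B \<subseteq> A" "v \<in> sites"
  shows "bind_pmf (exit_pmf B v) (exit_pmf A) = exit_pmf A v"
proof (rule exit_pmf_kernel)
  show "bounded_above B" using assms(1,2) unfolding bounded_above_def by blast
qed (use assms exit_pmf_step[of A] in auto)

section \<open>Settling one particle, and exchanging two of them\<close>

definition settle :: "site \<Rightarrow> site set \<Rightarrow> site set pmf" where
  "settle v A = map_pmf (\<lambda>a. insert a A) (exit_pmf A v)"

lemma settle_outside: "v \<notin> A \<Longrightarrow> settle v A = return_pmf (insert v A)"
  by (simp add: settle_def exit_pmf_outside)

lemma settle_step:
  assumes "bounded_above A" "v \<in> A" "v \<in> sites"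
  shows "settle v A = bind_pmf steps (\<lambda>d. settle (move N v d) A)"
  unfolding settle_def by (subst exit_pmf_step[OF assms]) (simp add: map_bind_pmf)

lemma bounded_above_insert [simp]: "bounded_above (insert a A) \<longleftrightarrow> bounded_above A"
proof
  assume "bounded_above A"
  then obtain M where "\<forall>v\<in>A. snd v \<le> M" by (auto simp: bounded_above_def)
  then have "\<forall>v\<in>insert a A. snd v \<le> max M (snd a)" by auto
  then show "bounded_above (insert a A)" unfolding bounded_above_def by blast
qed (auto simp: bounded_above_def)

lemma set_settle:
  assumes "bounded_above A" "v \<in> sites" "B \<in> set_pmf (settle v A)"
  obtains a where "a \<in> sites" "a \<notin> A" "B = insert a A"
proof -
  obtain a where "a \<in> set_pmf (exit_pmf A v)" "B = insert a A"
    using assms(3) unfolding settle_def by auto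
  with exit_pmf_not_in[OF assms(1,2)] exit_pmf_sites[OF assms(2)] that show thesis by blast
qed

lemma settle_mono:
  assumes "bounded_above A" "v \<in> sites" "B \<in> set_pmf (settle v A)"
  shows "bounded_above B" "A \<subseteq> B"
proof -
  obtain a where "B = insert a A" using set_settle[OF assms] .
  then show "bounded_above B" "A \<subseteq> B" using assms(1) by auto
qed

lemma settle_via_exit_pmf:
  assumes "bounded_above A" "v \<in> sites"
  shows "bind_pmf (exit_pmf A v) (\<lambda>a. settle a A) = settle v A"
  by (rule exit_pmf_kernel) (use assms settle_step[of A] in auto)

text \<open>
  Both sides are harmonic on \<open>A\<close> as functions of \<open>v\<close> and as functions of \<open>w\<close>, so it suffices to
  compare them for starting sites outside \<open>A\<close>.
\<close>

lemma settle_commute: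
  assumes A: "bounded_above A" and v: "v \<in> sites" and w: "w \<in> sites"
  shows "bind_pmf (settle v A) (settle w) = bind_pmf (settle w A) (settle v)"
proof -
  define F where "F v w = bind_pmf (settle v A) (settle w)" for v w
  have 1: "F v w = bind_pmf (exit_pmf A v) (\<lambda>a. F a w)" if "v \<in> sites" for v w
    unfolding F_def by (subst settle_via_exit_pmf[OF A that, symmetric]) (simp add: bind_assoc_pmf)
  have 2: "F v w = bind_pmf (exit_pmf A w) (\<lambda>b. F v b)" if "w \<in> sites" "v \<in> sites" for v w
  proof -
    have "bind_pmf (exit_pmf A w) (F v) = F v w"
    proof (rule exit_pmf_kernel[OF A _ that(1)])
      fix u assume u: "u \<in> A" "u \<in> sites"
      \<comment> \<open>The second particle is only followed until it leaves \<open>A\<close>. The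
        first one can only enlarge \<open>A\<close>, so \<open>u\<close> still lies in each outcome
        \<open>B\<close>, and one step of the second walk may be drawn before
        \<open>B\<close>.\<close>
      have "F v u = bind_pmf (settle v A) (\<lambda>B. bind_pmf steps (\<lambda>d. settle (move N u d) B))"
        unfolding F_def
        by (intro bind_pmf_cong refl settle_step)
           (use u settle_mono[OF A that(2)] in blast)+
      also have "\<dots> = bind_pmf steps (\<lambda>d. F v (move N u d))"
        unfolding F_def by (rule bind_commute_pmf)
      finally show "F v u = bind_pmf steps (\<lambda>d. F v (move N u d))" .
    qed
    then show ?thesis by simp
  qed
  \<comment> \<open>Two distinct vacant sites are filled in either order; for equal sites both sides
    are the same term, although the second particle then walks on.\<close>
  have sym: "F a b = F b a" if "a \<notin> A" "b \<notin> A" for a b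
    using that by (cases "a = b") (auto simp: F_def settle_outside bind_return_pmf insert_commute)
  have "F v w = bind_pmf (exit_pmf A v) (\<lambda>a. bind_pmf (exit_pmf A w) (\<lambda>b. F a b))"
    by (subst 1[OF v], rule bind_pmf_cong[OF refl], rule 2) (use v w exit_pmf_sites in auto)
  also have "\<dots> = bind_pmf (exit_pmf A v) (\<lambda>a. bind_pmf (exit_pmf A w) (\<lambda>b. F b a))"
    by (intro bind_pmf_cong refl sym) (use exit_pmf_not_in A v w in auto)
  also have "\<dots> = bind_pmf (exit_pmf A w) (\<lambda>b. bind_pmf (exit_pmf A v) (\<lambda>a. F b a))"
    by (rule bind_commute_pmf)
  also have "\<dots> = F w v"
    by (subst 1[OF w], rule bind_pmf_cong[OF refl], rule 2[symmetric]) (use v w exit_pmf_sites in auto)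
  finally show ?thesis by (simp add: F_def)
qed

section \<open>Releasing several particles in any order\<close>

primrec release :: "site list \<Rightarrow> site set \<Rightarrow> site set pmf" where
  "release [] A = return_pmf A"
| "release (v # vs) A = bind_pmf (settle v A) (release vs)"

definition settle_unif :: "site set \<Rightarrow> site set pmf" where
  "settle_unif A = bind_pmf (pmf_of_set (level N 0)) (\<lambda>v. settle v A)"

primrec grow :: "nat \<Rightarrow> site set \<Rightarrow> site set pmf" where
  "grow 0 A = return_pmf A"
| "grow (Suc n) A = bind_pmf (settle_unif A) (grow n)"

lemma grow_Suc_fun: "grow (Suc n) = (\<lambda>A. bind_pmf (settle_unif A) (grow n))"
  by (rule ext) simp

lemma grow_0_fun: "grow 0 = return_pmf"
  by (rule ext) simp

lemma level_0 [simp]: "finite (level N k)" "level N k \<noteq> {}"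
  using N3 level_nonempty[of N k] by (auto simp: finite_level)

lemma level_sites: "level N k \<subseteq> sites"
  by (auto simp: level_def)

lemma set_settle_unif:
  assumes "bounded_above A" "B \<in> set_pmf (settle_unif A)"
  obtains a where "a \<in> sites" "a \<notin> A" "B = insert a A"
proof -
  obtain v where "v \<in> sites" "B \<in> set_pmf (settle v A)"
    using assms(2) level_sites unfolding settle_unif_def by auto
  with set_settle[OF assms(1)] that show thesis by blast
qed

lemma settle_unif_mono:
  assumes "bounded_above A" "B \<in> set_pmf (settle_unif A)"
  shows "bounded_above B" "A \<subseteq> B"
proof -
  obtain a where "B = insert a A" using set_settle_unif[OF assms] .
  then show "bounded_above B" "A \<subseteq> B" using assms(1) by auto
qed

lemma release_commute:
  assumes "bounded_above A" "v \<in> sites" "set vs \<subseteq> sites"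
  shows "bind_pmf (release vs A) (settle v) = bind_pmf (settle v A) (release vs)"
  using assms
proof (induction vs arbitrary: A)
  case Nil
  show ?case by (simp add: bind_return_pmf bind_return_pmf')
next
  case (Cons w ws)
  have "bind_pmf (release (w # ws) A) (settle v) = bind_pmf (settle w A) (\<lambda>B. bind_pmf (release ws B) (settle v))"
    by (simp add: bind_assoc_pmf)
  also have "\<dots> = bind_pmf (settle w A) (\<lambda>B. bind_pmf (settle v B) (release ws))"
    by (rule bind_pmf_cong[OF refl], rule Cons.IH) (use Cons.prems settle_mono[OF Cons.prems(1), of w] in auto)
  also have "\<dots> = bind_pmf (bind_pmf (settle w A) (settle v)) (release ws)"
    by (simp add: bind_assoc_pmf)
  also have "\<dots> = bind_pmf (bind_pmf (settle v A) (settle w)) (release ws)"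
    using Cons.prems by (subst settle_commute) auto
  finally show ?case by (simp add: bind_assoc_pmf)
qed

lemma release_unif_commute:
  assumes "bounded_above A" "set vs \<subseteq> sites"
  shows "bind_pmf (release vs A) settle_unif = bind_pmf (settle_unif A) (release vs)"
proof -
  have "bind_pmf (release vs A) settle_unif =
      bind_pmf (pmf_of_set (level N 0)) (\<lambda>v. bind_pmf (release vs A) (settle v))"
    unfolding settle_unif_def by (rule bind_commute_pmf)
  also have "\<dots> = bind_pmf (pmf_of_set (level N 0)) (\<lambda>v. bind_pmf (settle v A) (release vs))"
    using assms level_sites by (intro bind_pmf_cong refl release_commute) auto
  finally show ?thesis by (simp add: settle_unif_def bind_assoc_pmf)
qed

text \<open>This lets particles with prescribed starting sites wait until a flat cluster has grown
  around them.\<close>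

lemma release_grow_commute:
  assumes "bounded_above A" "set vs \<subseteq> sites"
  shows "bind_pmf (release vs A) (grow n) = bind_pmf (grow n A) (release vs)"
  using assms
proof (induction n arbitrary: A)
  case 0
  show ?case by (simp add: bind_return_pmf bind_return_pmf')
next
  case (Suc n)
  have "bind_pmf (release vs A) (grow (Suc n)) = bind_pmf (bind_pmf (release vs A) settle_unif) (grow n)"
    by (simp add: bind_assoc_pmf grow_Suc_fun)
  also have "\<dots> = bind_pmf (settle_unif A) (\<lambda>B. bind_pmf (release vs B) (grow n))"
    by (subst release_unif_commute[OF Suc.prems]) (simp add: bind_assoc_pmf)
  also have "\<dots> = bind_pmf (settle_unif A) (\<lambda>B. bind_pmf (grow n B) (release vs))"
    by (rule bind_pmf_cong[OF refl], rule Suc.IH) (use Suc.prems settle_unif_mono in auto)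
  finally show ?case by (simp only: grow_Suc_fun bind_assoc_pmf)
qed

text \<open>A particle released at a vacant site stays there, so a configuration is itself the
  outcome of releasing one particle at each of its sites above level 0 into
  \<open>R 0\<close>.\<close>

lemma release_disjoint:
  assumes "distinct vs" "set vs \<inter> A = {}"
  shows "release vs A = return_pmf (set vs \<union> A)"
  using assms by (induction vs arbitrary: A) (auto simp: settle_outside bind_return_pmf)

lemma grow_Suc': "grow (Suc n) A = bind_pmf (grow n A) settle_unif"
proof (induction n arbitrary: A)
  case (Suc n)
  have "grow (Suc (Suc n)) A = bind_pmf (settle_unif A) (\<lambda>B. bind_pmf (grow n B) settle_unif)"
    unfolding grow.simps(2)[of "Suc n"] by (intro bind_pmf_cong refl Suc.IH)
  then show ?case by (simp add: bind_assoc_pmf)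
qed (simp add: bind_return_pmf bind_return_pmf' grow_0_fun)

lemma set_release:
  assumes "bounded_above A" "set vs \<subseteq> sites" "B \<in> set_pmf (release vs A)"
  shows "bounded_above B \<and> A \<subseteq> B"
  using assms
proof (induction vs arbitrary: A)
  case (Cons v vs)
  then obtain C where C: "C \<in> set_pmf (settle v A)" "B \<in> set_pmf (release vs C)" by auto
  then show ?case using Cons.IH[of C] Cons.prems settle_mono[OF Cons.prems(1) _ C(1)] by auto
qed auto

lemma set_grow:
  assumes "bounded_above A" "B \<in> set_pmf (grow n A)"
  shows "bounded_above B \<and> A \<subseteq> B"
  using assms
proof (induction n arbitrary: A)
  case (Suc n)
  then obtain C where C: "C \<in> set_pmf (settle_unif A)" "B \<in> set_pmf (grow n C)" by auto
  then show ?case using Suc.IH[of C] Suc.prems settle_unif_mono[OF Suc.prems(1) C(1)] by auto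
qed auto

end

section \<open>Hitting distribution of a level\<close>

text \<open>Up to pi / 3 the derivative cos - 1 / 2 is nonnegative. Beyond that, the sine is at
  least sqrt 3 / 2, hence at least 0.85, while x / 2 is at most 0.8.\<close>

lemma half_le_sin:
  assumes "0 \<le> x" "x \<le> pi / 2"
  shows "x / 2 \<le> sin x"
proof (cases "x \<le> pi / 3")
  case True
  have "sin 0 - 0 / 2 \<le> sin x - x / 2"
  proof (rule DERIV_nonneg_imp_nondecreasing[OF assms(1)])
    fix t assume t: "0 \<le> t" "t \<le> x"
    have "cos (pi / 3) \<le> cos t" using t True by (intro cos_monotone_0_pi_le) auto
    then show "\<exists>y. ((\<lambda>x. sin x - x / 2) has_real_derivative y) (at t) \<and> 0 \<le> y"
      by (intro exI[of _ "cos t - 1 / 2"]) (auto intro!: derivative_eq_intros simp: cos_60)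
  qed
  then show ?thesis by simp
next
  case False
  have "sqrt 3 / 2 = sin (pi / 3)" by (simp add: sin_60)
  also have "\<dots> \<le> sin x" using False assms by (intro sin_monotone_2pi_le) auto
  finally have "sqrt 3 / 2 \<le> sin x" .
  moreover have "sqrt 3 \<ge> 1.7" by (rule real_le_rsqrt) (simp add: power2_eq_square)
  moreover have "x \<le> 1.6" using assms pi_less_4 pi_approx by auto
  ultimately show ?thesis by auto
qed

text \<open>The real part of a full geometric sum over the powers of an n-th root of unity other
  than 1.\<close>

lemma sum_cos_roots:
  fixes m :: int
  assumes "0 < \<bar>m\<bar>" "\<bar>m\<bar> < int n"
  shows "(\<Sum>k<n. cos (2 * pi * real k * real_of_int m / real n)) = 0"
proof -
  define z where "z = cis (2 * pi * real_of_int m / real n)"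
  have n: "real n > 0" using assms by simp
  have "real n * (2 * pi * real_of_int m / real n) = 2 * pi * real_of_int m" using n by simp
  then have "z ^ n = cis (2 * pi * real_of_int m)" unfolding z_def Complex.DeMoivre by (rule arg_cong)
  then have zn: "z ^ n = 1" by (simp add: cis_multiple_2pi)
  have "z \<noteq> 1"
  proof
    assume "z = 1"
    then have "cos (2 * pi * real_of_int m / real n) = 1" by (metis z_def cis.sel(1) one_complex.sel(1))
    then obtain i where "2 * pi * real_of_int m / real n = real_of_int i * (2 * pi)"
      by (auto simp: cos_one_2pi_int)
    then have "real_of_int m = real_of_int i * real n" using n by (simp add: field_simps)
    then have "real_of_int m = real_of_int (i * int n)" by simp
    then have "m = i * int n" by (simp only: of_int_eq_iff)
    moreover from this have "i \<noteq> 0" using assms(1) by auto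
    then have "1 * int n \<le> \<bar>i\<bar> * int n" by (intro mult_right_mono) auto
    ultimately have "int n \<le> \<bar>m\<bar>" by (simp add: abs_mult)
    with assms(2) show False by simp
  qed
  then have "(\<Sum>k<n. z ^ k) = 0" using zn by (simp add: sum_gp_strict)
  then have "Re (\<Sum>k<n. z ^ k) = 0" by simp
  moreover have "Re (z ^ k) = cos (2 * pi * real k * real_of_int m / real n)" for k
    unfolding z_def Complex.DeMoivre by (simp add: mult_ac)
  ultimately show ?thesis by simp
qed

lemma cos_mod_period:
  assumes "n > 0"
  shows "cos (2 * pi * real k * real_of_int (a mod int n - c) / real n) = cos (2 * pi * real k * real_of_int (a - c) / real n)"
proof -
  have "real_of_int (a mod int n) = real_of_int (a - int n * (a div int n))" by (simp only: minus_mult_div_eq_mod)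
  then have *: "real_of_int (a mod int n) = real_of_int a - real n * real_of_int (a div int n)" by simp
  have "2 * pi * real k * real_of_int (a mod int n - c) / real n =
     2 * pi * real k * real_of_int (a - c) / real n - 2 * pi * real_of_int (int k * (a div int n))"
    unfolding of_int_diff * using assms by (simp add: field_simps)
  also have "cos \<dots> = cos (2 * pi * real k * real_of_int (a - c) / real n)"
    unfolding cos_diff cos_int_2pin sin_int_2pin by simp
  finally show ?thesis .
qed

text \<open>The decaying root of \<open>r + 1 / r = 4 - 2 cos \<theta>\<close>, where \<open>\<theta> = 2 \<pi> k / n\<close>.\<close>

definition decay :: "nat \<Rightarrow> nat \<Rightarrow> real" where
  "decay n k = (let s = 2 - cos (2 * pi * real k / real n) in s - sqrt (s\<^sup>2 - 1))"

lemma decay: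
  "0 < decay n k" "decay n k \<le> 1"
  "(decay n k)\<^sup>2 + 1 = (4 - 2 * cos (2 * pi * real k / real n)) * decay n k"
proof -
  define s where "s = 2 - cos (2 * pi * real k / real n)"
  have s: "s \<ge> 1" by (simp add: s_def)
  then have s2: "s\<^sup>2 \<ge> 1" by (simp add: one_le_power)
  have d: "decay n k = s - sqrt (s\<^sup>2 - 1)" by (simp add: decay_def s_def Let_def)
  have "sqrt (s\<^sup>2 - 1) < sqrt (s\<^sup>2)" by (rule real_sqrt_less_mono) simp
  then show "0 < decay n k" using s by (simp add: d)
  have "(s - 1)\<^sup>2 \<le> s\<^sup>2 - 1" using s by (simp add: power2_eq_square algebra_simps)
  then have "s - 1 \<le> sqrt (s\<^sup>2 - 1)" by (rule real_le_rsqrt)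
  then show "decay n k \<le> 1" by (simp add: d)
  have "(decay n k)\<^sup>2 + 1 = 2 * s * decay n k"
    using s2 unfolding d by (simp add: power2_diff algebra_simps) (simp add: power2_eq_square)
  then show "(decay n k)\<^sup>2 + 1 = (4 - 2 * cos (2 * pi * real k / real n)) * decay n k"
    by (simp add: s_def)
qed

text \<open>This is the spectral gap behind the scale N. The inverse of the decay is s + sqrt (s^2 -
  1), where s = 1 + 2 (sin x)^2 and x = pi k / n. Since sin x is at least 1 / n, by
  \<open>half_le_sin\<close> and symmetry about pi / 2, the inverse is at least 1 + 2 / n and thus
  at least \<open>exp (1 / n)\<close>.\<close>

lemma decay_le_exp:
  assumes "0 < k" "k < n"
  shows "decay n k \<le> exp (- 1 / real n)"
proof -
  define s where "s = 2 - cos (2 * pi * real k / real n)"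
  define x where "x = pi * real k / real n"
  have n: "real n > 0" using assms by simp
  have sin1: "1 / real n \<le> sin x"
  proof (cases "x \<le> pi / 2")
    case True
    have "1 / real n \<le> x / 2"
      using n assms pi_ge_two mult_mono[of 2 pi 1 "real k"] by (simp add: x_def field_simps)
    also have "\<dots> \<le> sin x" by (rule half_le_sin) (use True in \<open>auto simp: x_def\<close>)
    finally show ?thesis .
  next
    case False
    have "1 / real n \<le> (pi - x) / 2"
      using n assms pi_ge_two mult_mono[of 2 pi 1 "real n - real k"] by (simp add: x_def field_simps)
    also have "\<dots> \<le> sin (pi - x)"
      by (rule half_le_sin) (use False n assms in \<open>auto simp: x_def field_simps\<close>)
    finally show ?thesis by simp
  qed
  have "cos (2 * x) = 1 - 2 * (sin x)\<^sup>2" by (rule cos_double_sin)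
  then have s: "s = 1 + 2 * (sin x)\<^sup>2" by (simp add: s_def x_def mult.assoc)
  have "(1 / real n)\<^sup>2 \<le> (sin x)\<^sup>2" by (rule power_mono[OF sin1]) simp
  then have s1: "s \<ge> 1 + 2 * (1 / real n)\<^sup>2" by (simp add: s)
  then have s2: "s \<ge> 1" by (smt (verit) zero_le_power2)
  have "(2 * (1 / real n))\<^sup>2 \<le> (s - 1) * 2" using s1 by (simp add: power2_eq_square)
  also have "\<dots> \<le> (s - 1) * (s + 1)" using s2 by (intro mult_left_mono) auto
  finally have "2 * (1 / real n) \<le> sqrt (s\<^sup>2 - 1)"
    by (intro real_le_rsqrt) (simp add: power2_eq_square algebra_simps)
  then have inv: "1 + 2 * (1 / real n) \<le> s + sqrt (s\<^sup>2 - 1)" using s2 by simp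
  have d: "decay n k = s - sqrt (s\<^sup>2 - 1)" by (simp add: decay_def s_def Let_def)
  have "s\<^sup>2 \<ge> 1" using s2 by (simp add: one_le_power)
  then have "(s + sqrt (s\<^sup>2 - 1)) * decay n k = 1"
    unfolding d by (simp add: algebra_simps) (simp add: power2_eq_square)
  moreover have "(1 + 2 * (1 / real n)) * decay n k \<le> (s + sqrt (s\<^sup>2 - 1)) * decay n k"
    using inv decay(1)[of n k] by (intro mult_right_mono) auto
  ultimately have le1: "(1 + 2 * (1 / real n)) * decay n k \<le> 1" by simp
  have "exp (1 / real n) \<le> 1 + 1 / real n + (1 / real n)\<^sup>2"
    by (rule exp_bound) (use n assms in auto)
  also have "(1 / real n)\<^sup>2 \<le> 1 / real n"
    using n assms by (simp add: power2_eq_square field_simps)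
  finally have "exp (1 / real n) \<le> 1 + 2 * (1 / real n)" by simp
  then have "exp (1 / real n) * decay n k \<le> (1 + 2 * (1 / real n)) * decay n k"
    using decay(1)[of n k] by (intro mult_right_mono) auto
  with le1 have "exp (1 / real n) * decay n k \<le> 1" by simp
  then show ?thesis by (simp add: exp_minus field_simps)
qed

context cyl
begin

section \<open>Exit from a filled half-cylinder\<close>

abbreviation R :: "int \<Rightarrow> site set" where
  "R \<equiv> filled N"

lemma bounded_above_R [simp]: "bounded_above (R H)"
  by (auto simp: bounded_above_def filled_def)

lemma mem_R: "v \<in> R H \<longleftrightarrow> v \<in> sites \<and> snd v \<le> H"
  by (cases v) (auto simp: filled_def)

text \<open>The indicator of heights above M + 1 vanishes on \<open>A\<close> and on all its
  neighbours, so it is harmonic on \<open>A\<close> and optional stopping gives it expectation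
  zero.\<close>

lemma exit_pmf_height:
  assumes A: "\<And>w. w \<in> A \<Longrightarrow> snd w \<le> M" and v: "v \<in> sites" "snd v \<le> M + 1" and a: "a \<in> set_pmf (exit_pmf A v)"
  shows "snd a \<le> M + 1"
proof -
  have bA: "bounded_above A" using A unfolding bounded_above_def by blast
  define f where "f w = (if snd w > M + 1 then 1 else 0 :: real)" for w :: site
  have "measure_pmf.expectation (exit_pmf A v) f = f v"
  proof (rule optional_stopping[where B = 1])
    fix w assume w: "w \<in> A" "w \<in> sites"
    obtain x y where "w = (x, y)" by fastforce
    then show "f w = avg f w" using A[OF w(1)] by (simp add: f_def avg_eq)
  qed (use bA v in \<open>auto simp: f_def\<close>)
  then have "measure_pmf.expectation (exit_pmf A v) f = 0" using v by (simp add: f_def)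
  then have "AE w in exit_pmf A v. f w = 0"
    by (subst (asm) integral_nonneg_eq_0_iff_AE)
       (auto simp: f_def intro: measure_pmf.integrable_const_bound[where B = 1])
  then show ?thesis using a by (auto simp: AE_measure_pmf_iff f_def split: if_splits)
qed

lemma exit_pmf_R_level:
  assumes "v \<in> sites" "snd v \<le> H + 1" "a \<in> set_pmf (exit_pmf (R H) v)"
  shows "a \<in> level N (H + 1)"
proof -
  have "snd a \<le> H + 1"
    by (rule exit_pmf_height[of "R H" H v]) (use assms in \<open>auto simp: filled_def\<close>)
  moreover have "a \<in> sites" "a \<notin> R H" using exit_pmf_sites exit_pmf_not_in[of "R H"] assms by auto
  ultimately show ?thesis by (cases a) (auto simp: mem_R level_def)
qed

lemma card_level [simp]: "card (level N k) = N"
proof -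
  have "level N k = (\<lambda>x. (x, k)) ` {0..<int N}" by (auto simp: level_def cylinder_def)
  then show ?thesis by (simp add: card_image inj_on_def)
qed

text \<open>Separation of variables: a horizontal cosine times a power of its decay rate, with the
  distance to level H + 1 as exponent, is harmonic on \<open>R H\<close>. On level H + 1 these modes
  average to the indicator of \<open>u\<close>, so optional stopping expresses the exit probability
  as their average at \<open>v\<close>. Mode 0 gives 1 / N, and each other mode is at most the
  stated exponential.\<close>

lemma exit_pmf_R_near_uniform:
  assumes v: "v \<in> sites" "snd v \<le> H + 1" and u: "u \<in> level N (H + 1)"
  shows "\<bar>pmf (exit_pmf (R H) v) u - 1 / real N\<bar> \<le> exp (- real_of_int (H + 1 - snd v) / real N)"
proof -
  obtain c where c: "u = (c, H + 1)" "0 \<le> c" "c < int N" using u by (auto simp: level_def cylinder_def)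
  obtain x0 y0 where xy: "v = (x0, y0)" by fastforce
  have Np: "N > 0" using N3 by simp
  define C where "C k x = cos (2 * pi * real k * real_of_int (x - c) / real N)" for k x
  define f where "f k w = (if snd w \<le> H + 1 then C k (fst w) * decay N k ^ nat (H + 1 - snd w) else 0)" for k w
  have Cmod: "C k (a mod int N) = C k a" for k a
    unfolding C_def by (rule cos_mod_period[OF Np])
  have Csum: "C k (a + 1) + C k (a - 1) = 2 * cos (2 * pi * real k / real N) * C k a" for k a
  proof -
    have "2 * pi * real k * real_of_int (a + 1 - c) / real N = 2 * pi * real k * real_of_int (a - c) / real N + 2 * pi * real k / real N"
      "2 * pi * real k * real_of_int (a - 1 - c) / real N = 2 * pi * real k * real_of_int (a - c) / real N - 2 * pi * real k / real N"
      using Np by (simp_all add: field_simps)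
    then show ?thesis unfolding C_def by (simp add: cos_add cos_diff)
  qed
  have os: "measure_pmf.expectation (exit_pmf (R H) v) (f k) = f k v" for k
  proof (rule optional_stopping[where B = 1])
    show "\<bar>f k w\<bar> \<le> 1" for w
    proof -
      have "\<bar>C k (fst w)\<bar> * decay N k ^ nat (H + 1 - snd w) \<le> 1 * 1"
        using decay(1,2)[of N k] by (intro mult_mono power_le_one) (auto simp: C_def)
      then show ?thesis using decay(1)[of N k] by (auto simp: f_def abs_mult)
    qed
  next
    fix w assume w: "w \<in> R H" "w \<in> sites"
    obtain x y where xy: "w = (x, y)" by fastforce
    then have y: "y \<le> H" using w by (simp add: mem_R)
    define j where "j = nat (H - y)"
    have j: "nat (H + 1 - y) = Suc j" "nat (H + 1 - (y + 1)) = j" "nat (H + 1 - (y - 1)) = Suc (Suc j)"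
      using y by (auto simp: j_def)
    define r where "r = decay N k"
    have "4 * avg (f k) w = (C k (x + 1) + C k (x - 1)) * r ^ Suc j + C k x * r ^ j * (r\<^sup>2 + 1)"
    proof -
      have "f k (a, y) = C k a * r ^ Suc j" "f k (a, y + 1) = C k a * r ^ j"
        "f k (a, y - 1) = C k a * r ^ Suc (Suc j)" for a
        unfolding f_def fst_conv snd_conv j r_def using y by simp_all
      then show ?thesis unfolding xy avg_eq by (simp add: Cmod algebra_simps power2_eq_square)
    qed
    also have "\<dots> = 4 * (C k x * r ^ Suc j)"
      unfolding Csum r_def decay(3) by (simp add: algebra_simps)
    finally show "f k w = avg (f k) w" using y by (simp add: f_def xy j r_def)
  qed (use v in auto)
  have ind: "(\<Sum>k<N. f k w) / real N = indicator {u} w" if w: "w \<in> level N (H + 1)" for w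
  proof -
    obtain x where x: "w = (x, H + 1)" "0 \<le> x" "x < int N" using w by (auto simp: level_def cylinder_def)
    have "(\<Sum>k<N. f k w) = (\<Sum>k<N. C k x)" by (simp add: f_def x)
    also have "\<dots> = (if x = c then real N else 0)"
    proof (cases "x = c")
      case False
      then show ?thesis using x c unfolding C_def by (subst sum_cos_roots) auto
    qed (simp add: C_def)
    finally show ?thesis using Np by (auto simp: x c indicator_def)
  qed
  have "pmf (exit_pmf (R H) v) u = measure_pmf.expectation (exit_pmf (R H) v) (indicator {u})"
    by (simp add: measure_pmf_single)
  also have "\<dots> = measure_pmf.expectation (exit_pmf (R H) v) (\<lambda>w. (\<Sum>k<N. f k w) / real N)"
    by (rule integral_cong_AE) (use ind exit_pmf_R_level[OF v] in \<open>auto simp: AE_measure_pmf_iff\<close>)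
  also have "\<dots> = (\<Sum>k<N. f k v) / real N"
  proof -
    have "integrable (exit_pmf (R H) v) (f k)" for k
    proof (rule integrable_bounded_pmf[of _ 1])
      fix w
      have "\<bar>C k (fst w)\<bar> * decay N k ^ nat (H + 1 - snd w) \<le> 1 * 1"
        using decay(1,2)[of N k] by (intro mult_mono power_le_one) (auto simp: C_def)
      then show "\<bar>f k w\<bar> \<le> 1" using decay(1)[of N k] by (auto simp: f_def abs_mult)
    qed
    then show ?thesis by (simp add: os)
  qed
  also have "(\<Sum>k<N. f k v) = f 0 v + (\<Sum>k\<in>{1..<N}. f k v)"
  proof -
    have "{..<N} = insert 0 {1..<N}" using Np by auto
    then show ?thesis by simp
  qed
  also have "f 0 v = 1" using v by (simp add: f_def C_def xy decay_def)
  finally have "pmf (exit_pmf (R H) v) u - 1 / real N = (\<Sum>k\<in>{1..<N}. f k v) / real N"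
    by (simp add: add_divide_distrib)
  also have "\<bar>\<dots>\<bar> \<le> (\<Sum>k\<in>{1..<N}. exp (- real_of_int (H + 1 - snd v) / real N)) / real N"
  proof -
    have "\<bar>f k v\<bar> \<le> exp (- real_of_int (H + 1 - snd v) / real N)" if "k \<in> {1..<N}" for k
    proof -
      have "\<bar>f k v\<bar> \<le> 1 * decay N k ^ nat (H + 1 - snd v)"
        using decay(1)[of N k] v by (auto simp: f_def abs_mult C_def intro!: mult_right_mono)
      also have "\<dots> \<le> exp (- 1 / real N) ^ nat (H + 1 - snd v)"
        using decay(1)[of N k] decay_le_exp[of k N] that by (simp add: power_mono)
      also have "\<dots> = exp (real (nat (H + 1 - snd v)) * (- 1 / real N))"
        by (simp only: exp_of_nat_mult)
      also have "real (nat (H + 1 - snd v)) = real_of_int (H + 1 - snd v)" using v by simp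
      also have "real_of_int (H + 1 - snd v) * (- 1 / real N) = - real_of_int (H + 1 - snd v) / real N" by (simp only: times_divide_eq_right mult_minus1_right)
      finally show ?thesis .
    qed
    then have "\<bar>\<Sum>k\<in>{1..<N}. f k v\<bar> \<le> (\<Sum>k\<in>{1..<N}. exp (- real_of_int (H + 1 - snd v) / real N))"
      by (intro order_trans[OF sum_abs] sum_mono)
    then show ?thesis using Np by (simp add: divide_right_mono)
  qed
  also have "\<dots> \<le> exp (- real_of_int (H + 1 - snd v) / real N)"
    using Np by (simp add: field_simps)
  finally show ?thesis .
qed

text \<open>Summed over a starting level, the probability of leaving at \<open>u\<close> is a
  bounded harmonic sequence in that level. It is therefore constant, with value 1 read off at level
  H + 1.\<close>

lemma exit_pmf_R_unif:
  assumes "y \<le> H + 1"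
  shows "bind_pmf (pmf_of_set (level N y)) (exit_pmf (R H)) = pmf_of_set (level N (H + 1))"
proof (rule pmf_eqI)
  fix u
  have supp: "set_pmf (bind_pmf (pmf_of_set (level N y)) (exit_pmf (R H))) \<subseteq> level N (H + 1)"
  proof
    fix w assume "w \<in> set_pmf (bind_pmf (pmf_of_set (level N y)) (exit_pmf (R H)))"
    then obtain v where v: "v \<in> level N y" "w \<in> set_pmf (exit_pmf (R H) v)" by auto
    then have "v \<in> sites" "snd v = y" by (auto simp: level_def)
    then show "w \<in> level N (H + 1)" using exit_pmf_R_level v(2) assms by simp
  qed
  show "pmf (bind_pmf (pmf_of_set (level N y)) (exit_pmf (R H))) u = pmf (pmf_of_set (level N (H + 1))) u"
  proof (cases "u \<in> level N (H + 1)")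
    case False
    then show ?thesis using supp by (subst (1) pmf_eq_0_set_pmf[THEN iffD2]) auto
  next
    case True
    define f where "f v = pmf (exit_pmf (R H) v) u" for v
    define \<phi> where "\<phi> = row_sum f"
    have "\<phi> y = \<phi> (H + 1)"
    proof (rule harmonic_bounded_const[OF _ _ assms])
      fix j assume j: "j \<le> H"
      have "f v = avg f v" if "v \<in> R H" for v
        unfolding f_def avg_def using that by (subst exit_pmf_step) (auto simp: mem_R pmf_bind)
      then have "row_sum f j = row_sum (avg f) j"
        unfolding row_sum_def using j by (intro sum.cong) (auto simp: mem_R mem_sites)
      then show "2 * \<phi> j = \<phi> (j + 1) + \<phi> (j - 1)" unfolding row_sum_avg \<phi>_def by simp
    next
      fix j
      have "\<bar>\<phi> j\<bar> \<le> (\<Sum>x\<in>{0..<int N}. \<bar>f (x, j)\<bar>)" unfolding \<phi>_def row_sum_def by (rule sum_abs)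
      also have "\<dots> \<le> (\<Sum>x\<in>{0..<int N}. 1)" by (intro sum_mono) (simp add: f_def pmf_le_1)
      finally show "\<bar>\<phi> j\<bar> \<le> real N" by simp
    qed
    moreover have "\<phi> (H + 1) = 1"
    proof -
      obtain c where c: "u = (c, H + 1)" "0 \<le> c" "c < int N" using True by (auto simp: level_def cylinder_def)
      have "f (x, H + 1) = (if x = c then 1 else 0)" for x
        unfolding f_def by (subst exit_pmf_outside) (auto simp: mem_R c)
      then show ?thesis using c by (simp add: \<phi>_def row_sum_def)
    qed
    moreover have "(\<Sum>v\<in>level N y. f v) = \<phi> y"
      unfolding \<phi>_def row_sum_def
      by (rule sum.reindex_bij_witness[of _ "\<lambda>x. (x, y)" fst]) (auto simp: level_def cylinder_def)
    ultimately show ?thesis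
      using True by (subst pmf_bind_pmf_of_set) (simp_all add: f_def)
  qed
qed

section \<open>Exchanging given particles for uniform ones\<close>

lemma settle_via_R:
  assumes "R H \<subseteq> B" "bounded_above B" "v \<in> sites"
  shows "bind_pmf (exit_pmf (R H) v) (\<lambda>u. settle u B) = settle v B"
  by (rule exit_pmf_kernel) (use assms settle_step[of B] in auto)

lemma settle_unif_via_R:
  assumes "R H \<subseteq> B" "bounded_above B" "-1 \<le> H"
  shows "settle_unif B = bind_pmf (pmf_of_set (level N (H + 1))) (\<lambda>u. settle u B)"
proof -
  have "settle_unif B = bind_pmf (pmf_of_set (level N 0)) (\<lambda>v. bind_pmf (exit_pmf (R H) v) (\<lambda>u. settle u B))"
    unfolding settle_unif_def
    by (intro bind_pmf_cong refl settle_via_R[symmetric]) (use assms level_sites in auto)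
  also have "\<dots> = bind_pmf (bind_pmf (pmf_of_set (level N 0)) (exit_pmf (R H))) (\<lambda>u. settle u B)"
    by (simp add: bind_assoc_pmf)
  finally show ?thesis using assms by (simp add: exit_pmf_R_unif)
qed

text \<open>Either particle reaches level H + 1 before it can settle and evolves in the same way
  afterwards. The hitting laws differ by at most the exponential at each of N sites, hence the
  factor N. The continuation \<open>K\<close> is left free so that such bounds can be
  chained.\<close>

lemma settle_near_unif:
  assumes B: "R H \<subseteq> B" "bounded_above B" and H: "-1 \<le> H" and v: "v \<in> sites" "snd v \<le> H + 1"
  shows "\<bar>measure_pmf.prob (bind_pmf (settle v B) K) S - measure_pmf.prob (bind_pmf (settle_unif B) K) S\<bar>
    \<le> real N * exp (- real_of_int (H + 1 - snd v) / real N)"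
proof -
  define F where "F u = measure_pmf.prob (bind_pmf (settle u B) K) S" for u
  have 1: "measure_pmf.prob (bind_pmf (settle v B) K) S = (\<Sum>u\<in>level N (H + 1). pmf (exit_pmf (R H) v) u * F u)"
  proof -
    have "measure_pmf.prob (bind_pmf (settle v B) K) S = measure_pmf.expectation (exit_pmf (R H) v) F"
      unfolding F_def
      by (subst settle_via_R[OF B v(1), symmetric]) (simp only: bind_assoc_pmf measure_bind_pmf)
    also have "\<dots> = (\<Sum>u\<in>level N (H + 1). pmf (exit_pmf (R H) v) u *\<^sub>R F u)"
      by (rule integral_measure_pmf) (use exit_pmf_R_level[OF v] in auto)
    finally show ?thesis by simp
  qed
  have 2: "measure_pmf.prob (bind_pmf (settle_unif B) K) S = (\<Sum>u\<in>level N (H + 1). 1 / real N * F u)"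
  proof -
    have "measure_pmf.prob (bind_pmf (settle_unif B) K) S = measure_pmf.expectation (pmf_of_set (level N (H + 1))) F"
      unfolding F_def
      by (subst settle_unif_via_R[OF B H]) (simp only: bind_assoc_pmf measure_bind_pmf)
    also have "\<dots> = sum F (level N (H + 1)) / real N"
      by (subst integral_pmf_of_set) auto
    finally show ?thesis by (simp add: sum_divide_distrib)
  qed
  have "\<bar>measure_pmf.prob (bind_pmf (settle v B) K) S - measure_pmf.prob (bind_pmf (settle_unif B) K) S\<bar>
      = \<bar>\<Sum>u\<in>level N (H + 1). (pmf (exit_pmf (R H) v) u - 1 / real N) * F u\<bar>"
    unfolding 1 2 by (simp add: sum_subtractf left_diff_distrib)
  also have "\<dots> \<le> (\<Sum>u\<in>level N (H + 1). exp (- real_of_int (H + 1 - snd v) / real N))"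
  proof (intro order_trans[OF sum_abs] sum_mono)
    fix u assume u: "u \<in> level N (H + 1)"
    have "\<bar>(pmf (exit_pmf (R H) v) u - 1 / real N) * F u\<bar> \<le> exp (- real_of_int (H + 1 - snd v) / real N) * 1"
      unfolding abs_mult using exit_pmf_R_near_uniform[OF v u] by (intro mult_mono) (auto simp: F_def)
    then show "\<bar>(pmf (exit_pmf (R H) v) u - 1 / real N) * F u\<bar> \<le> exp (- real_of_int (H + 1 - snd v) / real N)"
      by simp
  qed
  finally show ?thesis by simp
qed

text \<open>The particles are exchanged one at a time, each at the cost of one error term;
  \<open>R H\<close> stays inside the cluster because clusters only grow.\<close>

lemma release_near_grow:
  assumes "R H \<subseteq> B" "bounded_above B" "-1 \<le> H" "set vs \<subseteq> R L" "L \<le> H + 1"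
  shows "\<bar>measure_pmf.prob (release vs B) S - measure_pmf.prob (grow (length vs) B) S\<bar>
    \<le> real (length vs) * (real N * exp (- real_of_int (H + 1 - L) / real N))"
  using assms
proof (induction vs arbitrary: B)
  case Nil
  then show ?case by simp
next
  case (Cons v vs)
  define e where "e = real N * exp (- real_of_int (H + 1 - L) / real N)"
  have v: "v \<in> sites" "snd v \<le> L" using Cons.prems by (auto simp: mem_R)
  have "\<bar>measure_pmf.prob (release (v # vs) B) S - measure_pmf.prob (bind_pmf (settle v B) (grow (length vs))) S\<bar>
      \<le> real (length vs) * e"
    unfolding release.simps e_def
    by (rule prob_bind_diff_le, rule Cons.IH)
       (use Cons.prems settle_mono[OF Cons.prems(2) v(1)] in auto)
  moreover have "\<bar>measure_pmf.prob (bind_pmf (settle v B) (grow (length vs))) S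
      - measure_pmf.prob (grow (length (v # vs)) B) S\<bar> \<le> e"
  proof -
    have "\<bar>measure_pmf.prob (bind_pmf (settle v B) (grow (length vs))) S
      - measure_pmf.prob (grow (length (v # vs)) B) S\<bar> \<le> real N * exp (- real_of_int (H + 1 - snd v) / real N)"
      using settle_near_unif[OF Cons.prems(1-3) v(1)] v Cons.prems by simp
    also have "\<dots> \<le> e" unfolding e_def using v N3 by (intro mult_left_mono) (auto intro!: divide_right_mono)
    finally show ?thesis .
  qed
  ultimately show ?case unfolding e_def[symmetric] by (simp add: algebra_simps)
qed

end

section \<open>Inner bound\<close>

text \<open>The product of 1 - x + x^2 / 2 and 1 + x + x^2 / 2 is 1 + x^4 / 4, and the second factor
  is at most \<open>exp x\<close>.\<close>

lemma exp_minus_le_quadratic: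
  fixes x :: real
  assumes "0 \<le> x"
  shows "exp (- x) \<le> 1 - x + x\<^sup>2 / 2"
proof -
  have pos: "0 \<le> 1 - x + x\<^sup>2 / 2"
    using zero_le_power2[of "x - 1"] by (simp add: power2_diff)
  have "(1 - x + x\<^sup>2 / 2) * (1 + x + x\<^sup>2 / 2) = 1 + (x\<^sup>2 / 2)\<^sup>2"
    by (simp add: algebra_simps power2_eq_square)
  then have "1 \<le> (1 - x + x\<^sup>2 / 2) * (1 + x + x\<^sup>2 / 2)" by simp
  also have "\<dots> \<le> (1 - x + x\<^sup>2 / 2) * exp x"
    by (intro mult_left_mono exp_lower_Taylor_quadratic assms pos)
  finally show ?thesis by (simp add: exp_minus field_simps)
qed

lemma power_div_fact_le_exp:
  fixes x :: real
  assumes "0 \<le> x"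
  shows "x ^ j / fact j \<le> exp x"
proof -
  have "(\<lambda>n. x ^ n /\<^sub>R fact n) sums exp x" by (rule exp_converges)
  then have "(\<Sum>n\<in>{j}. x ^ n /\<^sub>R fact n) \<le> exp x"
    unfolding sums_iff using assms sum_le_suminf[of "\<lambda>n. x ^ n /\<^sub>R fact n" "{j}"] by auto
  then show ?thesis by (simp add: divide_inverse mult.commute)
qed

lemma binomial_power_bound:
  assumes "n > 0" "16 * real m \<le> real n * real j"
  shows "(2 / real n) ^ j * real (m choose (j + 1)) \<le> real m * exp (- real j)"
proof -
  have "real ((m choose (j + 1)) * fact (j + 1)) \<le> real (m ^ (j + 1))"
    unfolding of_nat_le_iff by (rule binomial_fact_pow)
  then have "real (m choose (j + 1)) * fact (j + 1) \<le> real m ^ (j + 1)"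
    unfolding of_nat_mult of_nat_power of_nat_fact .
  moreover have "(fact j :: real) \<le> fact (j + 1)" by (rule fact_mono) simp
  then have "real (m choose (j + 1)) * fact j \<le> real (m choose (j + 1)) * fact (j + 1)"
    by (rule mult_left_mono) simp
  ultimately have "real (m choose (j + 1)) * fact j \<le> real m * real m ^ j" by simp
  then have c: "real (m choose (j + 1)) \<le> real m * real m ^ j / fact j" by (simp add: field_simps)
  have e2: "exp 2 \<le> (8 :: real)"
  proof -
    have "exp (2 :: real) = exp 1 * exp 1" by (simp flip: exp_add)
    also have "\<dots> \<le> 2.8 * 2.8" using e_less_272 by (intro mult_mono) auto
    finally show ?thesis by simp
  qed
  have "2 * real m / real n * exp 2 \<le> 2 * real m / real n * 8"
    using e2 by (intro mult_left_mono) auto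
  also have "\<dots> \<le> real j" using assms by (simp add: field_simps)
  finally have x: "2 * real m / real n \<le> real j * exp (- 2)" by (simp add: exp_minus field_simps)
  have "(2 / real n) ^ j * real (m choose (j + 1)) \<le> (2 / real n) ^ j * (real m * real m ^ j / fact j)"
    by (intro mult_left_mono c) simp
  also have "\<dots> = real m * ((2 * real m / real n) ^ j / fact j)"
    by (simp add: power_mult_distrib power_divide)
  also have "\<dots> \<le> real m * ((real j * exp (- 2)) ^ j / fact j)"
    by (intro mult_left_mono divide_right_mono power_mono x) auto
  also have "\<dots> = real m * (exp (- 2 * real j) * (real j ^ j / fact j))"
    by (simp add: power_mult_distrib exp_of_nat_mult[symmetric] mult.commute)
  also have "\<dots> \<le> real m * (exp (- 2 * real j) * exp (real j))"
    by (intro mult_left_mono power_div_fact_le_exp) auto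
  also have "exp (- 2 * real j) * exp (real j) = exp (- real j)" by (simp flip: exp_add)
  finally show ?thesis .
qed

context cyl
begin

section \<open>Freezing the particles that leave \<open>R H\<close>\<close>

definition exit_unif :: "site set \<Rightarrow> site pmf" where
  "exit_unif B = bind_pmf (pmf_of_set (level N 0)) (exit_pmf B)"

lemma settle_unif_eq: "settle_unif B = map_pmf (\<lambda>a. insert a B) (exit_unif B)"
  by (simp add: settle_unif_def exit_unif_def settle_def map_bind_pmf)

text \<open>
  Particles that leave \<open>R H\<close> before settling are frozen there; by \<open>release_unif_commute\<close> they
  may be released after all others have settled or been frozen.
\<close>

definition freeze :: "int \<Rightarrow> site set \<times> site list \<Rightarrow> site \<Rightarrow> site set \<times> site list" where
  "freeze H s a = (if a \<in> R H then (insert a (fst s), snd s) else (fst s, a # snd s))"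

primrec frozen :: "int \<Rightarrow> nat \<Rightarrow> (site set \<times> site list) pmf" where
  "frozen H 0 = return_pmf (R 0, [])"
| "frozen H (Suc n) = bind_pmf (frozen H n) (\<lambda>s. map_pmf (freeze H s) (exit_unif (fst s)))"

lemma bounded_above_subset: "A \<subseteq> B \<Longrightarrow> bounded_above B \<Longrightarrow> bounded_above A"
  unfolding bounded_above_def by blast

lemma exit_unif_supp:
  assumes "B \<subseteq> R H" "0 \<le> H" "a \<in> set_pmf (exit_unif B)"
  shows "a \<in> sites" "a \<notin> B" "snd a \<le> H + 1"
proof -
  obtain v where v: "v \<in> level N 0" "a \<in> set_pmf (exit_pmf B v)"
    using assms(3) by (auto simp: exit_unif_def)
  then have vc: "v \<in> sites" "snd v = 0" by (auto simp: level_def)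
  have B: "snd w \<le> H" if "w \<in> B" for w using assms(1) that by (auto simp: mem_R)
  then have "bounded_above B" unfolding bounded_above_def by blast
  then show "a \<in> sites" "a \<notin> B" using exit_pmf_sites exit_pmf_not_in v(2) vc(1) by auto
  show "snd a \<le> H + 1" by (rule exit_pmf_height[OF B vc(1) _ v(2)]) (use vc assms(2) in auto)
qed

text \<open>Every particle either fills a new site of \<open>R H\<close> or joins the list. This
  conservation law later gives the exact number of frozen particles once \<open>R H\<close> is
  full.\<close>

lemma set_frozen:
  assumes "s \<in> set_pmf (frozen H n)" "0 \<le> H"
  shows "R 0 \<subseteq> fst s" "fst s \<subseteq> R H" "set (snd s) \<subseteq> R (H + 1)"
    "finite (fst s - R 0)" "length (snd s) + card (fst s - R 0) = n"
proof -
  have "R 0 \<subseteq> fst s \<and> fst s \<subseteq> R H \<and> set (snd s) \<subseteq> R (H + 1) \<and> finite (fst s - R 0) \<and>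
      length (snd s) + card (fst s - R 0) = n"
    using assms(1)
  proof (induction n arbitrary: s)
    case 0
    then show ?case using assms(2) by (auto simp: mem_R)
  next
    case (Suc n)
    then obtain s' a where s': "s' \<in> set_pmf (frozen H n)" "a \<in> set_pmf (exit_unif (fst s'))" "s = freeze H s' a"
      by auto
    note IH = Suc.IH[OF s'(1)]
    have a: "a \<in> sites" "a \<notin> fst s'" "snd a \<le> H + 1"
      using exit_unif_supp[OF _ assms(2) s'(2)] IH by auto
    then have "a \<notin> R 0" using IH by blast
    then have "insert a (fst s') - R 0 = insert a (fst s' - R 0)" by auto
    then show ?case using IH a s'(3) by (auto simp: freeze_def mem_R)
  qed
  then show "R 0 \<subseteq> fst s" "fst s \<subseteq> R H" "set (snd s) \<subseteq> R (H + 1)"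
    "finite (fst s - R 0)" "length (snd s) + card (fst s - R 0) = n" by auto
qed

lemma R_sites: "R H \<subseteq> sites"
  by (auto simp: mem_R)

lemma grow_eq_frozen:
  assumes "0 \<le> H"
  shows "grow n (R 0) = bind_pmf (frozen H n) (\<lambda>s. release (snd s) (fst s))"
proof (induction n)
  case 0
  then show ?case by (simp add: bind_return_pmf)
next
  case (Suc n)
  have "grow (Suc n) (R 0) = bind_pmf (frozen H n) (\<lambda>s. bind_pmf (release (snd s) (fst s)) settle_unif)"
    unfolding grow_Suc' Suc by (simp add: bind_assoc_pmf)
  also have "\<dots> = bind_pmf (frozen H n) (\<lambda>s. bind_pmf (map_pmf (freeze H s) (exit_unif (fst s)))
      (\<lambda>s. release (snd s) (fst s)))"
  proof (rule bind_pmf_cong[OF refl])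
    fix s assume s: "s \<in> set_pmf (frozen H n)"
    note s' = set_frozen[OF s assms]
    have "bounded_above (fst s)" "set (snd s) \<subseteq> sites"
      using bounded_above_subset[OF s'(2) bounded_above_R] s'(3) R_sites[of "H + 1"] by auto
    then have "bind_pmf (release (snd s) (fst s)) settle_unif = bind_pmf (settle_unif (fst s)) (release (snd s))"
      by (rule release_unif_commute)
    also have "\<dots> = bind_pmf (exit_unif (fst s)) (\<lambda>a. release (snd s) (insert a (fst s)))"
      by (simp add: settle_unif_eq bind_map_pmf)
    also have "\<dots> = bind_pmf (exit_unif (fst s)) (\<lambda>a. release (snd (freeze H s a)) (fst (freeze H s a)))"
    proof (rule bind_pmf_cong[OF refl])
      fix a assume "a \<in> set_pmf (exit_unif (fst s))"
      then have "a \<notin> fst s" using exit_unif_supp[of "fst s" H a] s' assms by auto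
      then show "release (snd s) (insert a (fst s)) = release (snd (freeze H s a)) (fst (freeze H s a))"
        by (simp add: freeze_def settle_outside bind_return_pmf)
    qed
    finally show "bind_pmf (release (snd s) (fst s)) settle_unif = bind_pmf (map_pmf (freeze H s) (exit_unif (fst s)))
      (\<lambda>s. release (snd s) (fst s))" by (simp add: bind_map_pmf)
  qed
  also have "\<dots> = bind_pmf (frozen H (Suc n)) (\<lambda>s. release (snd s) (fst s))"
    by (simp add: bind_assoc_pmf)
  finally show ?case .
qed

text \<open>The probability that the walk from \<open>v\<close> visits \<open>z\<close> before
  leaving \<open>R H\<close>: with \<open>z\<close> removed from the region, a visit counts as an
  exit.\<close>

definition hit :: "int \<Rightarrow> site \<Rightarrow> site \<Rightarrow> real" where
  "hit H z v = pmf (exit_pmf (R H - {z}) v) z"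

lemma bounded_above_R_diff [simp]: "bounded_above (R H - X)"
  by (rule bounded_above_subset[of _ "R H"]) auto

lemma hit_bounds [simp]: "0 \<le> hit H z v" "hit H z v \<le> 1" "\<bar>hit H z v\<bar> \<le> 1"
  by (simp_all add: hit_def pmf_le_1)

lemma hit_outside: "v \<notin> R H \<Longrightarrow> v \<noteq> z \<Longrightarrow> hit H z v = 0"
  by (simp add: hit_def exit_pmf_outside)

lemma hit_self [simp]: "hit H z z = 1"
  by (simp add: hit_def exit_pmf_outside)

lemma hit_harmonic: "v \<in> R H \<Longrightarrow> v \<noteq> z \<Longrightarrow> hit H z v = avg (hit H z) v"
  unfolding hit_def avg_def by (subst exit_pmf_step) (auto simp: pmf_bind mem_R)

section \<open>Level sums of the visiting probability: a one-dimensional Green function\<close>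

lemma row_sum_hit_bounds: "0 \<le> row_sum (hit H z) j" "row_sum (hit H z) j \<le> real N"
proof -
  show "0 \<le> row_sum (hit H z) j" unfolding row_sum_def by (intro sum_nonneg) simp
  have "row_sum (hit H z) j \<le> (\<Sum>x\<in>{0..<int N}. 1)"
    unfolding row_sum_def by (intro sum_mono) simp
  then show "row_sum (hit H z) j \<le> real N" by simp
qed

lemma row_sum_hit_harmonic:
  assumes "j \<le> H" "j \<noteq> snd z"
  shows "2 * row_sum (hit H z) j = row_sum (hit H z) (j + 1) + row_sum (hit H z) (j - 1)"
proof -
  have "row_sum (hit H z) j = row_sum (avg (hit H z)) j"
    unfolding row_sum_def using assms by (intro sum.cong refl hit_harmonic) (auto simp: mem_R mem_sites)
  then show ?thesis unfolding row_sum_avg by simp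
qed

lemma row_sum_hit_below:
  assumes "z \<in> R H" "j \<le> snd z"
  shows "row_sum (hit H z) j = row_sum (hit H z) (snd z)"
proof -
  have "row_sum (hit H z) j = row_sum (hit H z) (snd z - 1 + 1)"
  proof (rule harmonic_bounded_const)
    fix i
    show "\<bar>row_sum (hit H z) i\<bar> \<le> real N" using row_sum_hit_bounds[of H z i] by simp
    show "2 * row_sum (hit H z) i = row_sum (hit H z) (i + 1) + row_sum (hit H z) (i - 1)" if "i \<le> snd z - 1"
      by (rule row_sum_hit_harmonic) (use that assms in \<open>auto simp: mem_R\<close>)
  qed (use assms in auto)
  then show ?thesis by simp
qed

text \<open>Above \<open>z\<close> the level sums are affine and run from a nonnegative value to 0
  at level H + 1, so their slope is at most 0.\<close>

lemma row_sum_hit_above: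
  assumes z: "z \<in> R H" and j: "snd z \<le> j" "j \<le> H"
  shows "row_sum (hit H z) j \<le> row_sum (hit H z) (snd z)"
proof -
  define \<phi> where "\<phi> = row_sum (hit H z)"
  define d where "d = \<phi> (snd z + 1) - \<phi> (snd z)"
  have lin: "\<phi> (snd z + int i) = \<phi> (snd z) + real i * d \<and> \<phi> (snd z + int i + 1) = \<phi> (snd z) + real (Suc i) * d"
    if "snd z + int i \<le> H" for i
    using that
  proof (induction i)
    case (Suc i)
    have "2 * \<phi> (snd z + int i + 1) = \<phi> (snd z + int i + 1 + 1) + \<phi> (snd z + int i + 1 - 1)"
      unfolding \<phi>_def by (rule row_sum_hit_harmonic) (use Suc.prems in auto)
    then show ?case using Suc by (simp add: algebra_simps)
  qed (simp add: d_def)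
  have "\<phi> (H + 1) = 0"
    unfolding \<phi>_def row_sum_def using z by (intro sum.neutral ballI hit_outside) (auto simp: mem_R)
  moreover have "\<phi> (snd z) \<ge> 0" by (simp add: \<phi>_def row_sum_hit_bounds)
  ultimately have "real (Suc (nat (H - snd z))) * d \<le> 0"
    using lin[of "nat (H - snd z)"] j by simp
  then have "d \<le> 0" by (simp add: mult_le_0_iff)
  then have "real (nat (j - snd z)) * d \<le> 0" by (simp add: mult_le_0_iff)
  then show ?thesis using lin[of "nat (j - snd z)"] j by (simp add: \<phi>_def)
qed

lemma row_sum_hit_ge_1:
  assumes "z \<in> R H" shows "1 \<le> row_sum (hit H z) (snd z)"
proof -
  have "(\<Sum>x\<in>{fst z}. hit H z (x, snd z)) \<le> row_sum (hit H z) (snd z)"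
    unfolding row_sum_def using assms by (intro sum_mono2) (auto simp: mem_R mem_sites cylinder_def)
  then show ?thesis by simp
qed

lemma R_diff_eq: "R H - R 0 = {0..<int N} \<times> {1..H}"
  by (auto simp: filled_def cylinder_def)

text \<open>Each of the H levels contributes at most the level sum at 0, since the level sums are
  constant up to the level of \<open>z\<close> and never larger above it.\<close>

lemma sum_hit_le:
  assumes z: "z \<in> R H" "0 \<le> snd z" and B: "B \<subseteq> R H"
  shows "(\<Sum>a\<in>B - R 0. hit H z a) \<le> real_of_int H * row_sum (hit H z) 0"
proof -
  have H: "0 \<le> H" using z by (simp add: mem_R)
  have "(\<Sum>a\<in>B - R 0. hit H z a) \<le> (\<Sum>a\<in>R H - R 0. hit H z a)"
  proof (rule sum_mono2)
    show "finite (R H - R 0)" by (simp add: R_diff_eq)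
  qed (use B in auto)
  also have "\<dots> = (\<Sum>j\<in>{1..H}. row_sum (hit H z) j)"
  proof -
    have "(\<Sum>j\<in>{1..H}. row_sum (hit H z) j) = (\<Sum>x\<in>{0..<int N}. \<Sum>j\<in>{1..H}. hit H z (x, j))"
      unfolding row_sum_def by (rule sum.swap)
    also have "\<dots> = (\<Sum>(x, j)\<in>R H - R 0. hit H z (x, j))"
      unfolding R_diff_eq by (rule sum.cartesian_product)
    finally show ?thesis by (simp add: case_prod_unfold)
  qed
  also have "\<dots> \<le> (\<Sum>j\<in>{1..H}. row_sum (hit H z) 0)"
  proof (rule sum_mono)
    fix j assume j: "j \<in> {1..H}"
    show "row_sum (hit H z) j \<le> row_sum (hit H z) 0"
    proof (cases "j \<le> snd z")
      case True
      show ?thesis unfolding row_sum_hit_below[OF z] row_sum_hit_below[OF z(1) True] ..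
    next
      case False
      then have "row_sum (hit H z) j \<le> row_sum (hit H z) (snd z)"
        using j by (intro row_sum_hit_above[OF z(1)]) auto
      then show ?thesis unfolding row_sum_hit_below[OF z] .
    qed
  qed
  also have "\<dots> = real_of_int H * row_sum (hit H z) 0" using H by simp
  finally show ?thesis .
qed

lemma expectation_exit_unif_hit:
  assumes "B \<subseteq> R H" "z \<notin> B"
  shows "measure_pmf.expectation (exit_unif B) (hit H z) = row_sum (hit H z) 0 / real N"
proof -
  have "measure_pmf.expectation (exit_unif B) (hit H z) =
      measure_pmf.expectation (pmf_of_set (level N 0)) (\<lambda>v. measure_pmf.expectation (exit_pmf B v) (hit H z))"
    unfolding exit_unif_def by (rule expectation_bind_pmf[of _ 1]) simp
  also have "\<dots> = measure_pmf.expectation (pmf_of_set (level N 0)) (hit H z)"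
  proof (rule integral_cong_AE)
    show "AE v in pmf_of_set (level N 0). measure_pmf.expectation (exit_pmf B v) (hit H z) = hit H z v"
      unfolding AE_measure_pmf_iff
    proof
      fix v assume "v \<in> set_pmf (pmf_of_set (level N 0))"
      then have v: "v \<in> sites" using level_sites by auto
      show "measure_pmf.expectation (exit_pmf B v) (hit H z) = hit H z v"
        by (rule optional_stopping[where B = 1])
           (use assms v bounded_above_subset[OF assms(1)] in \<open>auto intro!: hit_harmonic\<close>)
    qed
  qed auto
  also have "\<dots> = (\<Sum>v\<in>level N 0. hit H z v) / real N"
    by (subst integral_pmf_of_set) auto
  also have "(\<Sum>v\<in>level N 0. hit H z v) = row_sum (hit H z) 0"
    unfolding row_sum_def
    by (rule sum.reindex_bij_witness[of _ "\<lambda>x. (x, 0)" fst]) (auto simp: level_def cylinder_def)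
  finally show ?thesis .
qed


text \<open>
  While \<open>z\<close> is vacant every particle contributes \<open>row_sum (hit H z) 0 / N\<close> on average to the sum of
  \<open>hit H z\<close> over the settled sites, because \<open>hit H z\<close> is harmonic off \<open>z\<close>; but that sum is bounded by
  \<open>sum_hit_le\<close>. The exponential supermartingale makes this quantitative.
\<close>

lemma frozen_vacant:
  assumes z: "z \<in> R H" "1 \<le> snd z" and \<delta>: "0 \<le> \<delta>" "\<delta> \<le> 1"
    and H: "real_of_int H \<le> (1 - \<delta>) * (real n / real N)"
  shows "measure_pmf.prob (frozen H n) {s. z \<notin> fst s} \<le> exp (- (\<delta>\<^sup>2 / 2) * (real n / real N))"
proof -
  have H0: "0 \<le> H" using z by (simp add: mem_R)
  define p where "p = row_sum (hit H z) 0 / real N"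
  define S where "S B = (\<Sum>a\<in>B - R 0. hit H z a)" for B
  \<comment> \<open>The exponential weight is cut to 0 once \<open>z\<close> is filled, so it
    measures only histories in which \<open>z\<close> is still vacant.\<close>
  define f where "f s = (if z \<in> fst s then 0 else exp (- \<delta> * S (fst s)))" for s :: "site set \<times> site list"
  define q where "q = p * (\<delta> - \<delta>\<^sup>2 / 2)"
  have S0: "0 \<le> S B" for B unfolding S_def by (intro sum_nonneg) simp
  have f01: "0 \<le> f s" "f s \<le> 1" "\<bar>f s\<bar> \<le> 1" for s
    using S0[of "fst s"] \<delta> by (auto simp: f_def mult_nonneg_nonneg)
  have step: "measure_pmf.expectation (map_pmf (freeze H s) (exit_unif (fst s))) f \<le> f s * exp (- q)"
    if s: "s \<in> set_pmf (frozen H m)" for s m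
  proof (cases "z \<in> fst s")
    case True
    then have "f (freeze H s a) = 0" for a by (simp add: f_def freeze_def)
    then show ?thesis using f01(1)[of s] by simp
  next
    case False
    note s' = set_frozen[OF s H0]
    have int: "integrable (measure_pmf p) (\<lambda>a. exp (- \<delta> * hit H z a))" "integrable (measure_pmf p) (\<lambda>a. hit H z a)" for p
      using \<delta> by (auto intro!: integrable_bounded_pmf[of _ 1] simp: mult_nonneg_nonneg)
    have "measure_pmf.expectation (map_pmf (freeze H s) (exit_unif (fst s))) f
        \<le> measure_pmf.expectation (exit_unif (fst s)) (\<lambda>a. f s * exp (- \<delta> * hit H z a))"
      unfolding integral_map_pmf
    proof (rule integral_mono_AE)
      show "integrable (exit_unif (fst s)) (\<lambda>a. f (freeze H s a))"
        by (rule integrable_bounded_pmf[of _ 1]) (rule f01)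
      show "integrable (exit_unif (fst s)) (\<lambda>a. f s * exp (- \<delta> * hit H z a))" using int by auto
      show "AE a in exit_unif (fst s). f (freeze H s a) \<le> f s * exp (- \<delta> * hit H z a)"
        unfolding AE_measure_pmf_iff
      proof
        fix a assume a: "a \<in> set_pmf (exit_unif (fst s))"
        have a': "a \<notin> fst s" using exit_unif_supp[OF _ H0 a] s' by auto
        show "f (freeze H s a) \<le> f s * exp (- \<delta> * hit H z a)"
        proof (cases "a \<in> R H")
          case True
          have "insert a (fst s) - R 0 = insert a (fst s - R 0)" using a' s' by auto
          then have "S (insert a (fst s)) = hit H z a + S (fst s)" using a' s'(4) by (simp add: S_def)
          then show ?thesis using True False
            by (auto simp: f_def freeze_def algebra_simps simp flip: exp_add)
        next
          case F: False
          \<comment> \<open>A frozen particle lies outside \<open>R H\<close>, where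
            \<open>hit H z\<close> vanishes, so it changes neither side.\<close>
          then have "hit H z a = 0" using z by (intro hit_outside) auto
          then show ?thesis using F by (simp add: freeze_def f_def)
        qed
      qed
    qed
    also have "\<dots> = f s * measure_pmf.expectation (exit_unif (fst s)) (\<lambda>a. exp (- \<delta> * hit H z a))"
      by simp
    also have "\<dots> \<le> f s * exp (- q)"
    proof (rule mult_left_mono[OF _ f01(1)])
      have "measure_pmf.expectation (exit_unif (fst s)) (\<lambda>a. exp (- \<delta> * hit H z a))
         \<le> measure_pmf.expectation (exit_unif (fst s)) (\<lambda>a. 1 - (\<delta> - \<delta>\<^sup>2 / 2) * hit H z a)"
      proof (rule integral_mono)
        fix a
        have "exp (- \<delta> * hit H z a) \<le> 1 - \<delta> * hit H z a + (\<delta> * hit H z a)\<^sup>2 / 2"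
          using exp_minus_le_quadratic[of "\<delta> * hit H z a"] \<delta> by simp
        \<comment> \<open>The square of a number in [0, 1] is at most that number; this produces the
          drift with factor \<delta> - \<delta>^2 / 2 used in \<open>q\<close>.\<close>
        also have "(\<delta> * hit H z a)\<^sup>2 \<le> \<delta>\<^sup>2 * hit H z a"
          using mult_left_le[of "hit H z a" "hit H z a"] unfolding power_mult_distrib
          by (intro mult_left_mono) (auto simp: power2_eq_square)
        finally show "exp (- \<delta> * hit H z a) \<le> 1 - (\<delta> - \<delta>\<^sup>2 / 2) * hit H z a" by (simp add: algebra_simps)
      qed (use int in auto)
      also have "\<dots> = 1 - (\<delta> - \<delta>\<^sup>2 / 2) * measure_pmf.expectation (exit_unif (fst s)) (hit H z)"
        using int(2) by simp
      also have "\<dots> = 1 - q"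
        using s'(2) False by (simp add: expectation_exit_unif_hit p_def q_def)
      also have "\<dots> \<le> exp (- q)" using exp_ge_add_one_self[of "- q"] by simp
      finally show "measure_pmf.expectation (exit_unif (fst s)) (\<lambda>a. exp (- \<delta> * hit H z a)) \<le> exp (- q)" .
    qed
    finally show ?thesis .
  qed
  have E: "measure_pmf.expectation (frozen H m) f \<le> exp (- q * real m)" for m
  proof (induction m)
    case 0
    then show ?case using f01[of "(R 0, [])"] by simp
  next
    case (Suc m)
    have "measure_pmf.expectation (frozen H (Suc m)) f =
        measure_pmf.expectation (frozen H m) (\<lambda>s. measure_pmf.expectation (map_pmf (freeze H s) (exit_unif (fst s))) f)"
      unfolding frozen.simps by (rule expectation_bind_pmf[of _ 1]) (rule f01)
    also have "\<dots> \<le> measure_pmf.expectation (frozen H m) (\<lambda>s. f s * exp (- q))"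
      by (rule integral_mono_AE)
         (use step in \<open>auto simp: AE_measure_pmf_iff simp del: integral_map_pmf
           intro!: integrable_bounded_pmf[of _ 1] abs_expectation_le f01 integrable_mult_left\<close>)
    also have "\<dots> = measure_pmf.expectation (frozen H m) f * exp (- q)" by simp
    also have "\<dots> \<le> exp (- q * real m) * exp (- q)" using Suc by (intro mult_right_mono) auto
    also have "\<dots> = exp (- q * real (Suc m))" by (simp add: algebra_simps flip: exp_add)
    finally show ?case .
  qed
  define r where "r = row_sum (hit H z) 0"
  have r1: "1 \<le> r" using row_sum_hit_ge_1[OF z(1)] row_sum_hit_below[OF z(1), of 0] z by (simp add: r_def)
  \<comment> \<open>Markov's inequality: while \<open>z\<close> is vacant, \<open>sum_hit_le\<close>
    bounds the weight \<open>f\<close> from below.\<close>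
  have "measure_pmf.prob (frozen H n) {s. z \<notin> fst s} * exp (- \<delta> * (real_of_int H * r)) =
      measure_pmf.expectation (frozen H n) (\<lambda>s. indicator {s. z \<notin> fst s} s * exp (- \<delta> * (real_of_int H * r)))"
    by simp
  also have "\<dots> \<le> measure_pmf.expectation (frozen H n) f"
  proof (rule integral_mono_AE)
    show "AE s in frozen H n. indicator {s. z \<notin> fst s} s * exp (- \<delta> * (real_of_int H * r)) \<le> f s"
      unfolding AE_measure_pmf_iff
    proof
      fix s assume s: "s \<in> set_pmf (frozen H n)"
      have "S (fst s) \<le> real_of_int H * r"
        unfolding S_def r_def by (rule sum_hit_le[OF z(1)]) (use z set_frozen[OF s H0] in auto)
      then have "\<delta> * S (fst s) \<le> \<delta> * (real_of_int H * r)" using \<delta> by (intro mult_left_mono) auto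
      then show "indicator {s. z \<notin> fst s} s * exp (- \<delta> * (real_of_int H * r)) \<le> f s"
        by (auto simp: f_def indicator_def)
    qed
    show "integrable (frozen H n) (\<lambda>s. indicator {s. z \<notin> fst s} s * exp (- \<delta> * (real_of_int H * r)))"
      by (rule integrable_bounded_pmf[of _ "exp (- \<delta> * (real_of_int H * r))"]) (auto simp: indicator_def)
    show "integrable (frozen H n) f" by (rule integrable_bounded_pmf[of _ 1]) (rule f01)
  qed
  also have "\<dots> \<le> exp (- q * real n)" by (rule E)
  finally have "measure_pmf.prob (frozen H n) {s. z \<notin> fst s} \<le> exp (- q * real n) / exp (- \<delta> * (real_of_int H * r))"
    by (simp add: field_simps)
  also have "\<dots> = exp (r * (\<delta> * real_of_int H - (real n / real N) * (\<delta> - \<delta>\<^sup>2 / 2)))"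
    by (simp add: q_def p_def r_def[symmetric] field_simps flip: exp_diff)
  also have "\<dots> \<le> exp (- (\<delta>\<^sup>2 / 2) * (real n / real N))"
  proof -
    have "\<delta> * real_of_int H \<le> \<delta> * ((1 - \<delta>) * (real n / real N))" using H \<delta> by (intro mult_left_mono)
    then have 1: "\<delta> * real_of_int H - (real n / real N) * (\<delta> - \<delta>\<^sup>2 / 2) \<le> - (\<delta>\<^sup>2 / 2) * (real n / real N)"
    proof -
      have "\<delta> * h - u * (\<delta> - \<delta>\<^sup>2 / 2) \<le> - (\<delta>\<^sup>2 / 2) * u" if "\<delta> * h \<le> \<delta> * ((1 - \<delta>) * u)" for h u
        using that by (simp add: algebra_simps power2_eq_square)
      then show ?thesis using \<open>\<delta> * real_of_int H \<le> _\<close> by blast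
    qed
    also have "- (\<delta>\<^sup>2 / 2) * (real n / real N) \<le> 0" by (simp add: mult_nonneg_nonneg)
    finally have neg: "\<delta> * real_of_int H - (real n / real N) * (\<delta> - \<delta>\<^sup>2 / 2) \<le> 0" .
    \<comment> \<open>The bracket is nonpositive, so r, which is at least 1, may be lowered to 1.
      This makes the bound independent of \<open>z\<close>.\<close>
    have "r * (\<delta> * real_of_int H - (real n / real N) * (\<delta> - \<delta>\<^sup>2 / 2))
        \<le> 1 * (\<delta> * real_of_int H - (real n / real N) * (\<delta> - \<delta>\<^sup>2 / 2))"
      using r1 neg by (rule mult_right_mono_neg)
    then show ?thesis using 1 by simp
  qed
  finally show ?thesis .
qed

lemma frozen_not_full:
  assumes H0: "0 \<le> H" and \<delta>: "0 \<le> \<delta>" "\<delta> \<le> 1"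
    and H: "real_of_int H \<le> (1 - \<delta>) * (real n / real N)"
  shows "measure_pmf.prob (frozen H n) {s. \<not> R H \<subseteq> fst s} \<le>
    real N * real_of_int H * exp (- (\<delta>\<^sup>2 / 2) * (real n / real N))"
proof -
  have fin: "finite (R H - R 0)" by (simp add: R_diff_eq)
  have "measure_pmf.prob (frozen H n) {s. \<not> R H \<subseteq> fst s} \<le>
      measure_pmf.prob (frozen H n) (\<Union>z\<in>R H - R 0. {s. z \<notin> fst s})"
  proof (rule measure_pmf.finite_measure_mono_AE)
    show "AE s in frozen H n. s \<in> {s. \<not> R H \<subseteq> fst s} \<longrightarrow> s \<in> (\<Union>z\<in>R H - R 0. {s. z \<notin> fst s})"
      unfolding AE_measure_pmf_iff
    proof (intro ballI impI)
      fix s assume "s \<in> set_pmf (frozen H n)" "s \<in> {s. \<not> R H \<subseteq> fst s}"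
      then show "s \<in> (\<Union>z\<in>R H - R 0. {s. z \<notin> fst s})" using set_frozen(1)[of s H n] H0 by blast
    qed
  qed simp
  also have "\<dots> \<le> (\<Sum>z\<in>R H - R 0. measure_pmf.prob (frozen H n) {s. z \<notin> fst s})"
    using fin by (intro measure_pmf.finite_measure_subadditive_finite) auto
  also have "\<dots> \<le> (\<Sum>z\<in>R H - R 0. exp (- (\<delta>\<^sup>2 / 2) * (real n / real N)))"
    using assms by (intro sum_mono frozen_vacant) (auto simp: mem_R)
  also have "\<dots> = real N * real_of_int H * exp (- (\<delta>\<^sup>2 / 2) * (real n / real N))"
    using H0 by (simp add: R_diff_eq card_cartesian_product)
  finally show ?thesis .
qed

end

section \<open>Outer bound\<close>

context cyl
begin

text \<open>To pass level y the walk must first meet it at an occupied site; at a vacant one it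
  would stop. Letting it run through all of \<open>R (y - 1)\<close> can only increase the chance of
  meeting such a site, and after J levels of mixing each site of level y is hit with probability at
  most 1 / N + 1 / N.\<close>

lemma exit_above_le:
  assumes A: "bounded_above A" "finite (A \<inter> level N y)" and v: "v \<in> sites" "snd v + J \<le> y"
    and J: "0 \<le> J" "real N * exp (- real_of_int J / real N) \<le> 1"
  shows "measure_pmf.prob (exit_pmf A v) {a. y + 1 \<le> snd a} \<le> 2 / real N * real (card (A \<inter> level N y))"
proof -
  define X where "X = A \<inter> level N y"
  define B where "B = A \<inter> R (y - 1)"
  have int: "integrable (measure_pmf p) (\<lambda>u. measure_pmf.prob (K u) S)" for p and K :: "site \<Rightarrow> site pmf" and S
    by (rule integrable_bounded_pmf[of _ 1]) simp
  have intX: "integrable (measure_pmf p) (indicator X :: site \<Rightarrow> real)" for p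
    by (rule integrable_bounded_pmf[of _ 1]) (simp add: indicator_def)
  have vy: "snd v \<le> y" using v J by simp
  have "measure_pmf.prob (exit_pmf A v) {a. y + 1 \<le> snd a} =
      measure_pmf.expectation (exit_pmf B v) (\<lambda>u. measure_pmf.prob (exit_pmf A u) {a. y + 1 \<le> snd a})"
    by (subst exit_pmf_absorb[OF A(1) _ v(1), of B, symmetric]) (auto simp: B_def measure_bind_pmf)
  also have "\<dots> \<le> measure_pmf.expectation (exit_pmf B v) (indicator X)"
  proof (rule integral_mono_AE[OF int intX])
    show "AE u in exit_pmf B v. measure_pmf.prob (exit_pmf A u) {a. y + 1 \<le> snd a} \<le> indicator X u"
      unfolding AE_measure_pmf_iff
    proof
      fix u assume u: "u \<in> set_pmf (exit_pmf B v)"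
      have "snd u \<le> y - 1 + 1"
        by (rule exit_pmf_height[of B "y - 1" v]) (use u v vy in \<open>auto simp: B_def mem_R\<close>)
      then have uy: "snd u \<le> y" by simp
      have "u \<in> sites" using u v by (rule_tac exit_pmf_sites)
      moreover have "u \<notin> B"
        using exit_pmf_not_in[OF _ v(1) u] bounded_above_subset[of B A] A by (auto simp: B_def)
      ultimately have "u \<notin> A \<or> u \<in> X" using uy
        by (cases u) (auto simp: B_def X_def level_def mem_R)
      then show "measure_pmf.prob (exit_pmf A u) {a. y + 1 \<le> snd a} \<le> indicator X u"
      proof
        assume "u \<notin> A"
        then show ?thesis using uy by (simp add: exit_pmf_outside)
      qed simp
    qed
  qed
  \<comment> \<open>A walk already on level y lies outside \<open>R (y - 1)\<close> and stays put,
    while walks stopped lower get another chance.\<close>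
  also have "\<dots> \<le> measure_pmf.expectation (exit_pmf B v) (\<lambda>u. measure_pmf.prob (exit_pmf (R (y - 1)) u) X)"
  proof (rule integral_mono[OF intX int])
    fix u show "indicator X u \<le> measure_pmf.prob (exit_pmf (R (y - 1)) u) X"
    proof (cases "u \<in> X")
      case True
      then have "u \<notin> R (y - 1)" by (auto simp: X_def level_def mem_R)
      then show ?thesis using True by (simp add: exit_pmf_outside)
    qed simp
  qed
  also have "\<dots> = measure_pmf.prob (exit_pmf (R (y - 1)) v) X"
    by (subst exit_pmf_absorb[OF _ _ v(1), of "R (y - 1)" B, symmetric]) (auto simp: B_def measure_bind_pmf)
  also have "\<dots> = (\<Sum>u\<in>X. pmf (exit_pmf (R (y - 1)) v) u)"
    using A(2) by (intro measure_measure_pmf_finite) (simp add: X_def)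
  also have "\<dots> \<le> (\<Sum>u\<in>X. 2 / real N)"
  proof (rule sum_mono)
    fix u assume "u \<in> X"
    then have u: "u \<in> level N (y - 1 + 1)" by (simp add: X_def)
    have "exp (- real_of_int (y - 1 + 1 - snd v) / real N) \<le> exp (- real_of_int J / real N)"
    proof -
      have "- real_of_int (y - 1 + 1 - snd v) \<le> - real_of_int J" using v by linarith
      then show ?thesis using N3 by (intro exp_le_cancel_iff[THEN iffD2] divide_right_mono) auto
    qed
    also have "\<dots> \<le> 1 / real N" using J N3 by (simp add: field_simps)
    finally show "pmf (exit_pmf (R (y - 1)) v) u \<le> 2 / real N"
      using exit_pmf_R_near_uniform[OF v(1) _ u] vy by simp
  qed
  also have "\<dots> = 2 / real N * real (card (A \<inter> level N y))" by (simp add: X_def)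
  finally show ?thesis .
qed

lemma release_snoc: "release (vs @ [v]) A = bind_pmf (release vs A) (settle v)"
proof (induction vs arbitrary: A)
  case Nil
  have "release [] = return_pmf" by (rule ext) simp
  then show ?case by (simp add: bind_return_pmf bind_return_pmf')
next
  case (Cons a vs)
  have "release ((a # vs) @ [v]) A = bind_pmf (settle a A) (release (vs @ [v]))" by simp
  also have "\<dots> = bind_pmf (settle a A) (\<lambda>B. bind_pmf (release vs B) (settle v))"
    by (intro bind_pmf_cong refl Cons.IH)
  finally show ?case by (simp add: bind_assoc_pmf)
qed

lemma release_supp:
  assumes "bounded_above A" "set vs \<subseteq> sites" "B \<in> set_pmf (release vs A)"
  shows "finite (B - A)" "B - A \<subseteq> sites"
proof -
  have "finite (B - A) \<and> B - A \<subseteq> sites" using assms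
  proof (induction vs arbitrary: A)
    case (Cons v vs)
    then obtain C where C: "C \<in> set_pmf (settle v A)" "B \<in> set_pmf (release vs C)" by auto
    have v: "v \<in> sites" using Cons.prems by simp
    obtain a where a: "a \<in> sites" "C = insert a A" using set_settle[OF Cons.prems(1) v C(1)] .
    have "finite (B - C) \<and> B - C \<subseteq> sites" using Cons.IH[of C] Cons.prems a C by simp
    moreover have "B - A \<subseteq> insert a (B - C)" using a by auto
    ultimately show ?case using a by (auto intro: finite_subset)
  qed simp
  then show "finite (B - A)" "B - A \<subseteq> sites" by auto
qed

text \<open>By \<open>exit_above_le\<close> a further particle adds to the count at offset j + 1 at
  most 2 / N times the current count at offset j. Under induction on the particles this recursion is
  Pascal's rule for the binomial coefficients.\<close>

lemma expected_above_le:
  assumes vs: "set vs \<subseteq> R (H + 1)" and J: "0 \<le> J" "real N * exp (- real_of_int J / real N) \<le> 1"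
  shows "(\<integral>\<^sup>+A. ennreal (real (card {a \<in> A. H + 1 + J + int j \<le> snd a})) \<partial>release vs (R H))
    \<le> ennreal ((2 / real N) ^ j * real (length vs choose (j + 1)))"
  using vs
proof (induction vs arbitrary: j rule: rev_induct)
  case Nil
  have "{a \<in> R H. H + 1 + J + int j \<le> snd a} = {}" using J by (auto simp: mem_R)
  then have "card {a \<in> R H. H + 1 + J + int j \<le> snd a} = 0" by (simp only: card.empty)
  then show ?case by simp
next
  case (snoc v vs)
  define c where "c i A = real (card {a \<in> A. H + 1 + J + int i \<le> snd a})" for i and A :: "site set"
  have v: "v \<in> sites" "snd v \<le> H + 1" and vs: "set vs \<subseteq> R (H + 1)" using snoc.prems by (auto simp: mem_R)
  have supp: "bounded_above A" "finite {a \<in> A. H + 1 + J + int i \<le> snd a}"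
    if "A \<in> set_pmf (release vs (R H))" for A i
  proof -
    have vc: "set vs \<subseteq> sites" using vs R_sites by blast
    show "bounded_above A" using set_release[OF bounded_above_R vc that] by simp
    have "{a \<in> A. H + 1 + J + int i \<le> snd a} \<subseteq> A - R H" using J by (auto simp: mem_R)
    then show "finite {a \<in> A. H + 1 + J + int i \<le> snd a}"
      using release_supp(1)[OF bounded_above_R vc that] by (rule finite_subset)
  qed
  have inner: "(\<integral>\<^sup>+B. ennreal (c j B) \<partial>settle v A) \<le>
      ennreal (c j A) + emeasure (exit_pmf A v) {a. H + 1 + J + int j \<le> snd a}"
    if A: "A \<in> set_pmf (release vs (R H))" for A
  proof -
    have "(\<integral>\<^sup>+B. ennreal (c j B) \<partial>settle v A) = (\<integral>\<^sup>+a. ennreal (c j (insert a A)) \<partial>exit_pmf A v)"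
      by (simp add: settle_def)
    also have "\<dots> \<le> (\<integral>\<^sup>+a. ennreal (c j A) + indicator {a. H + 1 + J + int j \<le> snd a} a \<partial>exit_pmf A v)"
    proof (rule nn_integral_mono)
      fix a
      show "ennreal (c j (insert a A)) \<le> ennreal (c j A) + indicator {a. H + 1 + J + int j \<le> snd a} a"
      proof (cases "H + 1 + J + int j \<le> snd a")
        case True
        then have "{b \<in> insert a A. H + 1 + J + int j \<le> snd b} = insert a {b \<in> A. H + 1 + J + int j \<le> snd b}"
          by auto
        then have "c j (insert a A) \<le> c j A + 1"
          using supp(2)[OF A, of j] by (simp add: c_def card_insert_if)
        then have "ennreal (c j (insert a A)) \<le> ennreal (c j A + 1)" by (rule ennreal_leI)
        then show ?thesis using True by (simp add: c_def)
      next
        case False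
        then have "{b \<in> insert a A. H + 1 + J + int j \<le> snd b} = {b \<in> A. H + 1 + J + int j \<le> snd b}"
          by auto
        then show ?thesis by (simp add: c_def)
      qed
    qed
    also have "\<dots> = ennreal (c j A) + emeasure (exit_pmf A v) {a. H + 1 + J + int j \<le> snd a}"
      by (subst nn_integral_add) auto
    finally show ?thesis .
  qed
  have "(\<integral>\<^sup>+A. ennreal (c j A) \<partial>release (vs @ [v]) (R H)) =
      (\<integral>\<^sup>+A. \<integral>\<^sup>+B. ennreal (c j B) \<partial>settle v A \<partial>release vs (R H))"
    by (simp add: release_snoc)
  also have "\<dots> \<le> (\<integral>\<^sup>+A. ennreal (c j A) + emeasure (exit_pmf A v) {a. H + 1 + J + int j \<le> snd a} \<partial>release vs (R H))"
    using inner by (intro nn_integral_mono_AE) (auto simp: AE_measure_pmf_iff)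
  also have "\<dots> = (\<integral>\<^sup>+A. ennreal (c j A) \<partial>release vs (R H)) +
      (\<integral>\<^sup>+A. emeasure (exit_pmf A v) {a. H + 1 + J + int j \<le> snd a} \<partial>release vs (R H))"
    by (rule nn_integral_add) auto
  also have "\<dots> \<le> ennreal ((2 / real N) ^ j * real (length vs choose (j + 1))) +
      ennreal ((2 / real N) ^ j * real (length vs choose j))"
  proof (rule add_mono)
    show "(\<integral>\<^sup>+A. ennreal (c j A) \<partial>release vs (R H)) \<le> ennreal ((2 / real N) ^ j * real (length vs choose (j + 1)))"
      unfolding c_def by (rule snoc.IH[OF vs])
    show "(\<integral>\<^sup>+A. emeasure (exit_pmf A v) {a. H + 1 + J + int j \<le> snd a} \<partial>release vs (R H))
        \<le> ennreal ((2 / real N) ^ j * real (length vs choose j))"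
    proof (cases j)
      \<comment> \<open>At offset 0 the trivial bound of one new site per particle is used.\<close>
      case 0
      have "(\<integral>\<^sup>+A. emeasure (exit_pmf A v) {a. H + 1 + J + int j \<le> snd a} \<partial>release vs (R H)) \<le> (\<integral>\<^sup>+A. 1 \<partial>release vs (R H))"
        by (intro nn_integral_mono measure_pmf.emeasure_le_1)
      then show ?thesis by (simp add: 0)
    next
      case (Suc i)
      have "(\<integral>\<^sup>+A. emeasure (exit_pmf A v) {a. H + 1 + J + int j \<le> snd a} \<partial>release vs (R H))
          \<le> (\<integral>\<^sup>+A. ennreal (2 / real N) * ennreal (c i A) \<partial>release vs (R H))"
      proof (rule nn_integral_mono_AE, unfold AE_measure_pmf_iff, rule ballI)
        fix A assume A: "A \<in> set_pmf (release vs (R H))"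
        let ?y = "H + 1 + J + int i"
        have sub: "A \<inter> level N ?y \<subseteq> {a \<in> A. ?y \<le> snd a}" by (auto simp: level_def)
        have "measure_pmf.prob (exit_pmf A v) {a. ?y + 1 \<le> snd a} \<le> 2 / real N * real (card (A \<inter> level N ?y))"
          by (rule exit_above_le[OF supp(1)[OF A] finite_subset[OF sub supp(2)[OF A]] v(1) _ J]) (use v in auto)
        also have "\<dots> \<le> 2 / real N * c i A"
          unfolding c_def using card_mono[OF supp(2)[OF A] sub] by (intro mult_left_mono) auto
        finally have "ennreal (measure_pmf.prob (exit_pmf A v) {a. ?y + 1 \<le> snd a}) \<le> ennreal (2 / real N * c i A)"
          by (rule ennreal_leI)
        moreover have "ennreal (2 / real N * c i A) = ennreal (2 / real N) * ennreal (c i A)"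
          by (rule ennreal_mult) (simp_all add: c_def)
        moreover have "?y + 1 = H + 1 + J + int j" by (simp add: Suc)
        ultimately show "emeasure (exit_pmf A v) {a. H + 1 + J + int j \<le> snd a} \<le> ennreal (2 / real N) * ennreal (c i A)"
          unfolding measure_pmf.emeasure_eq_measure by (simp only:)
      qed
      also have "\<dots> = ennreal (2 / real N) * (\<integral>\<^sup>+A. ennreal (c i A) \<partial>release vs (R H))"
        by (rule nn_integral_cmult) auto
      also have "\<dots> \<le> ennreal (2 / real N) * ennreal ((2 / real N) ^ i * real (length vs choose (i + 1)))"
        unfolding c_def by (intro mult_left_mono snoc.IH[OF vs]) auto
      also have "\<dots> = ennreal ((2 / real N) ^ j * real (length vs choose j))"
        by (subst ennreal_mult[symmetric]) (simp_all add: Suc)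
      finally show ?thesis .
    qed
  qed
  also have "\<dots> = ennreal ((2 / real N) ^ j * real (length (vs @ [v]) choose (j + 1)))"
    by (subst ennreal_plus[symmetric]) (simp_all add: algebra_simps)
  finally show ?case by (simp add: c_def)
qed

text \<open>First moment method: leaving the bounded region forces at least one site into the count
  of \<open>expected_above_le\<close>.\<close>

lemma release_height:
  assumes vs: "set vs \<subseteq> R (H + 1)" and J: "0 \<le> J" "real N * exp (- real_of_int J / real N) \<le> 1"
    and j: "16 * real (length vs) \<le> real N * real j"
  shows "measure_pmf.prob (release vs (R H)) {A. \<not> A \<subseteq> R (H + J + int j)} \<le> real (length vs) * exp (- real j)"
proof -
  have vc: "set vs \<subseteq> sites" using vs R_sites by blast
  have "emeasure (release vs (R H)) {A. \<not> A \<subseteq> R (H + J + int j)} =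
      (\<integral>\<^sup>+A. indicator {A. \<not> A \<subseteq> R (H + J + int j)} A \<partial>release vs (R H))" by simp
  also have "\<dots> \<le> (\<integral>\<^sup>+A. ennreal (real (card {a \<in> A. H + 1 + J + int j \<le> snd a})) \<partial>release vs (R H))"
  proof (rule nn_integral_mono_AE, unfold AE_measure_pmf_iff, rule ballI)
    fix A assume A: "A \<in> set_pmf (release vs (R H))"
    show "indicator {A. \<not> A \<subseteq> R (H + J + int j)} A \<le> ennreal (real (card {a \<in> A. H + 1 + J + int j \<le> snd a}))"
    proof (cases "A \<subseteq> R (H + J + int j)")
      case False
      then obtain a where a: "a \<in> A" "a \<notin> R (H + J + int j)" by blast
      have "A - R H \<subseteq> sites" "finite (A - R H)" using release_supp[OF bounded_above_R vc A] by auto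
      moreover have "R H \<subseteq> sites" by (rule R_sites)
      ultimately have "a \<in> sites" using a by blast
      then have "a \<in> {a \<in> A. H + 1 + J + int j \<le> snd a}" using a by (auto simp: mem_R)
      moreover have "{a \<in> A. H + 1 + J + int j \<le> snd a} \<subseteq> A - R H" using J by (auto simp: mem_R)
      then have "finite {a \<in> A. H + 1 + J + int j \<le> snd a}"
        using \<open>finite (A - R H)\<close> by (rule finite_subset)
      ultimately have "0 < card {a \<in> A. H + 1 + J + int j \<le> snd a}" unfolding card_gt_0_iff by blast
      then have "1 \<le> real (card {a \<in> A. H + 1 + J + int j \<le> snd a})" by simp
      then have "ennreal 1 \<le> ennreal (real (card {a \<in> A. H + 1 + J + int j \<le> snd a}))" by (rule ennreal_leI)
      then show ?thesis using False by simp
    qed simp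
  qed
  also have "\<dots> \<le> ennreal ((2 / real N) ^ j * real (length vs choose (j + 1)))"
    by (rule expected_above_le[OF vs J])
  also have "\<dots> \<le> ennreal (real (length vs) * exp (- real j))"
    using binomial_power_bound[OF _ j] N3 by (intro ennreal_leI) auto
  finally show ?thesis by (simp add: measure_pmf.emeasure_eq_measure)
qed

text \<open>Once \<open>R H\<close> is full, exactly n - N H particles are frozen, and the
  hypothesis on j makes these few enough for \<open>release_height\<close>: the first J levels above
  are spent on mixing, the next j on the geometric decay.\<close>

lemma grow_shape:
  assumes H0: "0 \<le> H" and \<delta>: "0 \<le> \<delta>" "\<delta> \<le> 1"
    and H: "real_of_int H \<le> (1 - \<delta>) * (real n / real N)"
    and J: "0 \<le> J" "real N * exp (- real_of_int J / real N) \<le> 1"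
    and j: "16 * (real n - real N * real_of_int H) \<le> real N * real j"
  shows "measure_pmf.prob (grow n (R 0)) {A. \<not> (R H \<subseteq> A \<and> A \<subseteq> R (H + J + int j))} \<le>
    real N * real_of_int H * exp (- (\<delta>\<^sup>2 / 2) * (real n / real N)) + real n * exp (- real j)"
proof -
  define bad where "bad = {A. \<not> (R H \<subseteq> A \<and> A \<subseteq> R (H + J + int j))}"
  define Y where "Y = {s :: site set \<times> site list. \<not> R H \<subseteq> fst s}"
  have intY: "integrable (measure_pmf (frozen H n)) (\<lambda>s. indicator Y s :: real)"
    by (rule integrable_bounded_pmf[of _ 1]) (simp add: indicator_def)
  have "measure_pmf.prob (grow n (R 0)) bad =
      measure_pmf.expectation (frozen H n) (\<lambda>s. measure_pmf.prob (release (snd s) (fst s)) bad)"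
    by (simp add: grow_eq_frozen[OF H0] measure_bind_pmf)
  also have "\<dots> \<le> measure_pmf.expectation (frozen H n) (\<lambda>s. indicator Y s + real n * exp (- real j))"
  proof (rule integral_mono_AE)
    show "integrable (frozen H n) (\<lambda>s. measure_pmf.prob (release (snd s) (fst s)) bad)"
      by (rule integrable_bounded_pmf[of _ 1]) simp
    show "integrable (frozen H n) (\<lambda>s. indicator Y s + real n * exp (- real j))" using intY by simp
    show "AE s in frozen H n. measure_pmf.prob (release (snd s) (fst s)) bad \<le> indicator Y s + real n * exp (- real j)"
      unfolding AE_measure_pmf_iff
    proof
      fix s assume s: "s \<in> set_pmf (frozen H n)"
      note s' = set_frozen[OF s H0]
      show "measure_pmf.prob (release (snd s) (fst s)) bad \<le> indicator Y s + real n * exp (- real j)"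
      proof (cases "s \<in> Y")
        case True
        have "measure_pmf.prob (release (snd s) (fst s)) bad \<le> 1" by simp
        also have "\<dots> \<le> indicator Y s + real n * exp (- real j)" using True by simp
        finally show ?thesis .
      next
        case False
        then have fs: "fst s = R H" using s' by (auto simp: Y_def)
        have "card (R H - R 0) = N * nat H" by (simp add: R_diff_eq card_cartesian_product)
        then have len: "length (snd s) + N * nat H = n" using s'(5) fs by simp
        then have "real (length (snd s)) + real N * real (nat H) = real n" by (metis of_nat_add of_nat_mult)
        then have j': "16 * real (length (snd s)) \<le> real N * real j" using j H0 by simp
        have "measure_pmf.prob (release (snd s) (R H)) bad \<le>
            measure_pmf.prob (release (snd s) (R H)) {A. \<not> A \<subseteq> R (H + J + int j)}"
        proof (rule measure_pmf.finite_measure_mono_AE)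
          have "set (snd s) \<subseteq> sites" using s'(3) R_sites by blast
          then show "AE A in release (snd s) (R H). A \<in> bad \<longrightarrow> A \<in> {A. \<not> A \<subseteq> R (H + J + int j)}"
            using set_release[of "R H" "snd s"] by (auto simp: AE_measure_pmf_iff bad_def)
        qed simp
        also have "\<dots> \<le> real (length (snd s)) * exp (- real j)"
          by (rule release_height[OF s'(3) J j'])
        also have "\<dots> \<le> real n * exp (- real j)" using len by (intro mult_right_mono) auto
        finally show ?thesis using False by (simp add: fs)
      qed
    qed
  qed
  also have "\<dots> = measure_pmf.prob (frozen H n) Y + real n * exp (- real j)"
    using intY by simp
  also have "measure_pmf.prob (frozen H n) Y \<le> real N * real_of_int H * exp (- (\<delta>\<^sup>2 / 2) * (real n / real N))"
    unfolding Y_def by (rule frozen_not_full[OF H0 \<delta> H])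
  finally show ?thesis by (simp add: bad_def)
qed

lemma grow_not_full:
  assumes H0: "0 \<le> H" and \<delta>: "0 \<le> \<delta>" "\<delta> \<le> 1"
    and H: "real_of_int H \<le> (1 - \<delta>) * (real n / real N)"
  shows "measure_pmf.prob (grow n (R 0)) {A. \<not> R H \<subseteq> A} \<le>
    real N * real_of_int H * exp (- (\<delta>\<^sup>2 / 2) * (real n / real N))"
proof -
  define Y where "Y = {s :: site set \<times> site list. \<not> R H \<subseteq> fst s}"
  have intY: "integrable (measure_pmf (frozen H n)) (\<lambda>s. indicator Y s :: real)"
    by (rule integrable_bounded_pmf[of _ 1]) (simp add: indicator_def)
  have "measure_pmf.prob (grow n (R 0)) {A. \<not> R H \<subseteq> A} =
      measure_pmf.expectation (frozen H n) (\<lambda>s. measure_pmf.prob (release (snd s) (fst s)) {A. \<not> R H \<subseteq> A})"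
    by (simp add: grow_eq_frozen[OF H0] measure_bind_pmf)
  also have "\<dots> \<le> measure_pmf.expectation (frozen H n) (\<lambda>s. indicator Y s)"
  proof (rule integral_mono_AE[OF _ intY])
    show "integrable (frozen H n) (\<lambda>s. measure_pmf.prob (release (snd s) (fst s)) {A. \<not> R H \<subseteq> A})"
      by (rule integrable_bounded_pmf[of _ 1]) simp
    show "AE s in frozen H n. measure_pmf.prob (release (snd s) (fst s)) {A. \<not> R H \<subseteq> A} \<le> indicator Y s"
      unfolding AE_measure_pmf_iff
    proof
      fix s assume s: "s \<in> set_pmf (frozen H n)"
      note s' = set_frozen[OF s H0]
      show "measure_pmf.prob (release (snd s) (fst s)) {A. \<not> R H \<subseteq> A} \<le> indicator Y s"
      proof (cases "s \<in> Y")
        case False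
        have "set (snd s) \<subseteq> sites" using s'(3) R_sites by blast
        then have "set_pmf (release (snd s) (fst s)) \<inter> {A. \<not> R H \<subseteq> A} = {}"
          using set_release[OF bounded_above_subset[OF s'(2) bounded_above_R], of "snd s"] False
          unfolding Y_def by blast
        then have "measure_pmf.prob (release (snd s) (fst s)) {A. \<not> R H \<subseteq> A} = 0"
          by (simp add: measure_pmf_zero_iff)
        then show ?thesis by simp
      qed simp
    qed
  qed
  also have "\<dots> \<le> real N * real_of_int H * exp (- (\<delta>\<^sup>2 / 2) * (real n / real N))"
    using frozen_not_full[OF H0 \<delta> H] by (simp add: Y_def)
  finally show ?thesis .
qed

section \<open>Comparison with the flat-started cluster\<close>

lemma grow_add: "grow (m + n) A = bind_pmf (grow m A) (grow n)"
proof (induction m arbitrary: A)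
  case (Suc m)
  have "grow (Suc m + n) A = bind_pmf (settle_unif A) (grow (m + n))" by simp
  also have "\<dots> = bind_pmf (settle_unif A) (\<lambda>B. bind_pmf (grow m B) (grow n))"
    by (intro bind_pmf_cong refl Suc.IH)
  finally show ?case by (simp add: bind_assoc_pmf)
qed (simp add: bind_return_pmf)

lemma configs_split:
  assumes "A \<in> configs N"
  shows "finite {(x, y) \<in> A. y > 0}" "A = {(x, y) \<in> A. y > 0} \<union> R 0" "{(x, y) \<in> A. y > 0} \<inter> R 0 = {}" "A \<subseteq> sites"
    "bounded_above A"
proof -
  obtain F where F: "finite F" "F \<subseteq> sites" "A = R 0 \<union> F" using assms by (auto simp: configs_def)
  show "finite {(x, y) \<in> A. y > 0}" by (rule finite_subset[OF _ F(1)]) (auto simp: F(3) mem_R)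
  show "A \<subseteq> sites" using F R_sites by auto
  show "A = {(x, y) \<in> A. y > 0} \<union> R 0" using F by (auto simp: mem_R)
  show "{(x, y) \<in> A. y > 0} \<inter> R 0 = {}" by (auto simp: mem_R)
  have "\<forall>v\<in>A. snd v \<le> Max (insert 0 (snd ` F))"
  proof
    fix v assume "v \<in> A"
    then show "snd v \<le> Max (insert 0 (snd ` F))"
      using F(1) by (auto simp: F(3) mem_R Max_ge_iff)
  qed
  then show "bounded_above A" unfolding bounded_above_def by blast
qed

lemma config_size_le:
  assumes "A \<in> configs N" "A \<subseteq> R (int M)"
  shows "config_size A \<le> N * M"
proof -
  have "{(x, y) \<in> A. y > 0} \<subseteq> {0..<int N} \<times> {1..int M}" using assms(2) by (auto simp: filled_def cylinder_def)
  then have "card {(x, y) \<in> A. y > 0} \<le> card ({0..<int N} \<times> {1..int M})" by (intro card_mono) auto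
  then show ?thesis by (simp add: config_size_def card_cartesian_product)
qed

text \<open>The sites of \<open>A\<close> above level 0 become particles released after the flat
  cluster has grown for time t. If that cluster contains \<open>R H\<close>, they have at least H +
  1 - L levels in which to mix; otherwise the difference is bounded by 1.\<close>

lemma grow_near_flat:
  assumes A: "A \<in> configs N" "A \<subseteq> R L" and H: "-1 \<le> H" "L \<le> H + 1"
  shows "\<bar>measure_pmf.prob (grow t A) S - measure_pmf.prob (grow (t + config_size A) (R 0)) S\<bar>
    \<le> measure_pmf.prob (grow t (R 0)) {B. \<not> R H \<subseteq> B}
      + real (config_size A) * (real N * exp (- real_of_int (H + 1 - L) / real N))"
proof -
  define F where "F = {(x, y) \<in> A. y > 0}"
  define e where "e = real (config_size A) * (real N * exp (- real_of_int (H + 1 - L) / real N))"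
  note A' = configs_split[OF A(1), folded F_def]
  obtain vs where vs: "set vs = F" "distinct vs" using finite_distinct_list[OF A'(1)] by blast
  have len: "length vs = config_size A" using vs by (simp add: config_size_def F_def distinct_card[symmetric])
  have vsL: "set vs \<subseteq> R L" using A(2) A'(2) vs by auto
  then have vc: "set vs \<subseteq> sites" using R_sites by blast
  have "release vs (R 0) = return_pmf A" using vs A'(2,3) by (simp add: release_disjoint)
  then have "grow t A = bind_pmf (release vs (R 0)) (grow t)" by (simp add: bind_return_pmf)
  also have "\<dots> = bind_pmf (grow t (R 0)) (release vs)" by (rule release_grow_commute) (use vc in auto)
  finally have 1: "grow t A = bind_pmf (grow t (R 0)) (release vs)" .
  have 2: "grow (t + config_size A) (R 0) = bind_pmf (grow t (R 0)) (grow (length vs))"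
    by (simp add: grow_add len)
  define Y where "Y = {B. \<not> R H \<subseteq> B}"
  have e0: "0 \<le> e" by (simp add: e_def)
  have int: "integrable (measure_pmf p) (\<lambda>B. measure_pmf.prob (k B) S)" for p and k :: "site set \<Rightarrow> site set pmf"
    by (rule integrable_bounded_pmf[of _ 1]) simp
  have intY: "integrable (measure_pmf p) (\<lambda>B. indicator Y B :: real)" for p
    by (rule integrable_bounded_pmf[of _ 1]) (simp add: indicator_def)
  have "\<bar>measure_pmf.prob (grow t A) S - measure_pmf.prob (grow (t + config_size A) (R 0)) S\<bar> =
      \<bar>measure_pmf.expectation (grow t (R 0)) (\<lambda>B. measure_pmf.prob (release vs B) S - measure_pmf.prob (grow (length vs) B) S)\<bar>"
    unfolding 1 2 using int by (simp add: measure_bind_pmf)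
  also have "\<dots> \<le> measure_pmf.expectation (grow t (R 0)) (\<lambda>B. \<bar>measure_pmf.prob (release vs B) S - measure_pmf.prob (grow (length vs) B) S\<bar>)"
    by (rule integral_abs_bound)
  also have "\<dots> \<le> measure_pmf.expectation (grow t (R 0)) (\<lambda>B. indicator Y B + e)"
  proof (rule integral_mono_AE)
    show "integrable (grow t (R 0)) (\<lambda>B. \<bar>measure_pmf.prob (release vs B) S - measure_pmf.prob (grow (length vs) B) S\<bar>)"
      using int by (intro integrable_abs Bochner_Integration.integrable_diff)
    show "AE B in grow t (R 0). \<bar>measure_pmf.prob (release vs B) S - measure_pmf.prob (grow (length vs) B) S\<bar> \<le> indicator Y B + e"
      unfolding AE_measure_pmf_iff
    proof
      fix B assume B: "B \<in> set_pmf (grow t (R 0))"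
      show "\<bar>measure_pmf.prob (release vs B) S - measure_pmf.prob (grow (length vs) B) S\<bar> \<le> indicator Y B + e"
      proof (cases "B \<in> Y")
        case True
        have "0 \<le> measure_pmf.prob (release vs B) S" "measure_pmf.prob (release vs B) S \<le> 1"
          "0 \<le> measure_pmf.prob (grow (length vs) B) S" "measure_pmf.prob (grow (length vs) B) S \<le> 1" by simp_all
        then have "\<bar>measure_pmf.prob (release vs B) S - measure_pmf.prob (grow (length vs) B) S\<bar> \<le> 1"
          by linarith
        then show ?thesis using True e0 by simp
      next
        case False
        then have "R H \<subseteq> B" by (simp add: Y_def)
        moreover have "bounded_above B" using set_grow[OF _ B] by simp
        ultimately have "\<bar>measure_pmf.prob (release vs B) S - measure_pmf.prob (grow (length vs) B) S\<bar> \<le> e"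
          using release_near_grow[OF _ _ H(1) vsL H(2)] by (simp add: e_def len)
        then show ?thesis using False by simp
      qed
    qed
  qed (use intY in simp)
  also have "\<dots> = measure_pmf.prob (grow t (R 0)) Y + e" using intY by simp
  finally show ?thesis by (simp add: Y_def e_def)
qed

end

section \<open>Shifts and the sample space of IDLA\<close>

text \<open>The type \<open>site set\<close> is uncountable and only the carrier of a law on
  configurations is countable. The law is therefore pushed to the whole type, where it is still
  purely atomic.\<close>

lemma measure_pmf_of_countable:
  assumes "prob_space M" "sets M = Pow C" "countable C"
  obtains p where "measure_pmf p = distr M (count_space UNIV) (\<lambda>x. x)"
proof -
  interpret prob_space M by fact
  have sp: "space M = C" using assms(2) by (metis Pow_top Union_Pow_eq sets.sets_into_space space_in_borel sets_eq_imp_space_eq space_count_space sets_count_space)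
  have m: "(\<lambda>x. x) \<in> M \<rightarrow>\<^sub>M count_space UNIV" by (auto simp: measurable_def assms(2) sp)
  define M' where "M' = distr M (count_space UNIV) (\<lambda>x. x)"
  interpret M': prob_space M' unfolding M'_def by (rule prob_space_distr[OF m])
  have M'1: "measure M' {x} = measure M ({x} \<inter> C)" for x
    unfolding M'_def using m by (simp add: measure_distr sp vimage_def Int_def)
  have "(\<Union>x\<in>{x \<in> C. measure M {x} = 0}. {x}) \<in> null_sets M"
    using assms(3)
    by (intro null_sets_UN') (auto simp: null_sets_def assms(2) emeasure_eq_measure intro: countable_subset[of _ C])
  then have "AE x in M. measure M {x} \<noteq> 0"
    by (rule AE_I') (auto simp: sp)
  then have "AE x in M. measure M' {x} \<noteq> 0"
    unfolding M'1 using AE_space by eventually_elim (auto simp: sp)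
  then have "AE x in distr M (count_space UNIV) (\<lambda>x. x). measure M' {x} \<noteq> 0"
    by (subst AE_distr_iff[OF m]) auto
  then have "AE x in M'. measure M' {x} \<noteq> 0" by (simp only: M'_def)
  moreover have "sets M' = UNIV" by (simp add: M'_def)
  ultimately have "M' \<in> {M. prob_space M \<and> sets M = UNIV \<and> (AE x in M. measure M {x} \<noteq> 0)}"
    using M'.prob_space_axioms by blast
  then have "measure_pmf (Abs_pmf M') = M'" by (rule Abs_pmf_inverse)
  then show thesis using that unfolding M'_def by blast
qed

context cyl
begin

section \<open>Translation invariance and the shifted chain\<close>

definition lower :: "int \<Rightarrow> site \<Rightarrow> site" where
  "lower k = (\<lambda>(x, y). (x, y - k))"

lemma inj_lower [simp]: "inj (lower k)"
  by (auto simp: lower_def inj_def)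

lemma lower_image_iff [simp]: "lower k v \<in> lower k ` A \<longleftrightarrow> v \<in> A"
  by (simp add: inj_image_mem_iff)

lemma move_lower: "move N (lower k v) d = lower k (move N v d)"
  by (cases v; cases d) (simp add: lower_def)

lemma lower_sites [simp]: "lower k v \<in> sites \<longleftrightarrow> v \<in> sites"
  by (cases v) (simp add: lower_def mem_sites)

lemma bounded_above_lower: "bounded_above A \<Longrightarrow> bounded_above (lower k ` A)"
proof -
  assume "bounded_above A"
  then obtain M where "\<And>v. v \<in> A \<Longrightarrow> snd v \<le> M" unfolding bounded_above_def by blast
  then have "\<forall>v\<in>lower k ` A. snd v \<le> M - k" by (auto simp: lower_def)
  then show ?thesis unfolding bounded_above_def by blast
qed

text \<open>The translated walk solves the Dirichlet problem of \<open>A\<close>, so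
  \<open>exit_pmf_kernel\<close> reduces the claim to sites off \<open>A\<close>.\<close>

lemma exit_pmf_lower:
  assumes A: "bounded_above A" and v: "v \<in> sites"
  shows "exit_pmf (lower k ` A) (lower k v) = map_pmf (lower k) (exit_pmf A v)"
proof -
  have "exit_pmf (lower k ` A) (lower k v) = bind_pmf (exit_pmf A v) (\<lambda>v. exit_pmf (lower k ` A) (lower k v))"
  proof (rule exit_pmf_kernel[OF A _ v, symmetric])
    fix w assume "w \<in> A" "w \<in> sites"
    then show "exit_pmf (lower k ` A) (lower k w) = bind_pmf steps (\<lambda>d. exit_pmf (lower k ` A) (lower k (move N w d)))"
      by (subst exit_pmf_step[OF bounded_above_lower[OF A]]) (simp_all add: move_lower)
  qed
  also have "\<dots> = bind_pmf (exit_pmf A v) (\<lambda>a. return_pmf (lower k a))"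
    by (rule bind_pmf_cong[OF refl], rule exit_pmf_outside, unfold lower_image_iff) (rule exit_pmf_not_in[OF A v])
  finally show ?thesis by (simp add: map_pmf_def)
qed

lemma settle_lower:
  assumes "bounded_above A" "v \<in> sites"
  shows "settle (lower k v) (lower k ` A) = map_pmf (image (lower k)) (settle v A)"
  unfolding settle_def exit_pmf_lower[OF assms] by (simp add: map_pmf_comp)

text \<open>Translating also moves the starting level. This is harmless because a uniform walk from
  level 0 arrives uniformly on level k before it can settle.\<close>

lemma settle_unif_lower:
  assumes A: "bounded_above A" "R k \<subseteq> A" and k: "0 \<le> k"
  shows "settle_unif (lower k ` A) = map_pmf (image (lower k)) (settle_unif A)"
proof -
  have "level N 0 = lower k ` level N k"
    by (force simp: level_def cylinder_def lower_def image_def)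
  then have "pmf_of_set (level N 0) = map_pmf (lower k) (pmf_of_set (level N k))"
    by (simp add: map_pmf_of_set_inj inj_on_subset[OF inj_lower])
  then have "settle_unif (lower k ` A) = bind_pmf (pmf_of_set (level N k)) (\<lambda>u. settle (lower k u) (lower k ` A))"
    by (simp add: settle_unif_def bind_map_pmf)
  also have "\<dots> = bind_pmf (pmf_of_set (level N k)) (\<lambda>u. map_pmf (image (lower k)) (settle u A))"
    by (rule bind_pmf_cong[OF refl], rule settle_lower) (use A level_sites in auto)
  \<comment> \<open>The level is written as k - 1 + 1 to use \<open>settle_unif_via_R\<close> at
    height k - 1, which is -1 when k = 0.\<close>
  also have "\<dots> = map_pmf (image (lower k)) (bind_pmf (pmf_of_set (level N (k - 1 + 1))) (\<lambda>u. settle u A))"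
    by (simp add: map_bind_pmf)
  also have "bind_pmf (pmf_of_set (level N (k - 1 + 1))) (\<lambda>u. settle u A) = settle_unif A"
    by (rule settle_unif_via_R[symmetric]) (use A k in \<open>auto simp: mem_R\<close>)
  finally show ?thesis .
qed

lemma grow_lower:
  assumes "bounded_above A" "R k \<subseteq> A" "0 \<le> k"
  shows "grow n (lower k ` A) = map_pmf (image (lower k)) (grow n A)"
  using assms
proof (induction n arbitrary: A)
  case (Suc n)
  have "grow (Suc n) (lower k ` A) = bind_pmf (settle_unif A) (\<lambda>B. grow n (lower k ` B))"
    by (simp add: settle_unif_lower[OF Suc.prems] bind_map_pmf)
  also have "\<dots> = bind_pmf (settle_unif A) (\<lambda>B. map_pmf (image (lower k)) (grow n B))"
    by (rule bind_pmf_cong[OF refl], rule Suc.IH) (use Suc.prems settle_unif_mono[OF Suc.prems(1)] in auto)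
  finally show ?case by (simp add: map_bind_pmf)
qed simp

lemma settle_unif_configs:
  assumes "A \<in> configs N" "B \<in> set_pmf (settle_unif A)"
  shows "B \<in> configs N"
proof -
  obtain a where "a \<in> sites" "B = insert a A" using set_settle_unif[OF configs_split(5)[OF assms(1)] assms(2)] .
  then show ?thesis using insert_configs[OF assms(1)] by simp
qed

lemma grow_configs:
  assumes "A \<in> configs N" "B \<in> set_pmf (grow n A)"
  shows "B \<in> configs N"
  using assms by (induction n arbitrary: A) (auto dest: settle_unif_configs)

lemma full_height_ge:
  assumes "A \<in> configs N" "R (int k) \<subseteq> A"
  shows "k \<le> full_height N A"
  unfolding full_height_def using full_height(2)[OF _ assms(1)] N3 assms(2) by (intro Max_ge) auto

text \<open>Lowering by k reduces the full height by exactly k, so the total translation is the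
  same. The premise that \<open>R k\<close> is filled keeps the difference of natural numbers from
  being cut off at 0.\<close>

lemma shift_down_lower:
  assumes A: "A \<in> configs N" and k: "R (int k) \<subseteq> A"
  shows "shift_down N (lower (int k) ` A) = shift_down N A"
proof -
  have N0: "N > 0" using N3 by simp
  have iff: "R (int j) \<subseteq> lower (int k) ` A \<longleftrightarrow> R (int (j + k)) \<subseteq> A" for j
  proof -
    have "R (int j) = lower (int k) ` R (int (j + k))"
    proof
      show "R (int j) \<subseteq> lower (int k) ` R (int (j + k))"
      proof
        fix v assume "v \<in> R (int j)"
        then have "v = lower (int k) (fst v, snd v + int k)" "(fst v, snd v + int k) \<in> R (int (j + k))"
          by (auto simp: lower_def mem_R cylinder_def)
        then show "v \<in> lower (int k) ` R (int (j + k))" by blast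
      qed
    qed (auto simp: lower_def mem_R cylinder_def)
    then show ?thesis by (simp add: inj_image_subset_iff)
  qed
  have "full_height N (lower (int k) ` A) = full_height N A - k"
    unfolding full_height_def[of N "lower (int k) ` A"] iff
  proof (rule Max_eqI)
    show "finite {j. R (int (j + k)) \<subseteq> A}"
      by (rule finite_subset[OF _ finite_imageI[OF full_height(2)[OF N0 A], of "\<lambda>i. i - k"]])
        (auto intro!: rev_image_eqI[of "_ + k"])
    show "j \<le> full_height N A - k" if "j \<in> {j. R (int (j + k)) \<subseteq> A}" for j
      using full_height_ge[OF A, of "j + k"] that by simp
    show "full_height N A - k \<in> {j. R (int (j + k)) \<subseteq> A}"
      using full_height_ge[OF A k] full_height(1)[OF N0 A] by simp
  qed
  then have "int (full_height N (lower (int k) ` A)) = int (full_height N A) - int k"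
    using full_height_ge[OF A k] by simp
  then show ?thesis
    unfolding shift_down_def by (simp add: image_image lower_def case_prod_unfold)
qed

lemma shift_down_eq: "shift_down N A = lower (int (full_height N A)) ` A"
  by (simp add: shift_down_def lower_def)

text \<open>Intermediate shifts can thus be postponed: the shifted chain is the unshifted one with a
  single shift at the end.\<close>

lemma shift_down_grow:
  assumes A: "A \<in> configs N"
  shows "map_pmf (shift_down N) (grow n (shift_down N A)) = map_pmf (shift_down N) (grow n A)"
proof -
  define k where "k = full_height N A"
  have k: "R (int k) \<subseteq> A" unfolding k_def using full_height(1)[OF _ A] N3 by simp
  have "map_pmf (shift_down N) (grow n (shift_down N A)) =
      map_pmf (\<lambda>B. shift_down N (lower (int k) ` B)) (grow n A)"
    unfolding shift_down_eq[of A] k_def[symmetric]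
    by (subst grow_lower) (use A k configs_split(5) in \<open>auto simp: map_pmf_comp\<close>)
  also have "\<dots> = map_pmf (shift_down N) (grow n A)"
  proof (rule map_pmf_cong[OF refl])
    fix B assume B: "B \<in> set_pmf (grow n A)"
    show "shift_down N (lower (int k) ` B) = shift_down N B"
      by (rule shift_down_lower) (use grow_configs[OF A B] set_grow[OF configs_split(5)[OF A] B] k in auto)
  qed
  finally show ?thesis .
qed

section \<open>Passage from the sample space to \<open>grow\<close>\<close>

lemma walk_space_eq: "walk_space N = uniform_count_measure (level N 0) \<Otimes>\<^sub>M path_space"
  by (simp add: walk_space_def path_space_def)

lemma distr_exit_site: "distr (walk_space N) (count_space UNIV) (exit_site N A) = measure_pmf (exit_unif A)"
proof (rule measure_eqI)
  fix X assume "X \<in> sets (distr (walk_space N) (count_space UNIV) (exit_site N A))"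
  interpret S: prob_space path_space by (rule prob_space_path_space)
  have "emeasure (distr (walk_space N) (count_space UNIV) (exit_site N A)) X =
      emeasure (walk_space N) (exit_site N A -` X \<inter> space (walk_space N))"
    by (rule emeasure_distr[OF measurable_exit_site]) simp
  also have "\<dots> = (\<integral>\<^sup>+ v. emeasure path_space (Pair v -` (exit_site N A -` X \<inter> space (walk_space N))) \<partial>uniform_count_measure (level N 0))"
    unfolding walk_space_eq
    by (rule S.emeasure_pair_measure_alt)
       (use measurable_sets[OF measurable_exit_site, of X N A] in \<open>simp add: walk_space_eq\<close>)
  also have "\<dots> = (\<integral>\<^sup>+ v. emeasure (exit_pmf A v) X \<partial>uniform_count_measure (level N 0))"
  proof (rule nn_integral_cong)
    fix v assume "v \<in> space (uniform_count_measure (level N 0))"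
    then have "Pair v -` (exit_site N A -` X \<inter> space (walk_space N)) = {s. exit_site N A (v, s) \<in> X}"
      by (auto simp: walk_space_eq space_pair_measure)
    then show "emeasure path_space (Pair v -` (exit_site N A -` X \<inter> space (walk_space N))) = emeasure (exit_pmf A v) X"
      by (simp add: emeasure_exit_pmf)
  qed
  also have "\<dots> = (\<Sum>v\<in>level N 0. emeasure (exit_pmf A v) X * ennreal (1 / real N))"
    unfolding uniform_count_measure_def by (subst nn_integral_point_measure_finite) (auto simp: mult.commute)
  also have "\<dots> = (\<Sum>v\<in>level N 0. emeasure (exit_pmf A v) X) / ennreal (real N)"
    using N3 by (simp add: divide_ennreal_def sum_distrib_right inverse_ennreal divide_inverse)
  also have "\<dots> = emeasure (exit_unif A) X"
    unfolding exit_unif_def emeasure_bind_pmf by (subst nn_integral_pmf_of_set) (auto simp: ennreal_of_nat_eq_real_of_nat)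
  finally show "emeasure (distr (walk_space N) (count_space UNIV) (exit_site N A)) X = emeasure (exit_unif A) X" .
qed simp

lemma idla_case_nat: "idla N A (case_nat w \<omega>) (Suc t) = idla N (A \<union> {exit_site N A w}) \<omega> t"
  by (induction t) auto

text \<open>After the first driving walk is split off, the rest of the sample drives an IDLA process
  started from \<open>A\<close> with one exit site added.\<close>

lemma emeasure_idla:
  assumes "A \<in> configs N"
  shows "emeasure (idla_space N) {\<omega> \<in> space (idla_space N). idla N A \<omega> t \<in> S} = emeasure (grow t A) S"
  using assms
proof (induction t arbitrary: A)
  case 0
  interpret prob_space "idla_space N" using N3 by (intro prob_space_idla_space) simp
  show ?case by (cases "A \<in> S") (simp_all add: emeasure_space_1)
next
  case (Suc t)
  have N0: "N > 0" using N3 by simp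
  interpret W: prob_space "walk_space N" by (rule prob_space_walk_space[OF N0])
  interpret Q: sequence_space "walk_space N" by unfold_locales
  let ?X = "{\<omega> \<in> space (idla_space N). idla N A \<omega> (Suc t) \<in> S}"
  have "?X = (\<lambda>\<omega>. idla N A \<omega> (Suc t)) -` (S \<inter> configs N) \<inter> space (idla_space N)"
    using measurable_space[OF measurable_idla[OF N0 Suc.prems, of "Suc t"]] by auto
  also have "\<dots> \<in> sets (idla_space N)"
    by (rule measurable_sets[OF measurable_idla[OF N0 Suc.prems]]) auto
  finally have X: "?X \<in> sets Q.S" by (simp add: idla_space_def)
  have "emeasure (idla_space N) ?X =
      (\<integral>\<^sup>+ w. emeasure (idla_space N) {\<omega> \<in> space (idla_space N). case_nat w \<omega> \<in> ?X} \<partial>walk_space N)"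
    using Q.emeasure_case_nat[OF X] by (simp add: idla_space_def)
  also have "\<dots> = (\<integral>\<^sup>+ w. emeasure (grow t (insert (exit_site N A w) A)) S \<partial>walk_space N)"
  proof (rule nn_integral_cong)
    fix w assume w: "w \<in> space (walk_space N)"
    have "{\<omega> \<in> space (idla_space N). case_nat w \<omega> \<in> ?X} =
        {\<omega> \<in> space (idla_space N). idla N (A \<union> {exit_site N A w}) \<omega> t \<in> S}"
      using w by (auto simp: idla_case_nat idla_space_def space_PiM PiE_iff split: nat.split simp del: idla.simps(2))
    moreover have "A \<union> {exit_site N A w} \<in> configs N"
      by (rule insert_configs[OF Suc.prems exit_site_in_cylinder[OF N0 w]])
    ultimately show "emeasure (idla_space N) {\<omega> \<in> space (idla_space N). case_nat w \<omega> \<in> ?X} =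
        emeasure (grow t (insert (exit_site N A w) A)) S"
      using Suc.IH by simp
  qed
  also have "\<dots> = (\<integral>\<^sup>+ a. emeasure (grow t (insert a A)) S \<partial>distr (walk_space N) (count_space UNIV) (exit_site N A))"
    by (rule nn_integral_distr[symmetric]) (auto intro: measurable_exit_site)
  also have "\<dots> = emeasure (grow (Suc t) A) S"
    unfolding distr_exit_site by (simp add: settle_unif_eq)
  finally show ?case .
qed

lemma measure_idla_law:
  assumes A: "A \<in> configs N" and S: "S \<subseteq> configs N"
  shows "measure (idla_law N A t) S = measure_pmf.prob (grow (nat \<lfloor>t\<rfloor>) A) S"
proof -
  have N0: "N > 0" using N3 by simp
  have "emeasure (idla_law N A t) S =
      emeasure (idla_space N) {\<omega> \<in> space (idla_space N). idla N A \<omega> (nat \<lfloor>t\<rfloor>) \<in> S}"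
    unfolding idla_law_def
    by (subst emeasure_distr[OF measurable_idla[OF N0 A]]) (use S in \<open>auto intro!: arg_cong2[of _ _ _ _ emeasure]\<close>)
  then show ?thesis by (simp add: emeasure_idla[OF A] measure_def)
qed

section \<open>Starting laws and stationarity as pmfs\<close>

lemma config_distribution_pmf:
  assumes "config_distribution N \<nu>"
  obtains p where "measure_pmf p = distr \<nu> (count_space UNIV) (\<lambda>A. A)"
    "(\<lambda>A. A) \<in> \<nu> \<rightarrow>\<^sub>M count_space UNIV" "space \<nu> = configs N" "set_pmf p \<subseteq> configs N"
    "\<And>S. S \<subseteq> configs N \<Longrightarrow> emeasure \<nu> S = emeasure p S"
proof -
  have \<nu>: "prob_space \<nu>" "sets \<nu> = Pow (configs N)"
    using assms by (auto simp: config_distribution_def)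
  have sp: "space \<nu> = configs N" using \<nu>(2) by (metis sets_eq_imp_space_eq sets_count_space space_count_space)
  have m: "(\<lambda>x. x) \<in> \<nu> \<rightarrow>\<^sub>M count_space UNIV" by (auto simp: measurable_def \<nu>(2) sp)
  obtain p where p: "measure_pmf p = distr \<nu> (count_space UNIV) (\<lambda>x. x)"
    by (rule measure_pmf_of_countable[OF \<nu> countable_configs])
  have pS: "emeasure p S = emeasure \<nu> (S \<inter> configs N)" for S
    unfolding p by (subst emeasure_distr[OF m]) (auto simp: sp)
  have "set_pmf p \<subseteq> configs N"
  proof
    fix A assume "A \<in> set_pmf p"
    then have "emeasure p {A} \<noteq> 0" by (simp add: emeasure_pmf_single set_pmf_iff)
    then show "A \<in> configs N" unfolding pS by (cases "A \<in> configs N") auto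
  qed
  moreover have "emeasure \<nu> S = emeasure p S" if "S \<subseteq> configs N" for S
    using that by (simp add: pS Int_absorb2)
  ultimately show thesis using that p m sp by blast
qed

lemma stationary_pmf:
  assumes "stationary_shifted_idla N \<mu>"
  obtains p where "set_pmf p \<subseteq> configs N" "\<And>S. S \<subseteq> configs N \<Longrightarrow> measure \<mu> S = measure_pmf.prob p S"
    "bind_pmf p (\<lambda>A. map_pmf (shift_down N) (settle_unif A)) = p"
proof -
  have N0: "N > 0" using N3 by simp
  have \<mu>: "config_distribution N \<mu>" "sets \<mu> = Pow (configs N)"
    and st: "distr (\<mu> \<Otimes>\<^sub>M idla_space N) (count_space (configs N)) (\<lambda>(A, \<omega>). shift_down N (idla N A \<omega> 1)) = \<mu>"
    using assms by (auto simp: stationary_shifted_idla_def config_distribution_def)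
  interpret I: prob_space "idla_space N" by (rule prob_space_idla_space[OF N0])
  obtain p where p: "measure_pmf p = distr \<mu> (count_space UNIV) (\<lambda>A. A)"
    and m: "(\<lambda>A. A) \<in> \<mu> \<rightarrow>\<^sub>M count_space UNIV" and sp: "space \<mu> = configs N" and supp: "set_pmf p \<subseteq> configs N"
    and pS: "\<And>S. S \<subseteq> configs N \<Longrightarrow> emeasure \<mu> S = emeasure p S"
    using config_distribution_pmf[OF \<mu>(1)] by blast
  have "bind_pmf p (\<lambda>A. map_pmf (shift_down N) (settle_unif A)) = p"
  proof (rule pmf_eqI)
    fix C
    define q where "q = bind_pmf p (\<lambda>A. map_pmf (shift_down N) (settle_unif A))"
    have sq: "set_pmf q \<subseteq> configs N"
      unfolding q_def using supp N0 by (auto intro!: shift_down_in_configs dest: settle_unif_configs)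
    have "emeasure q {C} = emeasure p {C}"
    proof (cases "C \<in> configs N")
      case False
      then have "C \<notin> set_pmf q" "C \<notin> set_pmf p" using sq supp by auto
      then show ?thesis by (simp add: emeasure_pmf_single set_pmf_iff)
    next
      case True
      let ?f = "\<lambda>(A, \<omega>). shift_down N (idla N A \<omega> 1)"
      have mf: "?f \<in> \<mu> \<Otimes>\<^sub>M idla_space N \<rightarrow>\<^sub>M count_space (configs N)"
        by (rule measurable_shifted_idla[OF N0 \<mu>(2)])
      have C: "{C} \<in> sets (count_space (configs N))" using True by simp
      have "emeasure p {C} = emeasure \<mu> {C}" using True by (simp add: pS)
      also have "\<dots> = emeasure (distr (\<mu> \<Otimes>\<^sub>M idla_space N) (count_space (configs N)) ?f) {C}"
        by (simp only: st)
      also have "\<dots> = emeasure (\<mu> \<Otimes>\<^sub>M idla_space N) (?f -` {C} \<inter> space (\<mu> \<Otimes>\<^sub>M idla_space N))"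
        by (rule emeasure_distr[OF mf C])
      also have "\<dots> = (\<integral>\<^sup>+ A. emeasure (idla_space N) (Pair A -` (?f -` {C} \<inter> space (\<mu> \<Otimes>\<^sub>M idla_space N))) \<partial>\<mu>)"
        by (rule I.emeasure_pair_measure_alt[OF measurable_sets[OF mf C]])
      also have "\<dots> = (\<integral>\<^sup>+ A. emeasure (settle_unif A) (shift_down N -` {C}) \<partial>\<mu>)"
      proof (rule nn_integral_cong)
        fix A assume A: "A \<in> space \<mu>"
        have "Pair A -` (?f -` {C} \<inter> space (\<mu> \<Otimes>\<^sub>M idla_space N)) =
            {\<omega> \<in> space (idla_space N). idla N A \<omega> (Suc 0) \<in> shift_down N -` {C}}"
          using A by (auto simp: space_pair_measure)
        then show "emeasure (idla_space N) (Pair A -` (?f -` {C} \<inter> space (\<mu> \<Otimes>\<^sub>M idla_space N))) =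
            emeasure (settle_unif A) (shift_down N -` {C})"
          using A emeasure_idla[of A "Suc 0" "shift_down N -` {C}"]
          by (simp add: sp grow_0_fun bind_return_pmf' del: idla.simps)
      qed
      also have "\<dots> = (\<integral>\<^sup>+ A. emeasure (settle_unif A) (shift_down N -` {C}) \<partial>p)"
        unfolding p by (rule nn_integral_distr[symmetric, OF m]) simp
      also have "\<dots> = emeasure q {C}" by (simp add: q_def)
      finally show ?thesis by simp
    qed
    then show "pmf (bind_pmf p (\<lambda>A. map_pmf (shift_down N) (settle_unif A))) C = pmf p C"
      by (simp add: emeasure_pmf_single q_def)
  qed
  moreover have "measure \<mu> S = measure_pmf.prob p S" if "S \<subseteq> configs N" for S
    using that by (simp add: measure_def pS)
  ultimately show thesis using that supp by blast
qed

text \<open>Stationarity iterated, with all shifts but the last removed by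
  \<open>shift_down_grow\<close>. The base case of one step is stationarity itself.\<close>

lemma stationary_grow:
  assumes supp: "set_pmf p \<subseteq> configs N"
    and st: "bind_pmf p (\<lambda>A. map_pmf (shift_down N) (settle_unif A)) = p"
  shows "map_pmf (shift_down N) (bind_pmf p (grow (Suc n))) = p"
proof (induction n)
  case 0
  show ?case by (simp add: grow_0_fun grow_Suc_fun bind_return_pmf' map_bind_pmf st)
next
  case (Suc n)
  have "map_pmf (shift_down N) (bind_pmf p (grow (Suc (Suc n)))) =
      bind_pmf p (\<lambda>A. bind_pmf (settle_unif A) (\<lambda>B. map_pmf (shift_down N) (grow (Suc n) B)))"
    unfolding grow_Suc_fun[of "Suc n"] by (simp only: map_bind_pmf)
  also have "\<dots> = bind_pmf p (\<lambda>A. bind_pmf (settle_unif A) (\<lambda>B. map_pmf (shift_down N) (grow (Suc n) (shift_down N B))))"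
    by (intro bind_pmf_cong refl shift_down_grow[symmetric]) (use supp settle_unif_configs in blast)
  also have "\<dots> = bind_pmf (bind_pmf p (\<lambda>A. map_pmf (shift_down N) (settle_unif A))) (\<lambda>B. map_pmf (shift_down N) (grow (Suc n) B))"
    by (simp only: bind_assoc_pmf bind_map_pmf)
  also have "\<dots> = map_pmf (shift_down N) (bind_pmf p (grow (Suc n)))"
    unfolding st by (simp only: map_bind_pmf)
  also have "\<dots> = p" by (rule Suc)
  finally show ?case .
qed

end

section \<open>Height of stationary configurations\<close>

text \<open>Half of the exponential decay absorbs the linear factor.\<close>

lemma mult_exp_minus_le:
  fixes x :: real
  assumes "c > 0"
  shows "x * exp (- 2 * c * x) \<le> 1 / c * exp (- c * x)"
proof -
  have "c * x \<le> exp (c * x)" using exp_ge_add_one_self[of "c * x"] by linarith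
  then have "c * x * exp (- 2 * c * x) \<le> exp (c * x) * exp (- 2 * c * x)" by (intro mult_right_mono) auto
  also have "\<dots> = exp (- c * x)" by (simp flip: exp_add)
  finally have "1 / c * (c * x * exp (- 2 * c * x)) \<le> 1 / c * exp (- c * x)"
    using assms by (intro mult_left_mono) auto
  then show ?thesis using assms by simp
qed

lemma exp_minus_divide_mono:
  fixes a b c :: real
  assumes "c * b \<le> a / n"
  shows "exp (- a / n) \<le> exp (- c * b)"
  using assms by simp

context cyl
begin

lemma R_mono: "i \<le> j \<Longrightarrow> R i \<subseteq> R j"
  by (auto simp: mem_R)

text \<open>
  With \<open>\<delta> = 1 / 640\<close> at most \<open>N J / 16\<close> particles exceed the volume of \<open>R H\<close>, which is what
  \<open>grow_shape\<close> needs to climb only \<open>J\<close> levels; \<open>204800 = 1 / (2 \<delta>\<^sup>2)\<close> makes its error at most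
  \<open>exp (- 4 J / N)\<close>.
\<close>

lemma contraction:
  fixes J :: nat
  assumes N: "204800 \<le> N" and J: "32 \<le> J" "real N * exp (- real J / real N) \<le> 1"
    and A: "A \<in> configs N" "A \<subseteq> R (int (4 * J))"
  shows "measure_pmf.prob (grow (16 * N * J) A) {B. \<not> shift_down N B \<subseteq> R (int (2 * J))}
    \<le> 28 * real N ^ 3 * exp (- 2 * real J / real N)"
proof -
  define X where "X = real J / real N"
  define Bad where "Bad = {B. \<not> (\<exists>H\<ge>0. R H \<subseteq> B \<and> B \<subseteq> R (H + int (2 * J)))}"
  \<comment> \<open>Enough particles for 16 J full levels. A flat cluster of that size fills
    \<open>R (12 * int J)\<close> (the case \<delta> = 1 / 4 of \<open>grow_not_full\<close>), which
    leaves more than 8 J levels for mixing above the height 4 J of \<open>A\<close>.\<close>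
  define t where "t = 16 * N * J"
  define n where "n = t + config_size A"
  define u where "u = real n / real N"
  define \<delta> :: real where "\<delta> = 1 / 640"
  define H where "H = \<lfloor>(1 - \<delta>) * u\<rfloor>"
  define E where "E = exp (- 4 * X)"
  have Np: "real N > 0" "real N \<ge> 204800" using N3 N by auto
  have size: "real (config_size A) \<le> 4 * real N * real J"
  proof -
    have "config_size A \<le> N * (4 * J)" by (rule config_size_le[OF A])
    then have "real (config_size A) \<le> real (N * (4 * J))" by (simp only: of_nat_le_iff)
    then show ?thesis by simp
  qed
  have u: "16 * real J \<le> u" "u \<le> 20 * real J"
    using size Np by (simp_all add: u_def n_def t_def field_simps)
  have H: "real_of_int H \<le> (1 - \<delta>) * u" "(1 - \<delta>) * u < real_of_int H + 1" unfolding H_def by linarith+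
  have H0: "0 \<le> H" unfolding H_def using u by (simp add: \<delta>_def)
  have EXP: "exp (- c * real J) \<le> E" if "4 \<le> c * real N" for c
  proof -
    have "4 * real J \<le> c * real N * real J" using that by (intro mult_right_mono) auto
    then have "4 * X \<le> c * real J" using Np by (simp add: X_def divide_le_eq mult_ac)
    then show ?thesis by (simp add: E_def)
  qed
  have shape: "measure_pmf.prob (grow n (R 0)) Bad \<le> 40 * real N * real J * E"
  proof -
    have "measure_pmf.prob (grow n (R 0)) Bad \<le>
        measure_pmf.prob (grow n (R 0)) {A. \<not> (R H \<subseteq> A \<and> A \<subseteq> R (H + int J + int J))}"
    proof (rule measure_pmf.finite_measure_mono)
      have "H + int J + int J = H + int (2 * J)" by simp
      then show "Bad \<subseteq> {A. \<not> (R H \<subseteq> A \<and> A \<subseteq> R (H + int J + int J))}"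
        using H0 unfolding Bad_def by (metis (mono_tags, lifting) mem_Collect_eq subsetI)
    qed simp
    also have "\<dots> \<le> real N * real_of_int H * exp (- (\<delta>\<^sup>2 / 2) * (real n / real N)) + real n * exp (- real J)"
    proof (rule grow_shape[OF H0])
      show "16 * (real n - real N * real_of_int H) \<le> real N * real J"
      proof -
        have "real n = real N * u" using Np by (simp add: u_def)
        then have "16 * (real n - real N * real_of_int H) = real N * (16 * (u - real_of_int H))"
          by (simp add: algebra_simps)
        also have "\<dots> \<le> real N * real J"
        proof (rule mult_left_mono)
          \<comment> \<open>Rounding is absorbed here: u - H is at most 20 J / 640 + 1 = J / 32 + 1,
            and 1 is at most J / 32.\<close>
          have "32 \<le> real J" using J(1) by simp
          moreover have "u - u / 640 < real_of_int H + 1" using H(2) by (simp add: \<delta>_def left_diff_distrib)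
          then have "640 * u - u < 640 * real_of_int H + 640" by simp
          ultimately show "16 * (u - real_of_int H) \<le> real J" using u(2) by simp
        qed simp
        finally show ?thesis .
      qed
      show "real_of_int H \<le> (1 - \<delta>) * (real n / real N)" using H(1) by (simp only: u_def)
    qed (use J(2) in \<open>auto simp: \<delta>_def\<close>)
    also have "\<dots> \<le> 20 * real N * real J * E + 20 * real N * real J * E"
    proof (rule add_mono)
      have "u - u / 640 \<le> u" using u by simp
      then have "real_of_int H \<le> u" using H(1) by (simp add: \<delta>_def left_diff_distrib)
      then have "real_of_int H \<le> 20 * real J" using u by simp
      moreover have "exp (- (\<delta>\<^sup>2 / 2) * (real n / real N)) \<le> E"
      proof -
        have "(\<delta>\<^sup>2 / 2) * (16 * real J) \<le> (\<delta>\<^sup>2 / 2) * (real n / real N)"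
          using u by (intro mult_left_mono) (auto simp: u_def)
        moreover have "(\<delta>\<^sup>2 / 2) * (16 * real J) = (8 * \<delta>\<^sup>2) * real J" by simp
        ultimately have "exp (- (\<delta>\<^sup>2 / 2) * (real n / real N)) \<le> exp (- (8 * \<delta>\<^sup>2) * real J)"
          unfolding mult_minus_left exp_le_cancel_iff neg_le_iff_le by (simp only:)
        also have "\<dots> \<le> E" by (rule EXP) (use Np in \<open>simp add: \<delta>_def power2_eq_square\<close>)
        finally show ?thesis .
      qed
      ultimately have "real N * (real_of_int H * exp (- (\<delta>\<^sup>2 / 2) * (real n / real N))) \<le> real N * (20 * real J * E)"
        using H0 by (intro mult_left_mono mult_mono) auto
      then show "real N * real_of_int H * exp (- (\<delta>\<^sup>2 / 2) * (real n / real N)) \<le> 20 * real N * real J * E"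
        by (simp add: mult_ac)
    next
      have "real n \<le> 20 * real N * real J" using u Np by (simp add: u_def field_simps)
      moreover have "exp (- real J) \<le> E" using EXP[of 1] Np by simp
      ultimately show "real n * exp (- real J) \<le> 20 * real N * real J * E" by (intro mult_mono) (auto simp: E_def)
    qed
    also have "\<dots> = 40 * real N * real J * E" by simp
    finally show ?thesis .
  qed
  have flat: "measure_pmf.prob (grow t (R 0)) {B. \<not> R (12 * int J) \<subseteq> B} \<le> 12 * real N * real J * E"
  proof -
    have "measure_pmf.prob (grow t (R 0)) {B. \<not> R (12 * int J) \<subseteq> B} \<le>
      real N * real_of_int (12 * int J) * exp (- ((1 / 4)\<^sup>2 / 2) * (real t / real N))"
      by (rule grow_not_full) (use Np in \<open>auto simp: t_def\<close>)
    also have "exp (- ((1 / 4)\<^sup>2 / 2) * (real t / real N)) = exp (- (1 / 2) * real J)"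
      using Np by (simp add: t_def power2_eq_square)
    also have "\<dots> \<le> E" by (rule EXP) (use Np in simp)
    finally show ?thesis using Np by (simp add: mult_left_mono)
  qed
  define Z where "Z = real_of_int (12 * int J + 1 - int (4 * J))"
  have mix: "real (config_size A) * (real N * exp (- Z / real N)) \<le> 4 * real N * real N * real J * E"
  proof -
    have "4 * X = 4 * real J / real N" by (simp add: X_def)
    also have "\<dots> \<le> Z / real N"
      using Np by (intro divide_right_mono) (auto simp: Z_def)
    finally have "exp (- Z / real N) \<le> E" unfolding E_def by (rule exp_minus_divide_mono)
    then have "real (config_size A) * (real N * exp (- Z / real N)) \<le> (4 * real N * real J) * (real N * E)"
      by (intro mult_mono size mult_left_mono) auto
    also have "(4 * real N * real J) * (real N * E) = 4 * real N * real N * real J * E" by simp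
    finally show ?thesis .
  qed
  have "\<bar>measure_pmf.prob (grow t A) Bad - measure_pmf.prob (grow n (R 0)) Bad\<bar>
      \<le> measure_pmf.prob (grow t (R 0)) {B. \<not> R (12 * int J) \<subseteq> B}
        + real (config_size A) * (real N * exp (- Z / real N))"
    unfolding n_def Z_def by (rule grow_near_flat[OF A]) auto
  then have "measure_pmf.prob (grow t A) Bad \<le> 52 * real N * real J * E + 4 * real N * real N * real J * E"
    using shape flat mix by linarith
  also have "52 * real N * real J * E \<le> real N * real N * real J * E"
    using Np by (intro mult_right_mono) (auto simp: E_def)
  \<comment> \<open>J = N X supplies the third factor N, and the exponent is written as 2 * 2 to
    match \<open>mult_exp_minus_le\<close> with c = 2.\<close>
  also have "real N * real N * real J * E + 4 * real N * real N * real J * E = 5 * real N ^ 3 * (X * exp (- 2 * 2 * X))"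
    using Np by (simp add: X_def E_def power3_eq_cube)
  also have "\<dots> \<le> 5 * real N ^ 3 * (1 / 2 * exp (- 2 * X))"
    by (intro mult_left_mono mult_exp_minus_le) auto
  also have "\<dots> \<le> 28 * real N ^ 3 * exp (- 2 * X)" by simp
  finally have "measure_pmf.prob (grow t A) Bad \<le> 28 * real N ^ 3 * exp (- 2 * X)" by simp
  moreover have "measure_pmf.prob (grow t A) {B. \<not> shift_down N B \<subseteq> R (int (2 * J))} \<le> measure_pmf.prob (grow t A) Bad"
  proof (rule measure_pmf.finite_measure_mono_AE)
    show "AE B in grow t A. B \<in> {B. \<not> shift_down N B \<subseteq> R (int (2 * J))} \<longrightarrow> B \<in> Bad"
      unfolding AE_measure_pmf_iff
    proof (intro ballI impI)
      fix B assume B: "B \<in> set_pmf (grow t A)" "B \<in> {B. \<not> shift_down N B \<subseteq> R (int (2 * J))}"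
      show "B \<in> Bad"
      proof (rule ccontr)
        assume "B \<notin> Bad"
        then obtain K where K: "0 \<le> K" "R K \<subseteq> B" "B \<subseteq> R (K + int (2 * J))" by (auto simp: Bad_def)
        \<comment> \<open>\<open>B\<close> lies below K + 2 J and the shift removes at least K
          levels.\<close>
        have "nat K \<le> full_height N B"
          using K by (intro full_height_ge grow_configs[OF A(1) B(1)]) auto
        then have "shift_down N B \<subseteq> R (int (2 * J))"
          using K unfolding shift_down_eq by (force simp: lower_def mem_R cylinder_def)
        with B(2) show False by simp
      qed
    qed
  qed simp
  ultimately show ?thesis by (simp add: t_def X_def)
qed

lemma stationary_contraction:
  fixes J :: nat
  assumes N: "204800 \<le> N" and J: "32 \<le> J" "real N * exp (- real J / real N) \<le> 1"
    and supp: "set_pmf p \<subseteq> configs N"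
    and st: "bind_pmf p (\<lambda>A. map_pmf (shift_down N) (settle_unif A)) = p"
  shows "measure_pmf.prob p {A. \<not> A \<subseteq> R (int (2 * J))} \<le>
    measure_pmf.prob p {A. \<not> A \<subseteq> R (int (4 * J))} + 28 * real N ^ 3 * exp (- 2 * real J / real N)"
proof -
  define t where "t = 16 * N * J"
  define q where "q = 28 * real N ^ 3 * exp (- 2 * real J / real N)"
  define Y where "Y = {A. \<not> A \<subseteq> R (int (4 * J))}"
  have q0: "0 \<le> q" by (simp add: q_def)
  have intY: "integrable (measure_pmf p) (\<lambda>A. indicator Y A :: real)"
    by (rule integrable_bounded_pmf[of _ 1]) (simp add: indicator_def)
  obtain s where s: "t = Suc s" using J N3 by (cases t) (auto simp: t_def)
  have "measure_pmf.prob p {A. \<not> A \<subseteq> R (int (2 * J))} =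
      measure_pmf.prob (map_pmf (shift_down N) (bind_pmf p (grow t))) {A. \<not> A \<subseteq> R (int (2 * J))}"
    unfolding s stationary_grow[OF supp st] ..
  also have "\<dots> = measure_pmf.expectation p (\<lambda>A. measure_pmf.prob (grow t A) {B. \<not> shift_down N B \<subseteq> R (int (2 * J))})"
    by (simp add: measure_bind_pmf vimage_def)
  also have "\<dots> \<le> measure_pmf.expectation p (\<lambda>A. indicator Y A + q)"
  proof (rule integral_mono_AE)
    show "integrable (measure_pmf p) (\<lambda>A. measure_pmf.prob (grow t A) {B. \<not> shift_down N B \<subseteq> R (int (2 * J))})"
      by (rule integrable_bounded_pmf[of _ 1]) simp
    show "AE A in p. measure_pmf.prob (grow t A) {B. \<not> shift_down N B \<subseteq> R (int (2 * J))} \<le> indicator Y A + q"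
      unfolding AE_measure_pmf_iff
    proof
      fix A assume A: "A \<in> set_pmf p"
      show "measure_pmf.prob (grow t A) {B. \<not> shift_down N B \<subseteq> R (int (2 * J))} \<le> indicator Y A + q"
      proof (cases "A \<in> Y")
        case True
        have "measure_pmf.prob (grow t A) {B. \<not> shift_down N B \<subseteq> R (int (2 * J))} \<le> 1" by simp
        also have "1 \<le> indicator Y A + q" using True q0 by simp
        finally show ?thesis .
      next
        case False
        then show ?thesis using contraction[OF N J, of A] A supp by (auto simp: Y_def q_def t_def)
      qed
    qed
  qed (use intY in simp)
  also have "\<dots> = measure_pmf.prob p Y + q" using intY by simp
  finally show ?thesis by (simp add: Y_def q_def)
qed

text \<open>Continuity from above: each configuration has finite height, so the events decrease to
  the empty set. This is the end term of the telescoping sum below.\<close>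

lemma unbounded_configs_vanish:
  assumes supp: "set_pmf p \<subseteq> configs N" and J: "0 < J"
  shows "(\<lambda>i. measure_pmf.prob p {A. \<not> A \<subseteq> R (int (2 * (2 ^ i * J)))}) \<longlonglongrightarrow> 0"
proof -
  define S where "S i = {A \<in> configs N. \<not> A \<subseteq> R (int (2 * (2 ^ i * J)))}" for i
  have "(\<lambda>i. measure_pmf.prob p (S i)) \<longlonglongrightarrow> measure_pmf.prob p (\<Inter>i. S i)"
  proof (rule measure_pmf.finite_Lim_measure_decseq)
    show "decseq S"
    proof (rule decseq_SucI)
      fix i
      have "int (2 * (2 ^ i * J)) \<le> int (2 * (2 ^ Suc i * J))" by simp
      then have "R (int (2 * (2 ^ i * J))) \<subseteq> R (int (2 * (2 ^ Suc i * J)))" by (rule R_mono)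
      then show "S (Suc i) \<subseteq> S i" unfolding S_def by blast
    qed
  qed simp
  moreover have "(\<Inter>i. S i) = {}"
  proof (rule ccontr)
    assume "(\<Inter>i. S i) \<noteq> {}"
    then obtain A where A: "A \<in> configs N" "\<And>i. \<not> A \<subseteq> R (int (2 * (2 ^ i * J)))" by (auto simp: S_def)
    obtain M where M: "\<And>v. v \<in> A \<Longrightarrow> snd v \<le> M"
      using configs_split(5)[OF A(1)] unfolding bounded_above_def by blast
    have "nat M < 2 ^ nat M" by (rule less_exp)
    also have "2 ^ nat M \<le> 2 * (2 ^ nat M * J)" using J by simp
    finally have "M \<le> int (2 * (2 ^ nat M * J))" by linarith
    then have "A \<subseteq> R (int (2 * (2 ^ nat M * J)))"
      using M configs_split(4)[OF A(1)] by (fastforce simp: mem_R)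
    with A(2) show False by blast
  qed
  moreover have "measure_pmf.prob p (S i) = measure_pmf.prob p {A. \<not> A \<subseteq> R (int (2 * (2 ^ i * J)))}" for i
    by (rule measure_pmf.finite_measure_eq_AE) (use supp in \<open>auto simp: AE_measure_pmf_iff S_def\<close>)
  ultimately show ?thesis by simp
qed

text \<open>Doubling the height squares the exponential e in \<open>r\<close>, and N e at most 1
  forces e at most 1 / 2. Hence the error 28 N^3 e^2 of one contraction is at most
  \<open>r i - r (Suc i)\<close>, and the errors telescope.\<close>

lemma stationary_height:
  fixes J :: nat
  assumes N: "204800 \<le> N" and J: "32 \<le> J" "real N * exp (- real J / real N) \<le> 1"
    and supp: "set_pmf p \<subseteq> configs N"
    and st: "bind_pmf p (\<lambda>A. map_pmf (shift_down N) (settle_unif A)) = p"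
  shows "measure_pmf.prob p {A. \<not> A \<subseteq> R (int (2 * J))} \<le> 56 * real N ^ 3 * exp (- real J / real N)"
proof -
  define g where "g i = measure_pmf.prob p {A. \<not> A \<subseteq> R (int (2 * (2 ^ i * J)))}" for i
  define r where "r i = 56 * real N ^ 3 * exp (- real (2 ^ i * J) / real N)" for i :: nat
  have Np: "real N > 0" using N3 by simp
  have step: "g i \<le> g (Suc i) + (r i - r (Suc i))" for i
  proof -
    define e where "e = exp (- real (2 ^ i * J) / real N)"
    have "1 * J \<le> 2 ^ i * J" by (intro mult_right_mono) auto
    then have J': "J \<le> 2 ^ i * J" by simp
    then have "- real (2 ^ i * J) / real N \<le> - real J / real N"
      using Np by (intro divide_right_mono) (auto simp del: of_nat_mult of_nat_power)
    then have "e \<le> exp (- real J / real N)" by (simp add: e_def del: of_nat_mult of_nat_power)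
    then have Ne: "real N * e \<le> 1" using J(2) mult_left_mono[of e "exp (- real J / real N)" "real N"] Np by linarith
    have e0: "0 < e" by (simp add: e_def)
    have "2 * e \<le> real N * e" using N e0 by (intro mult_right_mono) auto
    then have "e \<le> 1 / 2" using Ne by simp
    have e2: "exp (- 2 * real (2 ^ i * J) / real N) = e * e"
      unfolding e_def by (simp add: field_simps flip: exp_add)
    have e2': "exp (- real (2 ^ Suc i * J) / real N) = e * e"
      unfolding e_def by (simp add: field_simps flip: exp_add)
    have J32: "32 \<le> 2 ^ i * J" using J' J(1) by linarith
    have eq: "2 * (2 ^ Suc i * J) = 4 * (2 ^ i * J)" by simp
    have "g i \<le> g (Suc i) + 28 * real N ^ 3 * (e * e)"
      using stationary_contraction[OF N J32 Ne[unfolded e_def] supp st] unfolding g_def eq e2 .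
    also have "28 * real N ^ 3 * (e * e) \<le> r i - r (Suc i)"
    proof -
      have "28 * (e * e) \<le> 56 * e - 56 * (e * e)"
        using \<open>e \<le> 1 / 2\<close> e0 mult_left_mono[of e "1 / 2" e] by simp
      then have "real N ^ 3 * (28 * (e * e)) \<le> real N ^ 3 * (56 * e - 56 * (e * e))"
        by (intro mult_left_mono) auto
      moreover have "r i = 56 * real N ^ 3 * e" by (simp only: r_def e_def)
      moreover have "r (Suc i) = 56 * real N ^ 3 * (e * e)" by (simp only: r_def e2')
      ultimately show ?thesis by (simp add: algebra_simps)
    qed
    finally show ?thesis by simp
  qed
  have tel: "g 0 \<le> g i + r 0" for i
  proof -
    have "g 0 \<le> g i + (r 0 - r i)"
    proof (induction i)
      case (Suc i)
      then show ?case using step[of i] by linarith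
    qed simp
    moreover have "0 \<le> r i" by (simp add: r_def)
    ultimately show ?thesis by linarith
  qed
  have "(\<lambda>i. g i + r 0) \<longlonglongrightarrow> 0 + r 0"
    unfolding g_def using J by (intro tendsto_add unbounded_configs_vanish supp tendsto_const) auto
  then have "g 0 \<le> 0 + r 0" by (rule LIMSEQ_le_const) (use tel in auto)
  then show ?thesis by (simp add: g_def r_def)
qed

text \<open>Both laws are compared with \<open>grow (t + config_size A) (R 0)\<close>, which is
  where equality of sizes enters. Time t supplies 8 J levels of particles, half of which are
  certified as filled; this leaves more than 2 J levels for mixing above height 2 J.\<close>

lemma same_size_laws_close:
  fixes J t :: nat
  assumes A: "A \<in> configs N" "A \<subseteq> R (int (2 * J))" and A': "A' \<in> configs N" "A' \<subseteq> R (int (2 * J))"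
    and size: "config_size A = config_size A'" and t: "8 * N * J \<le> t"
  shows "\<bar>measure_pmf.prob (grow t A) S - measure_pmf.prob (grow t A') S\<bar> \<le> 12 * real N ^ 3 * exp (- real J / real N)"
proof -
  define X where "X = real J / real N"
  define e where "e = measure_pmf.prob (grow t (R 0)) {B. \<not> R (4 * int J) \<subseteq> B}
      + real (config_size A) * (real N * exp (- real_of_int (4 * int J + 1 - int (2 * J)) / real N))"
  have Np: "real N > 0" "real N \<ge> 1" using N3 by auto
  have t': "8 * real J \<le> real t / real N"
  proof -
    have "real (8 * N * J) \<le> real t" using t by (simp only: of_nat_le_iff)
    then show ?thesis using Np by (simp add: field_simps)
  qed
  have "\<bar>measure_pmf.prob (grow t B) S - measure_pmf.prob (grow (t + config_size B) (R 0)) S\<bar> \<le> e"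
    if "B \<in> configs N" "B \<subseteq> R (int (2 * J))" "config_size B = config_size A" for B
    using grow_near_flat[OF that(1,2), of "4 * int J" t S] that(3) by (simp add: e_def)
  from this[OF A refl] this[OF A' size[symmetric]]
  have "\<bar>measure_pmf.prob (grow t A) S - measure_pmf.prob (grow t A') S\<bar> \<le> 2 * e"
    unfolding size by linarith
  also have "e \<le> 6 * real N ^ 3 * exp (- X)"
  proof -
    define E where "E = exp (- 2 * X)"
    have "real J * 2 \<le> real J * real N" using N3 by (intro mult_left_mono) auto
    then have X: "2 * X \<le> real J" "0 \<le> X" using Np by (auto simp: X_def field_simps)
    have "measure_pmf.prob (grow t (R 0)) {B. \<not> R (4 * int J) \<subseteq> B} \<le>
        real N * real_of_int (4 * int J) * exp (- ((1 / 2)\<^sup>2 / 2) * (real t / real N))"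
      by (rule grow_not_full) (use t' in auto)
    also have "\<dots> \<le> real N * real_of_int (4 * int J) * E"
    proof (intro mult_left_mono)
      \<comment> \<open>The exponent on the right is at least 1 / 8 times 8 J, that is J, and J = N
        X exceeds 2 X.\<close>
      have "2 * X \<le> ((1 / 2)\<^sup>2 / 2) * (real t / real N)" using X t' by (simp add: power2_eq_square)
      then show "exp (- ((1 / 2)\<^sup>2 / 2) * (real t / real N)) \<le> E" unfolding E_def by simp
    qed simp
    also have "\<dots> = 4 * (real N * real J * E) * 1" by simp
    also have "\<dots> \<le> 4 * (real N * real J * E) * real N" using Np by (intro mult_left_mono) (auto simp: E_def)
    finally have 1: "measure_pmf.prob (grow t (R 0)) {B. \<not> R (4 * int J) \<subseteq> B} \<le> 4 * (real N * real N * real J * E)"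
      by (simp add: mult_ac)
    have "config_size A \<le> N * (2 * J)" by (rule config_size_le[OF A])
    then have "real (config_size A) \<le> real (N * (2 * J))" by (simp only: of_nat_le_iff)
    then have "real (config_size A) \<le> 2 * real N * real J" by simp
    moreover have "exp (- real_of_int (4 * int J + 1 - int (2 * J)) / real N) \<le> E"
      using Np by (simp add: E_def X_def field_simps)
    ultimately have "real (config_size A) * (real N * exp (- real_of_int (4 * int J + 1 - int (2 * J)) / real N))
        \<le> 2 * real N * real J * (real N * E)"
      by (intro mult_mono) auto
    with 1 have "e \<le> 6 * (real N * real N * real J * E)" by (simp add: e_def mult_ac)
    also have "\<dots> = 6 * real N ^ 3 * (X * exp (- 2 * 1 * X))"
      using Np by (simp add: X_def E_def power3_eq_cube)
    also have "\<dots> \<le> 6 * real N ^ 3 * (1 / 1 * exp (- 1 * X))"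
      by (intro mult_left_mono mult_exp_minus_le) auto
    finally show ?thesis by simp
  qed
  finally show ?thesis by (simp add: X_def)
qed


text \<open>The bound on atoms sums to arbitrary events because both laws are discrete on the
  countable set of configurations.\<close>

lemma lukewarm_measure_le:
  assumes \<nu>: "lukewarm_start N k \<mu> \<nu>" and \<mu>: "config_distribution N \<mu>" and S: "S \<subseteq> configs N"
  shows "measure \<nu> S \<le> real N ^ k * measure \<mu> S"
proof -
  have c\<nu>: "config_distribution N \<nu>" and le: "\<And>A. A \<in> configs N \<Longrightarrow> measure \<nu> {A} \<le> real N ^ k * measure \<mu> {A}"
    using \<nu> by (auto simp: lukewarm_start_def)
  obtain p where p: "\<And>S. S \<subseteq> configs N \<Longrightarrow> emeasure \<mu> S = emeasure (measure_pmf p) S"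
    using config_distribution_pmf[OF \<mu>] by metis
  obtain q where q: "\<And>S. S \<subseteq> configs N \<Longrightarrow> emeasure \<nu> S = emeasure (measure_pmf q) S"
    using config_distribution_pmf[OF c\<nu>] by metis
  have pq: "pmf q A \<le> real N ^ k * pmf p A" if "A \<in> S" for A
  proof -
    have "A \<in> configs N" using S that by blast
    then show ?thesis using le[of A] p[of "{A}"] q[of "{A}"] by (simp add: measure_def emeasure_pmf_single)
  qed
  have "emeasure q S = (\<integral>\<^sup>+A. ennreal (pmf q A) \<partial>count_space S)" by (simp add: nn_integral_pmf)
  also have "\<dots> \<le> (\<integral>\<^sup>+A. ennreal (real N ^ k) * ennreal (pmf p A) \<partial>count_space S)"
    using pq by (intro nn_integral_mono) (auto simp: ennreal_mult[symmetric] intro!: ennreal_leI)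
  also have "\<dots> = ennreal (real N ^ k) * emeasure p S" by (simp add: nn_integral_cmult nn_integral_pmf)
  finally have "ennreal (measure_pmf.prob q S) \<le> ennreal (real N ^ k * measure_pmf.prob p S)"
    by (simp add: measure_pmf.emeasure_eq_measure ennreal_mult)
  then have "measure_pmf.prob q S \<le> real N ^ k * measure_pmf.prob p S" by (subst (asm) ennreal_le_iff) auto
  then show ?thesis using p[OF S] q[OF S] by (simp add: measure_def)
qed

lemma tv_idla_law_le:
  assumes A: "A \<in> configs N" "A' \<in> configs N"
    and le: "\<And>S. \<bar>measure_pmf.prob (grow (nat \<lfloor>t\<rfloor>) A) S - measure_pmf.prob (grow (nat \<lfloor>t\<rfloor>) A') S\<bar> \<le> e"
  shows "tv_dist (idla_law N A t) (idla_law N A' t) \<le> e"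
  unfolding tv_dist_def
proof (rule cSUP_least)
  show "sets (idla_law N A t) \<noteq> {}" by (metis empty_iff sets.empty_sets)
  fix S assume "S \<in> sets (idla_law N A t)"
  then have "S \<subseteq> configs N" by (simp add: idla_law_def)
  then show "\<bar>measure (idla_law N A t) S - measure (idla_law N A' t) S\<bar> \<le> e"
    using le A by (simp add: measure_idla_law)
qed

end

theorem theorem1p3:
  fixes \<gamma> :: real and k :: nat
  assumes "\<gamma> > 0"
  shows "\<exists>(d :: real) (G :: nat \<Rightarrow> site set set).
    d > 0 \<and> (\<forall>N\<ge>3. G N \<subseteq> configs N) \<and>
    (\<exists>N0\<ge>3. \<forall>N\<ge>N0.
      (\<forall>\<mu> \<nu>. stationary_shifted_idla N \<mu> \<longrightarrow> lukewarm_start N k \<mu> \<nu> \<longrightarrow>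
         measure \<nu> (G N) \<ge> 1 - real N powr (-\<gamma>)) \<and>
      (\<forall>A\<in>G N. \<forall>A'\<in>G N. config_size A = config_size A' \<longrightarrow>
         tv_dist (idla_law N A (d * real N ^ 2 * ln (real N)))
                 (idla_law N A' (d * real N ^ 2 * ln (real N))) \<le> real N powr (-\<gamma>)))"
proof -
  \<comment> \<open>The exponent pays for \<gamma>, for the factor N^k of the lukewarm start, for
    N^3 in the error bounds, and for one more N that beats the constant 56.\<close>
  define K where "K = \<gamma> + real k + 4"
  \<comment> \<open>Chosen so that 8 N J, with J at most K L + 1 and L = N log N at least 1, stays
    below d N^2 log N.\<close>
  define d where "d = 8 * K + 8"
  \<comment> \<open>About K N log N levels, so that the mixing error \<open>exp (- J / N)\<close> is
    at most N^(-K).\<close>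
  define J where "J N = nat \<lceil>K * (real N * ln (real N))\<rceil>" for N
  define G where "G N = {A \<in> configs N. A \<subseteq> filled N (int (2 * J N))}" for N
  have K: "K > 4" using assms by (simp add: K_def)
  have main: "(\<forall>\<mu> \<nu>. stationary_shifted_idla N \<mu> \<longrightarrow> lukewarm_start N k \<mu> \<nu> \<longrightarrow>
         measure \<nu> (G N) \<ge> 1 - real N powr (-\<gamma>)) \<and>
      (\<forall>A\<in>G N. \<forall>A'\<in>G N. config_size A = config_size A' \<longrightarrow>
         tv_dist (idla_law N A (d * real N ^ 2 * ln (real N)))
                 (idla_law N A' (d * real N ^ 2 * ln (real N))) \<le> real N powr (-\<gamma>))"
    if N: "204800 \<le> N" for N
  proof -
    interpret cyl N by unfold_locales (use N in simp)
    have Np: "real N \<ge> 204800" "real N > 0" using N by auto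
    have ln1: "1 \<le> ln (real N)"
      using Np exp_le by (subst ln_ge_iff) auto
    define L where "L = real N * ln (real N)"
    have L: "real N \<le> L" using ln1 Np mult_left_mono[of 1 "ln (real N)" "real N"] by (simp add: L_def)
    have KL: "4 * L \<le> K * L" using K L Np by (intro mult_right_mono) auto
    have J: "K * L \<le> real (J N)" "real (J N) \<le> K * L + 1"
      using KL L Np unfolding J_def L_def[symmetric] by linarith+
    have J32: "32 \<le> J N" using J(1) KL L Np by linarith
    have eJ: "exp (- real (J N) / real N) \<le> real N powr (- K)"
    proof -
      have "K * ln (real N) \<le> real (J N) / real N"
        using J(1) Np by (simp add: L_def field_simps)
      then show ?thesis using Np by (simp add: powr_def)
    qed
    have e56: "56 * real N ^ 3 * exp (- real (J N) / real N) \<le> real N powr (- \<gamma>) / real N ^ k"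
    proof -
      have "56 * real N ^ 3 * exp (- real (J N) / real N) \<le> 56 * real N ^ 3 * real N powr (- K)"
        by (intro mult_left_mono eJ) auto
      also have "real N powr (- K) = real N powr (- \<gamma>) / real N ^ k / real N ^ 4"
        using Np by (simp add: K_def powr_diff powr_realpow powr_numeral powr_minus powr_add divide_simps)
      also have "56 * real N ^ 3 * (real N powr (- \<gamma>) / real N ^ k / real N ^ 4) =
          56 / real N * (real N powr (- \<gamma>) / real N ^ k)"
        using Np by (simp add: power4_eq_xxxx power3_eq_cube)
      also have "\<dots> \<le> 1 * (real N powr (- \<gamma>) / real N ^ k)"
        using Np by (intro mult_right_mono) auto
      finally show ?thesis by simp
    qed
    have NeJ: "real N * exp (- real (J N) / real N) \<le> 1"
    proof -
      have "real N powr (- K) \<le> real N powr (- 1)" using K Np by (intro powr_mono) auto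
      then have "exp (- real (J N) / real N) \<le> 1 / real N" using eJ Np by (simp add: powr_minus_divide)
      then show ?thesis using Np by (simp add: field_simps)
    qed
    show ?thesis
    proof (intro conjI allI impI ballI)
      fix \<mu> \<nu> assume \<mu>: "stationary_shifted_idla N \<mu>" and \<nu>: "lukewarm_start N k \<mu> \<nu>"
      have c: "config_distribution N \<mu>" "config_distribution N \<nu>"
        using \<mu> \<nu> by (auto simp: stationary_shifted_idla_def lukewarm_start_def)
      obtain p where p: "set_pmf p \<subseteq> configs N" "\<And>S. S \<subseteq> configs N \<Longrightarrow> measure \<mu> S = measure_pmf.prob p S"
        "bind_pmf p (\<lambda>A. map_pmf (shift_down N) (settle_unif A)) = p"
        using stationary_pmf[OF \<mu>] by blast
      interpret \<nu>: prob_space \<nu> using c by (simp add: config_distribution_def)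
      have s\<nu>: "sets \<nu> = Pow (configs N)" "space \<nu> = configs N"
        using c config_distribution_pmf[OF c(2)] by (auto simp: config_distribution_def)
      have "measure \<nu> (configs N - G N) \<le> real N ^ k * measure \<mu> (configs N - G N)"
        by (rule lukewarm_measure_le[OF \<nu> c(1)]) auto
      also have "measure \<mu> (configs N - G N) = measure_pmf.prob p (configs N - G N)"
        by (rule p(2)) auto
      also have "\<dots> \<le> measure_pmf.prob p {A. \<not> A \<subseteq> R (int (2 * J N))}"
        by (rule measure_pmf.finite_measure_mono) (auto simp: G_def)
      also have "\<dots> \<le> 56 * real N ^ 3 * exp (- real (J N) / real N)"
        by (rule stationary_height[OF N J32 NeJ p(1,3)])
      also note e56
      finally have "measure \<nu> (configs N - G N) \<le> real N powr (- \<gamma>)"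
        using Np by (simp add: mult_left_mono)
      moreover have "measure \<nu> (configs N - G N) = 1 - measure \<nu> (G N)"
        using \<nu>.prob_compl[of "G N"] s\<nu> by (simp add: G_def)
      ultimately show "measure \<nu> (G N) \<ge> 1 - real N powr (- \<gamma>)" by simp
    next
      fix A A' assume A: "A \<in> G N" "A' \<in> G N" and size: "config_size A = config_size A'"
      define t where "t = nat \<lfloor>d * real N ^ 2 * ln (real N)\<rfloor>"
      have "8 * N * J N \<le> t"
        unfolding t_def
      proof (rule le_nat_floor)
        have "real (8 * N * J N) \<le> 8 * real N * (K * L + 1)" using J(2) by (simp add: mult_left_mono)
        also have "\<dots> \<le> 8 * real N * (K * L + L)" using L Np by (intro mult_left_mono) auto
        also have "\<dots> = d * real N ^ 2 * ln (real N)" by (simp add: d_def L_def power2_eq_square algebra_simps)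
        finally show "real (8 * N * J N) \<le> d * real N ^ 2 * ln (real N)" .
      qed
      then have close: "\<bar>measure_pmf.prob (grow t A) S - measure_pmf.prob (grow t A') S\<bar>
          \<le> 12 * real N ^ 3 * exp (- real (J N) / real N)" for S
        using A size by (intro same_size_laws_close) (auto simp: G_def)
      have small: "12 * real N ^ 3 * exp (- real (J N) / real N) \<le> real N powr (- \<gamma>)"
      proof -
        have "12 * real N ^ 3 * exp (- real (J N) / real N) \<le> 56 * real N ^ 3 * exp (- real (J N) / real N)"
          by (intro mult_right_mono) auto
        also note e56
        also have "real N powr (- \<gamma>) / real N ^ k \<le> real N powr (- \<gamma>) / 1"
          using Np by (intro divide_left_mono) auto
        finally show ?thesis by simp
      qed
      show "tv_dist (idla_law N A (d * real N ^ 2 * ln (real N)))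
          (idla_law N A' (d * real N ^ 2 * ln (real N))) \<le> real N powr (- \<gamma>)"
        by (rule tv_idla_law_le)
           (use A close small in \<open>auto simp: G_def t_def intro: order_trans\<close>)
    qed
  qed
  show ?thesis
  proof (intro exI[of _ d] exI[of _ G] conjI exI[of _ "204800 :: nat"] allI impI)
    show "d > 0" using K by (simp add: d_def)
    show "G N \<subseteq> configs N" for N by (auto simp: G_def)
  qed (use main in auto)
qed

end
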